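(* Let $L$ be an algebra that is free of finite rank as an abelian group. If the map $\eta_{*L}:\Gamma_L\backslash\Delta_L\to\widehat\Gamma_L\backslash\widehat\Delta_L$ is bijective, then the sequence $\{T_L(n)\}_{n\ge1}$ in $R_L$ is multiplicative, and the Euler product formula $$D_L(s)=\prod_pP_{L_p}(p^{-s})$$ holds, where $p$ runs through all prime numbers.
   Context: **Hecke rings.** Let $G$ be a group, $\Delta\subset G$ a submonoid, $\Gamma\subset\Delta$ a subgroup such that $\Gamma\backslash\Gamma A\Gamma$ and $\Gamma A\Gamma/\Gamma$ are finite for all $A\in\Delta$. The Hecke ring $R(\Gamma,\Delta)$ is the free abelian group on $\Gamma\backslash\Delta/\Gamma$ with product $(\Gamma A\Gamma)(\Gamma B\Gamma)=\sum_{\Gamma C\Gamma}\#\{\Gamma\beta\in\Gamma\backslash\Gamma B\Gamma : C\beta^{-1}\in\Gamma A\Gamma\}\cdot\Gamma C\Gamma$. **Hecke rings of an algebra.** An algebra is an abelian group with a bi-additive product. For $L$ as in the claim, $L_p=L\otimes\mathbb{Z}_p$. Algebra endomorphisms act on the right; the image of $L$ under $\alpha$ is $L^\alpha$. Put $G_L=\mathrm{Aut}^{alg}_{\mathbb{Q}}(L\otimes\mathbb{Q})$, $\Delta_L=\mathrm{End}^{alg}_{\mathbb{Z}}(L)\cap G_L$, $\Gamma_L=\mathrm{Aut}^{alg}_{\mathbb{Z}}(L)$; for each prime $p$, $G_{L_p}=\mathrm{Aut}^{alg}_{\mathbb{Q}_p}(L\otimes\mathbb{Q}_p)$, $\Delta_{L_p}=\mathrm{End}^{alg}_{\mathbb{Z}_p}(L_p)\cap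 G_{L_p}$, $\Gamma_{L_p}=\mathrm{Aut}^{alg}_{\mathbb{Z}_p}(L_p)$. Let $\widehat G_L$ be the restricted direct product of the $G_{L_p}$ relative to the $\Gamma_{L_p}$, $\widehat\Delta_L=\widehat G_L\cap\prod_p\Delta_{L_p}$, $\widehat\Gamma_L=\prod_p\Gamma_{L_p}$. The Hecke rings of $(\Gamma_L,\Delta_L)$, $(\Gamma_{L_p},\Delta_{L_p})$, $(\widehat\Gamma_L,\widehat\Delta_L)$ are $R_L$, $R_{L_p}$, $\widehat R_L$; double cosets of $\alpha$ are denoted $T_L(\alpha)$, $T_{L_p}(\alpha)$, $\widehat T_L(\alpha)$. $R_{L_p}$ is a subring of $\widehat R_L$ via the inclusion $\Delta_{L_p}\subset\widehat\Delta_L$ (components $1$ away from $p$); $R_{L_p}$ and $R_{L_q}$ commute for $p\ne q$ (known). **Comparison maps.** $\eta_L:\Delta_L\to\widehat\Delta_L$ is the diagonal embedding; $\eta_{*L}:\Gamma_L\backslash\Delta_L\to\widehat\Gamma_L\backslash\widehat\Delta_L$ is the induced map; $\eta_L^*:\widehat R_L\to R_L$ is the additive map $\widehat T_L(\widehat\alpha)\mapsto\sum_\beta T_L(\beta)$, $\beta$ over representatives of $\Gamma_L\backslash\eta_L^{-1}(\widehat\Gamma_L\widehat\alpha\widehat\Gamma_L)/\Gamma_L$. It is known that if $\eta_{*L}$ is bijective then $\eta_L^*$ is an injective ring homomorphism; in that case $\widehat R_L$ (hence each $R_{L_p}$) is regarded as a subring of $R_L$ via $\eta_L^*$. **Series.**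 $T_{L_p}(p^k)=\sum T_{L_p}(\alpha)$ over representatives of $\Gamma_{L_p}\backslash\{\alpha\in\Delta_{L_p}:[L_p:L_p^\alpha]=p^k\}/\Gamma_{L_p}$, and $P_{L_p}(X)=\sum_{k\ge0}T_{L_p}(p^k)X^k$. $T_L(n)=\sum T_L(\alpha)$ over representatives of $\Gamma_L\backslash\{\alpha\in\Delta_L:[L:L^\alpha]=n\}/\Gamma_L$, and $D_L(s)=\sum_{n>0}T_L(n)n^{-s}$, a formal Dirichlet series. Multiplicative means $T_L(1)=1$ and $T_L(mn)=T_L(m)T_L(n)$ for coprime $m,n$. The infinite product is the formal one: its $n^{-s}$-coefficient is $\prod_pT_{L_p}(p^{v_p(n)})$, $v_p$ being the $p$-adic valuation. *)

theory Defs
  imports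
    Complex_Main
    "HOL-Algebra.Free_Abelian_Groups"
    "HOL-Algebra.Generated_Groups"
    "HOL-Algebra.IntRing"
    "HOL-Algebra.Module"
    "HOL-Algebra.QuotRing"
    "HOL-Computational_Algebra.Primes"
begin

section \<open>Algebras and extension of scalars\<close>

text \<open>The product need be neither associative nor unital; the \<open>one\<close> field of the record is ignored.\<close>

locale nonassoc_algebra = abelian_group L for L (structure) +
  assumes prod_closed: "x \<in> carrier L \<Longrightarrow> y \<in> carrier L \<Longrightarrow> x \<otimes> y \<in> carrier L"
    and prod_add_left: "x \<in> carrier L \<Longrightarrow> y \<in> carrier L \<Longrightarrow> z \<in> carrier L \<Longrightarrow>
      (x \<oplus> y) \<otimes> z = x \<otimes> z \<oplus> y \<otimes> z"
    and prod_add_right: "x \<in> carrier L \<Longrightarrow> y \<in> carrier L \<Longrightarrow> z \<in> carrier L \<Longrightarrow>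
      x \<otimes> (y \<oplus> z) = x \<otimes> y \<oplus> x \<otimes> z"

definition int_algebra :: "('a, 'm) ring_scheme \<Rightarrow> (int, 'a) module" where
  "int_algebra L = \<lparr>carrier = carrier L, monoid.mult = monoid.mult L, one = undefined,
     ring.zero = ring.zero L, add = add L, module.smult = (\<lambda>n x. add_pow L n x)\<rparr>"

text \<open>\<open>tensor L R\<close> is the tensor product over the integers: the free abelian group on
  \<open>carrier L \<times> carrier R\<close> modulo the subgroup generated by the biadditivity relations.
  Its elements are cosets of that subgroup.\<close>

definition tensor_free ::
    "('a, 'm) ring_scheme \<Rightarrow> ('r, 'n) ring_scheme \<Rightarrow> ('a \<times> 'r \<Rightarrow>\<^sub>0 int) monoid" where
  "tensor_free L R = free_Abelian_group (carrier L \<times> carrier R)"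

definition tensor_relations ::
    "('a, 'm) ring_scheme \<Rightarrow> ('r, 'n) ring_scheme \<Rightarrow> ('a \<times> 'r \<Rightarrow>\<^sub>0 int) set" where
  "tensor_relations L R = generate (tensor_free L R)
     ({frag_of (x \<oplus>\<^bsub>L\<^esub> y, r) - frag_of (x, r) - frag_of (y, r) | x y r.
         x \<in> carrier L \<and> y \<in> carrier L \<and> r \<in> carrier R} \<union>
      {frag_of (x, r \<oplus>\<^bsub>R\<^esub> s) - frag_of (x, r) - frag_of (x, s) | x r s.
         x \<in> carrier L \<and> r \<in> carrier R \<and> s \<in> carrier R})"

definition tensor_class ::
    "('a, 'm) ring_scheme \<Rightarrow> ('r, 'n) ring_scheme \<Rightarrow> ('a \<times> 'r \<Rightarrow>\<^sub>0 int) \<Rightarrow>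
      ('a \<times> 'r \<Rightarrow>\<^sub>0 int) set" where
  "tensor_class L R c = tensor_relations L R #>\<^bsub>tensor_free L R\<^esub> c"

text \<open>The product is determined by
  \<open>(x \<otimes> r) (y \<otimes> s) = x y \<otimes> r s\<close> and the scalar action by \<open>r (x \<otimes> s) = x \<otimes> r s\<close>.
  As in \<^const>\<open>rcoset_mult\<close>, unions over all representatives avoid choosing one.\<close>

definition tensor ::
    "('a, 'm) ring_scheme \<Rightarrow> ('r, 'n) ring_scheme \<Rightarrow> ('r, ('a \<times> 'r \<Rightarrow>\<^sub>0 int) set) module" where
  "tensor L R = \<lparr>
     carrier = rcosets\<^bsub>tensor_free L R\<^esub> (tensor_relations L R),
     monoid.mult = (\<lambda>X Y. \<Union>c\<in>X. \<Union>d\<in>Y. tensor_class L R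
       (frag_extend (\<lambda>(x, r). frag_extend (\<lambda>(y, s). frag_of (x \<otimes>\<^bsub>L\<^esub> y, r \<otimes>\<^bsub>R\<^esub> s)) d) c)),
     one = undefined,
     ring.zero = tensor_relations L R,
     add = (\<lambda>X Y. X <#>\<^bsub>tensor_free L R\<^esub> Y),
     module.smult = (\<lambda>r X. \<Union>c\<in>X. tensor_class L R
       (frag_extend (\<lambda>(x, s). frag_of (x, r \<otimes>\<^bsub>R\<^esub> s)) c))\<rparr>"

definition pure_tensor ::
    "('a, 'm) ring_scheme \<Rightarrow> ('r, 'n) ring_scheme \<Rightarrow> 'a \<Rightarrow> 'r \<Rightarrow> ('a \<times> 'r \<Rightarrow>\<^sub>0 int) set" where
  "pure_tensor L R x r = tensor_class L R (frag_of (x, r))"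

text \<open>The map \<open>L \<otimes> R \<rightarrow> L \<otimes> S\<close> induced by a ring homomorphism \<open>h: R \<rightarrow> S\<close>.\<close>

definition tensor_map ::
    "('a, 'm) ring_scheme \<Rightarrow> ('s, 'n) ring_scheme \<Rightarrow> ('r \<Rightarrow> 's) \<Rightarrow>
      ('a \<times> 'r \<Rightarrow>\<^sub>0 int) set \<Rightarrow> ('a \<times> 's \<Rightarrow>\<^sub>0 int) set" where
  "tensor_map L S h X =
     (\<Union>c\<in>X. tensor_class L S (frag_extend (\<lambda>(x, r). frag_of (x, h r)) c))"


section \<open>The p-adic numbers\<close>

definition padic_abs :: "nat \<Rightarrow> rat \<Rightarrow> real" where
  "padic_abs p x = (if x = 0 then 0 else
     real p powi (int (multiplicity (int p) (snd (quotient_of x)))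
                - int (multiplicity (int p) (fst (quotient_of x)))))"

definition padic_cauchy :: "nat \<Rightarrow> (nat \<Rightarrow> rat) set" where
  "padic_cauchy p = {s. \<forall>e>0. \<exists>N. \<forall>m\<ge>N. \<forall>n\<ge>N. padic_abs p (s m - s n) < e}"

definition padic_null :: "nat \<Rightarrow> (nat \<Rightarrow> rat) set" where
  "padic_null p = {s. (\<lambda>n. padic_abs p (s n)) \<longlonglongrightarrow> 0}"

definition padic_cauchy_ring :: "nat \<Rightarrow> (nat \<Rightarrow> rat) ring" where
  "padic_cauchy_ring p = \<lparr>carrier = padic_cauchy p, monoid.mult = (\<lambda>s t n. s n * t n),
     one = (\<lambda>_. 1), ring.zero = (\<lambda>_. 0), add = (\<lambda>s t n. s n + t n)\<rparr>"

text \<open>The completion of the rationals for the p-adic absolute value, and its closed unit ball.\<close>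

definition Qp :: "nat \<Rightarrow> (nat \<Rightarrow> rat) set ring" where
  "Qp p = padic_cauchy_ring p Quot padic_null p"

definition Zp :: "nat \<Rightarrow> (nat \<Rightarrow> rat) set ring" where
  "Zp p = (Qp p)\<lparr>carrier := {X \<in> carrier (Qp p). \<exists>s\<in>X. \<forall>n. padic_abs p (s n) \<le> 1}\<rparr>"

abbreviation rat_ring :: "rat ring" where
  "rat_ring \<equiv> \<lparr>carrier = UNIV, monoid.mult = (*), one = 1, ring.zero = 0, add = (+)\<rparr>"

definition rat_to_Qp :: "nat \<Rightarrow> rat \<Rightarrow> (nat \<Rightarrow> rat) set" where
  "rat_to_Qp p x = padic_null p +>\<^bsub>padic_cauchy_ring p\<^esub> (\<lambda>_. x)"


section \<open>Endomorphisms, acting on the right\<close>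

definition alg_End :: "('r, 'n) ring_scheme \<Rightarrow> ('r, 'v, 'm) module_scheme \<Rightarrow> ('v \<Rightarrow> 'v) set" where
  "alg_End R V = {f \<in> carrier V \<rightarrow>\<^sub>E carrier V.
     (\<forall>x\<in>carrier V. \<forall>y\<in>carrier V.
        f (x \<oplus>\<^bsub>V\<^esub> y) = f x \<oplus>\<^bsub>V\<^esub> f y \<and> f (x \<otimes>\<^bsub>V\<^esub> y) = f x \<otimes>\<^bsub>V\<^esub> f y) \<and>
     (\<forall>r\<in>carrier R. \<forall>x\<in>carrier V. f (r \<odot>\<^bsub>V\<^esub> x) = r \<odot>\<^bsub>V\<^esub> f x)}"

definition alg_Aut :: "('r, 'n) ring_scheme \<Rightarrow> ('r, 'v, 'm) module_scheme \<Rightarrow> ('v \<Rightarrow> 'v) set" where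
  "alg_Aut R V = {f \<in> alg_End R V. bij_betw f (carrier V) (carrier V)}"

text \<open>Right action: the product of \<open>\<alpha>\<close> and \<open>\<beta>\<close> is \<open>\<alpha>\<close> followed by \<open>\<beta>\<close>.\<close>

definition Aut_group :: "('r, 'n) ring_scheme \<Rightarrow> ('r, 'v, 'm) module_scheme \<Rightarrow> ('v \<Rightarrow> 'v) monoid" where
  "Aut_group R V = \<lparr>carrier = alg_Aut R V, monoid.mult = (\<lambda>\<alpha> \<beta>. compose (carrier V) \<beta> \<alpha>),
     one = (\<lambda>x\<in>carrier V. x)\<rparr>"

text \<open>For an \<open>R\<close>-algebra \<open>M\<close> embedded by \<open>\<iota>\<close> in a \<open>K\<close>-algebra \<open>V\<close>, these are the intersections of
  \<open>End\<^sub>R(M)\<close> and \<open>Aut\<^sub>R(M)\<close> with \<open>Aut\<^sub>K(V)\<close>: the automorphisms of \<open>V\<close> that restrict along \<open>\<iota>\<close> to an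
  endomorphism, respectively automorphism, of \<open>M\<close>.\<close>

definition lattice_End where
  "lattice_End R M K V \<iota> =
     {\<alpha> \<in> alg_Aut K V. \<exists>\<phi>\<in>alg_End R M. \<forall>x\<in>carrier M. \<alpha> (\<iota> x) = \<iota> (\<phi> x)}"

definition lattice_Aut where
  "lattice_Aut R M K V \<iota> =
     {\<alpha> \<in> alg_Aut K V. \<exists>\<phi>\<in>alg_Aut R M. \<forall>x\<in>carrier M. \<alpha> (\<iota> x) = \<iota> (\<phi> x)}"

text \<open>The index of \<open>\<Lambda>\<^sup>\<alpha>\<close> in \<open>\<Lambda>\<close>, with value 0 if it is infinite.\<close>

definition lattice_index :: "('v, 'm) ring_scheme \<Rightarrow> 'v set \<Rightarrow> ('v \<Rightarrow> 'v) \<Rightarrow> nat" where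
  "lattice_index V \<Lambda> \<alpha> = card (rcosets\<^bsub>(add_monoid V)\<lparr>carrier := \<Lambda>\<rparr>\<^esub> (\<alpha> ` \<Lambda>))"


section \<open>Hecke rings\<close>

definition left_quotient :: "('g, 'm) monoid_scheme \<Rightarrow> 'g set \<Rightarrow> 'g set \<Rightarrow> 'g set set" where
  "left_quotient G \<Gamma> A = (\<lambda>a. \<Gamma> #>\<^bsub>G\<^esub> a) ` A"

definition dcoset :: "('g, 'm) monoid_scheme \<Rightarrow> 'g set \<Rightarrow> 'g \<Rightarrow> 'g set" where
  "dcoset G \<Gamma> a = (\<Gamma> #>\<^bsub>G\<^esub> a) <#>\<^bsub>G\<^esub> \<Gamma>"

definition dcosets :: "('g, 'm) monoid_scheme \<Rightarrow> 'g set \<Rightarrow> 'g set \<Rightarrow> 'g set set" where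
  "dcosets G \<Gamma> A = dcoset G \<Gamma> ` A"

text \<open>The coefficient of the double coset \<open>Z\<close> in the product of \<open>X\<close> and \<open>Y\<close>; it depends neither on
  the representative of \<open>Z\<close> nor on those of the cosets \<open>U\<close>.\<close>

definition hecke_coeff :: "('g, 'm) monoid_scheme \<Rightarrow> 'g set \<Rightarrow> 'g set \<Rightarrow> 'g set \<Rightarrow> 'g set \<Rightarrow> nat" where
  "hecke_coeff G \<Gamma> X Y Z =
     card {U \<in> left_quotient G \<Gamma> Y. \<exists>\<beta>\<in>U. (SOME c. c \<in> Z) \<otimes>\<^bsub>G\<^esub> inv\<^bsub>G\<^esub> \<beta> \<in> X}"

definition hecke_basis_mult ::
    "('g, 'm) monoid_scheme \<Rightarrow> 'g set \<Rightarrow> 'g set \<Rightarrow> 'g set \<Rightarrow> 'g set \<Rightarrow> ('g set \<Rightarrow>\<^sub>0 int)" where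
  "hecke_basis_mult G \<Gamma> \<Delta> X Y =
     (\<Sum>Z\<in>{Z \<in> dcosets G \<Gamma> \<Delta>. hecke_coeff G \<Gamma> X Y Z \<noteq> 0}.
        frag_cmul (int (hecke_coeff G \<Gamma> X Y Z)) (frag_of Z))"

definition hecke_ring ::
    "('g, 'm) monoid_scheme \<Rightarrow> 'g set \<Rightarrow> 'g set \<Rightarrow> ('g set \<Rightarrow>\<^sub>0 int) ring" where
  "hecke_ring G \<Gamma> \<Delta> = \<lparr>
     carrier = carrier (free_Abelian_group (dcosets G \<Gamma> \<Delta>)),
     monoid.mult = (\<lambda>f g. frag_extend (\<lambda>X. frag_extend (\<lambda>Y. hecke_basis_mult G \<Gamma> \<Delta> X Y) g) f),
     one = frag_of \<Gamma>, ring.zero = 0, add = (+)\<rparr>"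

text \<open>The sum of the double cosets of the elements of \<open>A\<close>, each taken once; used only where there
  are finitely many of them.\<close>

definition hecke_sum :: "('g, 'm) monoid_scheme \<Rightarrow> 'g set \<Rightarrow> 'g set \<Rightarrow> ('g set \<Rightarrow>\<^sub>0 int)" where
  "hecke_sum G \<Gamma> A = (\<Sum>X\<in>dcosets G \<Gamma> A. frag_of X)"


section \<open>Global and local Hecke rings of an algebra\<close>

type_synonym 'a glob_elt = "('a \<times> rat \<Rightarrow>\<^sub>0 int) set"
type_synonym 'a loc_elt = "('a \<times> (nat \<Rightarrow> rat) set \<Rightarrow>\<^sub>0 int) set"

definition global_emb :: "('a, 'm) ring_scheme \<Rightarrow> 'a \<Rightarrow> 'a glob_elt" where
  "global_emb L x = pure_tensor L rat_ring x 1"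

definition G_glob :: "('a, 'm) ring_scheme \<Rightarrow> ('a glob_elt \<Rightarrow> 'a glob_elt) monoid" where
  "G_glob L = Aut_group rat_ring (tensor L rat_ring)"

definition \<Delta>_glob :: "('a, 'm) ring_scheme \<Rightarrow> ('a glob_elt \<Rightarrow> 'a glob_elt) set" where
  "\<Delta>_glob L = lattice_End \<Z> (int_algebra L) rat_ring (tensor L rat_ring) (global_emb L)"

definition \<Gamma>_glob :: "('a, 'm) ring_scheme \<Rightarrow> ('a glob_elt \<Rightarrow> 'a glob_elt) set" where
  "\<Gamma>_glob L = lattice_Aut \<Z> (int_algebra L) rat_ring (tensor L rat_ring) (global_emb L)"

definition index_glob :: "('a, 'm) ring_scheme \<Rightarrow> ('a glob_elt \<Rightarrow> 'a glob_elt) \<Rightarrow> nat" where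
  "index_glob L \<alpha> = lattice_index (tensor L rat_ring) (global_emb L ` carrier L) \<alpha>"

definition R_glob :: "('a, 'm) ring_scheme \<Rightarrow> (('a glob_elt \<Rightarrow> 'a glob_elt) set \<Rightarrow>\<^sub>0 int) ring" where
  "R_glob L = hecke_ring (G_glob L) (\<Gamma>_glob L) (\<Delta>_glob L)"

definition T_glob :: "('a, 'm) ring_scheme \<Rightarrow> nat \<Rightarrow> (('a glob_elt \<Rightarrow> 'a glob_elt) set \<Rightarrow>\<^sub>0 int)" where
  "T_glob L n = hecke_sum (G_glob L) (\<Gamma>_glob L) {\<alpha> \<in> \<Delta>_glob L. index_glob L \<alpha> = n}"

definition local_emb :: "('a, 'm) ring_scheme \<Rightarrow> nat \<Rightarrow> 'a loc_elt \<Rightarrow> 'a loc_elt" where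
  "local_emb L p = tensor_map L (Qp p) (\<lambda>z. z)"

definition G_loc :: "('a, 'm) ring_scheme \<Rightarrow> nat \<Rightarrow> ('a loc_elt \<Rightarrow> 'a loc_elt) monoid" where
  "G_loc L p = Aut_group (Qp p) (tensor L (Qp p))"

definition \<Delta>_loc :: "('a, 'm) ring_scheme \<Rightarrow> nat \<Rightarrow> ('a loc_elt \<Rightarrow> 'a loc_elt) set" where
  "\<Delta>_loc L p = lattice_End (Zp p) (tensor L (Zp p)) (Qp p) (tensor L (Qp p)) (local_emb L p)"

definition \<Gamma>_loc :: "('a, 'm) ring_scheme \<Rightarrow> nat \<Rightarrow> ('a loc_elt \<Rightarrow> 'a loc_elt) set" where
  "\<Gamma>_loc L p = lattice_Aut (Zp p) (tensor L (Zp p)) (Qp p) (tensor L (Qp p)) (local_emb L p)"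

definition index_loc :: "('a, 'm) ring_scheme \<Rightarrow> nat \<Rightarrow> ('a loc_elt \<Rightarrow> 'a loc_elt) \<Rightarrow> nat" where
  "index_loc L p \<alpha> =
     lattice_index (tensor L (Qp p)) (local_emb L p ` carrier (tensor L (Zp p))) \<alpha>"

definition R_loc :: "('a, 'm) ring_scheme \<Rightarrow> nat \<Rightarrow> (('a loc_elt \<Rightarrow> 'a loc_elt) set \<Rightarrow>\<^sub>0 int) ring" where
  "R_loc L p = hecke_ring (G_loc L p) (\<Gamma>_loc L p) (\<Delta>_loc L p)"

definition T_loc :: "('a, 'm) ring_scheme \<Rightarrow> nat \<Rightarrow> nat \<Rightarrow> (('a loc_elt \<Rightarrow> 'a loc_elt) set \<Rightarrow>\<^sub>0 int)" where
  "T_loc L p n = hecke_sum (G_loc L p) (\<Gamma>_loc L p) {\<alpha> \<in> \<Delta>_loc L p. index_loc L p \<alpha> = n}"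


section \<open>The adelic Hecke ring and the comparison maps\<close>

type_synonym 'a adelic = "nat \<Rightarrow> 'a loc_elt \<Rightarrow> 'a loc_elt"

abbreviation primes :: "nat set" where
  "primes \<equiv> {p. prime p}"

definition G_hat :: "('a, 'm) ring_scheme \<Rightarrow> 'a adelic monoid" where
  "G_hat L = (product_group primes (G_loc L))\<lparr>carrier :=
     {a \<in> (\<Pi>\<^sub>E p\<in>primes. carrier (G_loc L p)). finite {p \<in> primes. a p \<notin> \<Gamma>_loc L p}}\<rparr>"

definition \<Delta>_hat :: "('a, 'm) ring_scheme \<Rightarrow> 'a adelic set" where
  "\<Delta>_hat L = carrier (G_hat L) \<inter> (\<Pi>\<^sub>E p\<in>primes. \<Delta>_loc L p)"

definition \<Gamma>_hat :: "('a, 'm) ring_scheme \<Rightarrow> 'a adelic set" where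
  "\<Gamma>_hat L = (\<Pi>\<^sub>E p\<in>primes. \<Gamma>_loc L p)"

definition R_hat :: "('a, 'm) ring_scheme \<Rightarrow> ('a adelic set \<Rightarrow>\<^sub>0 int) ring" where
  "R_hat L = hecke_ring (G_hat L) (\<Gamma>_hat L) (\<Delta>_hat L)"

text \<open>The base change of \<open>\<alpha>\<close> from the rationals to the p-adic numbers: the automorphism of
  \<open>L \<otimes> \<rat>\<^sub>p\<close> that extends \<open>\<alpha>\<close> along the canonical map.\<close>

definition base_change ::
    "('a, 'm) ring_scheme \<Rightarrow> nat \<Rightarrow> ('a glob_elt \<Rightarrow> 'a glob_elt) \<Rightarrow> ('a loc_elt \<Rightarrow> 'a loc_elt)" where
  "base_change L p \<alpha> = (THE f. f \<in> carrier (G_loc L p) \<and>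
     (\<forall>x\<in>carrier (tensor L rat_ring).
        f (tensor_map L (Qp p) (rat_to_Qp p) x) = tensor_map L (Qp p) (rat_to_Qp p) (\<alpha> x)))"

definition \<eta> :: "('a, 'm) ring_scheme \<Rightarrow> ('a glob_elt \<Rightarrow> 'a glob_elt) \<Rightarrow> 'a adelic" where
  "\<eta> L \<alpha> = (\<lambda>p\<in>primes. base_change L p \<alpha>)"

text \<open>On a coset \<open>U = \<Gamma>\<^sub>L\<alpha>\<close> this is the single coset of \<open>\<eta>(\<alpha>)\<close>; the union avoids choosing \<open>\<alpha>\<close>.\<close>

definition \<eta>_lower :: "('a, 'm) ring_scheme \<Rightarrow> ('a glob_elt \<Rightarrow> 'a glob_elt) set \<Rightarrow> 'a adelic set" where
  "\<eta>_lower L U = (\<Union>\<alpha>\<in>U. \<Gamma>_hat L #>\<^bsub>G_hat L\<^esub> \<eta> L \<alpha>)"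

definition \<eta>_upper ::
    "('a, 'm) ring_scheme \<Rightarrow> ('a adelic set \<Rightarrow>\<^sub>0 int) \<Rightarrow> (('a glob_elt \<Rightarrow> 'a glob_elt) set \<Rightarrow>\<^sub>0 int)" where
  "\<eta>_upper L = frag_extend (\<lambda>X. hecke_sum (G_glob L) (\<Gamma>_glob L) {\<beta> \<in> \<Delta>_glob L. \<eta> L \<beta> \<in> X})"

definition at_prime :: "('a, 'm) ring_scheme \<Rightarrow> nat \<Rightarrow> ('a loc_elt \<Rightarrow> 'a loc_elt) \<Rightarrow> 'a adelic" where
  "at_prime L p \<alpha> = (\<lambda>q\<in>primes. if q = p then \<alpha> else \<one>\<^bsub>G_loc L q\<^esub>)"

text \<open>The inclusion of \<open>R_loc L p\<close> into \<open>R_hat L\<close>; on a local double coset the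
  union is the single double coset of the image of any representative.\<close>

definition loc_to_hat ::
    "('a, 'm) ring_scheme \<Rightarrow> nat \<Rightarrow> (('a loc_elt \<Rightarrow> 'a loc_elt) set \<Rightarrow>\<^sub>0 int) \<Rightarrow> ('a adelic set \<Rightarrow>\<^sub>0 int)" where
  "loc_to_hat L p =
     frag_extend (\<lambda>X. frag_of (\<Union>\<alpha>\<in>X. dcoset (G_hat L) (\<Gamma>_hat L) (at_prime L p \<alpha>)))"

text \<open>The map of \<open>R_loc L p\<close> through \<open>R_hat L\<close> into \<open>R_glob L\<close> by which the former is regarded as
  a subring of the latter; it is injective when \<open>\<eta>_lower L\<close> is bijective.\<close>

definition loc_to_glob ::
    "('a, 'm) ring_scheme \<Rightarrow> nat \<Rightarrow> (('a loc_elt \<Rightarrow> 'a loc_elt) set \<Rightarrow>\<^sub>0 int) \<Rightarrow>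
      (('a glob_elt \<Rightarrow> 'a glob_elt) set \<Rightarrow>\<^sub>0 int)" where
  "loc_to_glob L p f = \<eta>_upper L (loc_to_hat L p f)"


section \<open>Dirichlet series and Euler products\<close>

text \<open>Formal Dirichlet series and formal power series are given by their coefficient sequences;
  the coefficient of a Dirichlet series at 0 is meaningless.\<close>

definition D_series :: "('a, 'm) ring_scheme \<Rightarrow> nat \<Rightarrow> (('a glob_elt \<Rightarrow> 'a glob_elt) set \<Rightarrow>\<^sub>0 int)" where
  "D_series L n = T_glob L n"

definition P_series :: "('a, 'm) ring_scheme \<Rightarrow> nat \<Rightarrow> nat \<Rightarrow> (('a loc_elt \<Rightarrow> 'a loc_elt) set \<Rightarrow>\<^sub>0 int)" where
  "P_series L p k = T_loc L p (p ^ k)"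

definition multiplicative_seq :: "('r, 'm) monoid_scheme \<Rightarrow> (nat \<Rightarrow> 'r) \<Rightarrow> bool" where
  "multiplicative_seq R t \<longleftrightarrow> t 1 = \<one>\<^bsub>R\<^esub> \<and>
     (\<forall>m n. m > 0 \<longrightarrow> n > 0 \<longrightarrow> coprime m n \<longrightarrow> t (m * n) = t m \<otimes>\<^bsub>R\<^esub> t n)"

text \<open>\<open>x\<close> is the product of the family \<open>f\<close> over \<open>I\<close>: all but finitely many factors are 1, and the
  remaining ones multiply to \<open>x\<close> in whatever order they are taken. (The monoid need not be
  commutative.)\<close>

definition has_formal_prod :: "('r, 'm) monoid_scheme \<Rightarrow> ('i \<Rightarrow> 'r) \<Rightarrow> 'i set \<Rightarrow> 'r \<Rightarrow> bool" where
  "has_formal_prod R f I x \<longleftrightarrow> (\<exists>F. finite F \<and> F \<subseteq> I \<and> (\<forall>i\<in>I - F. f i = \<one>\<^bsub>R\<^esub>) \<and>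
     (\<forall>is. distinct is \<and> set is = F \<longrightarrow> foldr (\<lambda>i y. f i \<otimes>\<^bsub>R\<^esub> y) is \<one>\<^bsub>R\<^esub> = x))"

text \<open>\<open>D(s) = \<Prod>\<^sub>p P\<^sub>p(p\<^sup>-\<^sup>s)\<close>: the factor at \<open>p\<close> contributes to the coefficient of \<open>n\<^sup>-\<^sup>s\<close> the
  coefficient of \<open>P\<^sub>p\<close> at the p-adic valuation of \<open>n\<close>.\<close>

definition has_euler_product ::
    "('r, 'm) monoid_scheme \<Rightarrow> (nat \<Rightarrow> 'r) \<Rightarrow> (nat \<Rightarrow> nat \<Rightarrow> 'r) \<Rightarrow> bool" where
  "has_euler_product R D P \<longleftrightarrow>
     (\<forall>n>0. has_formal_prod R (\<lambda>p. P p (multiplicity p n)) primes (D n))"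

end

theory Submission
  imports Defs "HOL-Algebra.Sylow" "HOL-Algebra.Multiplicative_Group"
begin

text \<open>
  Let \<open>\<Gamma> \<subseteq> \<Delta>\<close> be the automorphisms and the invertible endomorphisms of \<open>L\<close>, acting on \<open>L \<otimes> \<rat>\<close> on
  the right. A coset \<open>\<Gamma>\<alpha>\<close> is the same thing as the sublattice \<open>L\<^sup>\<alpha>\<close>, so Hecke multiplication is a
  count of sublattices: the coefficient of \<open>\<Gamma>c\<Gamma>\<close> in \<open>T(m) T(n)\<close> is the number of sublattices
  \<open>L\<^sup>\<beta>\<close> of index \<open>n\<close> in \<open>L\<close> with \<open>c\<beta>\<^sup>-\<^sup>1\<close> in \<open>\<Delta>\<close> of index \<open>m\<close>. The index is multiplicative, so \<open>c\<close>
  has index \<open>m n\<close>. When \<open>m\<close> and \<open>n\<close> are coprime, such an \<open>L\<^sup>\<beta>\<close> can only be \<open>{x \<in> L. m x \<in> L\<^sup>c}\<close>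
  (\<open>coprime_factor_image\<close>), and \<open>T(m) T(n) = T(m n)\<close> says that this lattice does have the form
  \<open>L\<^sup>\<beta>\<close> with \<open>c\<beta>\<^sup>-\<^sup>1\<close> in \<open>\<Delta>\<close>.

  The element \<open>\<beta>\<close> comes from the hypothesis on \<open>\<eta>\<close>. The adelic element that equals \<open>c\<close> at the primes
  dividing \<open>n\<close> and 1 at the others is congruent modulo \<open>\<Gamma>_hat\<close> to the image of some \<open>\<beta>\<close> in \<open>\<Delta>\<close>
  (\<open>adelic_approximation\<close>). Two facts relate \<open>\<beta>\<close> to its base changes \<open>\<beta>\<^sub>p\<close>. The index of \<open>\<beta>\<^sub>p\<close> is the
  \<open>p\<close>-part of the index of \<open>\<beta>\<close> (\<open>local_index\<close>), which gives \<open>\<beta>\<close> the index \<open>n\<close>. An automorphism of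
  \<open>L \<otimes> \<rat>\<close> that preserves every \<open>L\<^sub>p\<close> preserves \<open>L\<close> (\<open>\<Delta>_local_global\<close>), which puts \<open>c\<beta>\<^sup>-\<^sup>1\<close> in \<open>\<Delta>\<close>.
  This is \<open>divisor_of_coprime_index\<close>.

  The index formula is elementary. Write the index of \<open>\<beta>\<close> as \<open>p\<^sup>v m\<close> with \<open>m\<close> prime to \<open>p\<close>. As the
  integers are dense in the \<open>p\<close>-adic integers, \<open>L\<close> maps onto the quotient of \<open>L\<^sub>p\<close> by its image under
  \<open>\<beta>\<^sub>p\<close>, and the kernel turns out to be \<open>{x \<in> L. m x \<in> L\<^sup>\<beta>}\<close>. The quotient of \<open>L\<close> by this kernel is
  the \<open>p\<close>-primary part of the finite group \<open>L / L\<^sup>\<beta>\<close>, of order \<open>p\<^sup>v\<close> by Sylow's theorem.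

  For the Euler product, the index formula also shows that \<open>\<beta>\<close> has index \<open>p\<^sup>k\<close> exactly when \<open>\<beta>\<^sub>p\<close> has
  index \<open>p\<^sup>k\<close> and \<open>\<beta>\<^sub>q\<close> is an automorphism of \<open>L\<^sub>q\<close> for all other primes \<open>q\<close>. Hence the image of
  \<open>T\<^sub>p(p\<^sup>k)\<close> in the global Hecke ring is \<open>T(p\<^sup>k)\<close> (\<open>loc_to_glob_T_loc\<close>), and the product formula for the
  coefficient of \<open>n\<^sup>-\<^sup>s\<close> is multiplicativity applied to the prime factorization of \<open>n\<close>.
\<close>

section \<open>Indices of subgroups\<close>

lemma finite_image_of_coarser:
  assumes fin: "finite (F ` S)" and coarser: "\<And>x y. x \<in> S \<Longrightarrow> y \<in> S \<Longrightarrow> F x = F y \<Longrightarrow> H x = H y"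
  shows "finite (H ` S)"
proof -
  have "H x = H (SOME y. y \<in> S \<and> F y = F x)" if "x \<in> S" for x
    using someI[of "\<lambda>y. y \<in> S \<and> F y = F x" x] that by (intro coarser) auto
  then have "H ` S \<subseteq> (\<lambda>u. H (SOME y. y \<in> S \<and> F y = u)) ` F ` S" by auto
  then show ?thesis by (rule finite_subset) (use fin in simp)
qed

lemma card_image_eq_of_same_fibres:
  assumes "\<And>x y. x \<in> A \<Longrightarrow> y \<in> A \<Longrightarrow> f x = f y \<longleftrightarrow> g x = g y"
  shows "card (f ` A) = card (g ` A)"
proof (rule bij_betw_same_card)
  show "bij_betw (\<lambda>u. g (SOME x. x \<in> A \<and> f x = u)) (f ` A) (g ` A)"
  proof -
    have *: "g (SOME y. y \<in> A \<and> f y = f x) = g x" if "x \<in> A" for x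
      by (rule someI2[of "\<lambda>y. y \<in> A \<and> f y = f x"]) (use that assms in auto)
    show ?thesis
      unfolding bij_betw_def
    proof
      show "inj_on (\<lambda>u. g (SOME x. x \<in> A \<and> f x = u)) (f ` A)"
        by (rule inj_onI) (use * assms in auto)
      show "(\<lambda>u. g (SOME x. x \<in> A \<and> f x = u)) ` f ` A = g ` A"
        unfolding image_image by (rule image_cong) (use * in auto)
    qed
  qed
qed

lemma rcosets_eq_image: "rcosets\<^bsub>G\<^esub> H = (\<lambda>x. H #>\<^bsub>G\<^esub> x) ` carrier G"
  by (auto simp: RCOSETS_def)

lemma (in group) rcos_eq_iff:
  assumes "subgroup H G" "x \<in> carrier G" "y \<in> carrier G"
  shows "H #> x = H #> y \<longleftrightarrow> x \<otimes> inv y \<in> H"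
  using assms rcos_self repr_independence repr_independenceD subgroup.rcos_module
  by (metis is_group)

text \<open>The map \<open>a \<mapsto> K f(a)\<close> from \<open>A\<close> to the cosets of \<open>K\<close> is onto by the covering hypothesis, and its
  fibres are the cosets of the preimage of \<open>K\<close>.\<close>

lemma card_rcosets_vimage:
  assumes "group A" "group B" "f \<in> hom A B" "subgroup K B"
    and cover: "\<And>b. b \<in> carrier B \<Longrightarrow> \<exists>a\<in>carrier A. \<exists>k\<in>K. b = k \<otimes>\<^bsub>B\<^esub> f a"
  shows "card (rcosets\<^bsub>A\<^esub> {x \<in> carrier A. f x \<in> K}) = card (rcosets\<^bsub>B\<^esub> K)"
proof -
  interpret A: group A by fact
  interpret B: group B by fact
  interpret f: group_hom A B f
    using assms by (simp add: group_hom_def group_hom_axioms_def)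
  interpret K: subgroup K B by fact
  let ?M = "{x \<in> carrier A. f x \<in> K}"
  have M: "subgroup ?M A"
    by (rule A.subgroupI) (use K.one_closed in \<open>auto intro!: exI[of _ "\<one>\<^bsub>A\<^esub>"]\<close>)
  have "(\<lambda>a. K #>\<^bsub>B\<^esub> f a) ` carrier A = (\<lambda>b. K #>\<^bsub>B\<^esub> b) ` carrier B"
  proof (intro equalityI subsetI)
    fix U assume "U \<in> (\<lambda>b. K #>\<^bsub>B\<^esub> b) ` carrier B"
    then obtain b where b: "b \<in> carrier B" "U = K #>\<^bsub>B\<^esub> b" by auto
    then obtain a k where ak: "a \<in> carrier A" "k \<in> K" "b = k \<otimes>\<^bsub>B\<^esub> f a"
      using cover by blast
    then have "K #>\<^bsub>B\<^esub> b = K #>\<^bsub>B\<^esub> f a"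
      using b B.rcos_eq_iff[OF assms(4), of b "f a"] by (simp add: B.m_assoc)
    then show "U \<in> (\<lambda>a. K #>\<^bsub>B\<^esub> f a) ` carrier A" using ak b by auto
  qed auto
  moreover have "card ((\<lambda>x. ?M #>\<^bsub>A\<^esub> x) ` carrier A) = card ((\<lambda>a. K #>\<^bsub>B\<^esub> f a) ` carrier A)"
    by (rule card_image_eq_of_same_fibres)
      (auto simp: A.rcos_eq_iff[OF M] B.rcos_eq_iff[OF assms(4)])
  ultimately show ?thesis by (simp add: rcosets_eq_image)
qed

text \<open>A choice \<open>s\<close> of representatives of the cosets of \<open>H\<close> writes \<open>x\<close> as \<open>(x s(Hx)\<^sup>-\<^sup>1) s(Hx)\<close>, which
  identifies \<open>K\<close>-cosets in \<open>G\<close> with pairs of a \<open>K\<close>-coset in \<open>H\<close> and an \<open>H\<close>-coset in \<open>G\<close>. The bijection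
  holds for infinite indices too, which \<open>card\<close> counts as 0.\<close>

lemma (in group) card_rcosets_tower:
  assumes H: "subgroup H G" and K: "subgroup K G" and KH: "K \<subseteq> H"
  shows "card (rcosets K) = card (rcosets\<^bsub>G\<lparr>carrier := H\<rparr>\<^esub> K) * card (rcosets H)"
proof -
  interpret H: subgroup H G by fact
  interpret K: subgroup K G by fact
  define s :: "'a set \<Rightarrow> 'a" where "s = (\<lambda>U. SOME y. y \<in> U)"
  have s: "s (H #> x) \<in> H #> x" if "x \<in> carrier G" for x
    unfolding s_def by (rule someI[of _ x]) (rule rcos_self[OF that H])
  have sc: "s (H #> x) \<in> carrier G" if "x \<in> carrier G" for x
    using s[OF that] H.rcosets_carrier r_coset_subset_G[OF H.subset that] by blast
  have Hs: "H #> s (H #> x) = H #> x" if "x \<in> carrier G" for x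
    using repr_independence[OF s[OF that] that H] by simp
  have xs: "x \<otimes> inv s (H #> x) \<in> H" if "x \<in> carrier G" for x
    using Hs[OF that] rcos_eq_iff[OF H that sc[OF that]] by simp
  let ?g = "\<lambda>x. (K #> (x \<otimes> inv s (H #> x)), H #> x)"
  have "card ((\<lambda>x. K #> x) ` carrier G) = card (?g ` carrier G)"
  proof (rule card_image_eq_of_same_fibres)
    fix x y assume x: "x \<in> carrier G" and y: "y \<in> carrier G"
    have cancel: "inv z \<otimes> (z \<otimes> w) = w" if "z \<in> carrier G" "w \<in> carrier G" for z w
      using that by (simp flip: m_assoc)
    have *: "(K #> (x \<otimes> inv s (H #> x)) = K #> (y \<otimes> inv s (H #> x))) \<longleftrightarrow> x \<otimes> inv y \<in> K"
      using x y sc[OF x]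
      by (simp add: rcos_eq_iff[OF K] inv_mult_group m_assoc cancel)
    have "H #> x = H #> y" if "K #> x = K #> y"
      using that rcos_eq_iff[OF K x y] rcos_eq_iff[OF H x y] KH by blast
    then show "(K #> x = K #> y) \<longleftrightarrow> (?g x = ?g y)"
      using * rcos_eq_iff[OF K x y] by auto
  qed
  also have "?g ` carrier G = ((\<lambda>h. K #> h) ` H) \<times> ((\<lambda>x. H #> x) ` carrier G)"
  proof (intro equalityI subsetI)
    fix z assume "z \<in> ?g ` carrier G"
    then show "z \<in> ((\<lambda>h. K #> h) ` H) \<times> ((\<lambda>x. H #> x) ` carrier G)"
      using xs by auto
  next
    fix z assume "z \<in> ((\<lambda>h. K #> h) ` H) \<times> ((\<lambda>x. H #> x) ` carrier G)"
    then obtain h x where h: "h \<in> H" and x: "x \<in> carrier G" and z: "z = (K #> h, H #> x)" by auto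
    let ?y = "h \<otimes> s (H #> x)"
    have hc: "h \<in> carrier G" using h by simp
    have y: "?y \<in> carrier G" using hc sc[OF x] by simp
    have "H #> ?y = H #> s (H #> x)"
      using rcos_eq_iff[OF H y sc[OF x]] h hc sc[OF x] by (simp add: m_assoc)
    then have Hy: "H #> ?y = H #> x" using Hs[OF x] by simp
    have "?y \<otimes> inv s (H #> ?y) = h"
      unfolding Hy using hc sc[OF x] by (simp add: m_assoc)
    then show "z \<in> ?g ` carrier G" using y Hy z by (intro image_eqI[of _ _ ?y]) auto
  qed
  finally show ?thesis
    by (simp add: rcosets_eq_image card_cartesian_product r_coset_def)
qed

lemma (in comm_group) pow_card_rcosets:
  assumes H: "subgroup H G" and fin: "card (rcosets H) > 0" and x: "x \<in> carrier G"
  shows "x [^] (card (rcosets H)) \<in> H"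
proof -
  interpret N: normal H G by (rule subgroup_imp_normal[OF H])
  interpret Q: group "G Mod H" by (rule N.factorgroup_is_group)
  have "finite (carrier (G Mod H))" using fin by (simp add: FactGroup_def card_gt_0_iff)
  then have "(H #> x) [^]\<^bsub>G Mod H\<^esub> order (G Mod H) = \<one>\<^bsub>G Mod H\<^esub>"
    using x by (intro Q.pow_order_eq_1) (auto simp: carrier_FactGroup)
  then have "H #> (x [^] (card (rcosets H))) = H"
    using N.FactGroup_pow[OF x] by (simp add: order_def FactGroup_def)
  then show ?thesis
    using x coset_join1[OF _ nat_pow_closed[OF x] H] by blast
qed

text \<open>The fibres of \<open>x \<mapsto> (Hx)\<^sup>m\<close> are the cosets on the left-hand side, so the claim is that the \<open>m\<close>-th powers
  in the group \<open>G / H\<close> of order \<open>p\<^sup>v m\<close> are exactly its Sylow subgroup \<open>S\<close>. They lie in \<open>S\<close> because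
  \<open>S\<close> has index \<open>m\<close>; conversely \<open>S\<close> has exponent dividing \<open>p\<^sup>v\<close>, so taking \<open>m\<close>-th powers is invertible
  on it by Bezout.\<close>

lemma (in comm_group) card_rcosets_prime_part:
  fixes p v m :: nat
  assumes p: "prime p" and H: "subgroup H G" and card: "card (rcosets H) = p ^ v * m"
    and cop: "coprime p m" and m: "m > 0"
  shows "card (rcosets {x \<in> carrier G. x [^] m \<in> H}) = p ^ v"
proof -
  interpret N: normal H G by (rule subgroup_imp_normal[OF H])
  interpret Q: comm_group "G Mod H" by (rule abelian_FactGroup[OF H])
  let ?Q = "G Mod H" and ?M = "{x \<in> carrier G. x [^] m \<in> H}"
  have pos: "p ^ v * m > 0" using m prime_gt_0_nat[OF p] by simp
  have carrQ: "carrier ?Q = rcosets H" by (simp add: FactGroup_def)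
  have fin: "finite (carrier ?Q)"
    unfolding carrQ by (rule card_ge_0_finite) (simp only: card pos)
  have ord: "order ?Q = p ^ v * m" using card by (simp add: order_def FactGroup_def)
  obtain S where S: "subgroup S ?Q" "card S = p ^ v"
    using sylow_thm[OF p Q.is_group ord fin] by auto
  interpret S: subgroup S ?Q by (rule S(1))
  have finS: "finite S" using S.subset fin by (rule finite_subset)
  have M: "subgroup ?M G"
    by (rule subgroupI) (auto simp: nat_pow_distrib nat_pow_inv intro!: exI[of _ \<one>])
  have "card ((\<lambda>x. ?M #> x) ` carrier G) = card ((\<lambda>x. H #> (x [^] m)) ` carrier G)"
    by (rule card_image_eq_of_same_fibres)
      (auto simp: rcos_eq_iff[OF M] rcos_eq_iff[OF H] nat_pow_distrib nat_pow_inv)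
  also have "(\<lambda>x. H #> (x [^] m)) ` carrier G = (\<lambda>q. q [^]\<^bsub>?Q\<^esub> m) ` carrier ?Q"
    by (auto simp: carrier_FactGroup image_image N.FactGroup_pow)
  also have "\<dots> = S"
  proof (intro equalityI subsetI)
    fix y assume "y \<in> (\<lambda>q. q [^]\<^bsub>?Q\<^esub> m) ` carrier ?Q"
    then obtain q where q: "q \<in> carrier ?Q" "y = q [^]\<^bsub>?Q\<^esub> m" by auto
    have "card (rcosets\<^bsub>?Q\<^esub> S) * card S = order ?Q" by (rule Q.lagrange[OF S(1)])
    then have c: "card (rcosets\<^bsub>?Q\<^esub> S) = m" using ord S(2) p by (simp add: prime_gt_0_nat)
    show "y \<in> S" using Q.pow_card_rcosets[OF S(1) _ q(1)] c m q(2) by simp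
  next
    fix h assume h: "h \<in> S"
    then have hc: "h \<in> carrier ?Q" using S.subset by auto
    have "h [^]\<^bsub>?Q\<^esub> (p ^ v) = \<one>\<^bsub>?Q\<^esub>"
      using group.pow_order_eq_1[OF S.subgroup_is_group[OF Q.is_group], of h] h finS S(2)
      by (simp add: order_def monoid.nat_pow_consistent[OF Q.is_monoid, symmetric])
    then have hp: "h [^]\<^bsub>?Q\<^esub> (int (p ^ v)) = \<one>\<^bsub>?Q\<^esub>" by (simp only: int_pow_int)
    have "coprime (int (p ^ v)) (int m)" using cop by (simp add: coprime_power_left_iff flip: of_nat_power)
    then obtain a b where ab: "a * int (p ^ v) + b * int m = 1"
      by (metis bezout_int coprime_imp_gcd_eq_1)
    have "h = h [^]\<^bsub>?Q\<^esub> (int (p ^ v) * a + b * int m)"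
      using ab hc by (simp add: mult.commute)
    also have "\<dots> = (h [^]\<^bsub>?Q\<^esub> int (p ^ v)) [^]\<^bsub>?Q\<^esub> a \<otimes>\<^bsub>?Q\<^esub> h [^]\<^bsub>?Q\<^esub> (b * int m)"
      using hc by (simp only: Q.int_pow_mult Q.int_pow_pow)
    also have "\<dots> = h [^]\<^bsub>?Q\<^esub> (b * int m)"
      unfolding hp Q.int_pow_one using hc by (intro Q.l_one Q.int_pow_closed)
    also have "\<dots> = (h [^]\<^bsub>?Q\<^esub> b) [^]\<^bsub>?Q\<^esub> m"
      using hc by (simp add: Q.int_pow_pow[symmetric] int_pow_int)
    finally show "h \<in> (\<lambda>q. q [^]\<^bsub>?Q\<^esub> m) ` carrier ?Q" using hc by blast
  qed
  finally show ?thesis using S(2) by (simp add: rcosets_eq_image)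
qed

lemma (in group) card_rcosets_eq_1:
  assumes H: "subgroup H G" and "card (rcosets H) = 1"
  shows "H = carrier G"
proof -
  obtain U where U: "rcosets H = {U}" using assms(2) by (auto simp: card_1_singleton_iff)
  have "H \<in> rcosets H" using subgroup.subgroup_in_rcosets[OF H is_group] .
  then show ?thesis using U rcosets_part_G[OF H] by simp
qed

section \<open>Products of sums of double cosets\<close>

text \<open>The unions of double cosets of \<open>\<Gamma>\<close>.\<close>

definition bi_invariant :: "('g, 'm) monoid_scheme \<Rightarrow> 'g set \<Rightarrow> 'g set \<Rightarrow> bool" where
  "bi_invariant G \<Gamma> A \<longleftrightarrow> A \<subseteq> carrier G \<and>
     (\<forall>\<gamma>\<in>\<Gamma>. \<forall>a\<in>A. \<forall>\<delta>\<in>\<Gamma>. \<gamma> \<otimes>\<^bsub>G\<^esub> a \<otimes>\<^bsub>G\<^esub> \<delta> \<in> A)"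

lemma bi_invariantD:
  assumes "bi_invariant G \<Gamma> A" "a \<in> A"
  shows "a \<in> carrier G" "\<gamma> \<in> \<Gamma> \<Longrightarrow> \<delta> \<in> \<Gamma> \<Longrightarrow> \<gamma> \<otimes>\<^bsub>G\<^esub> a \<otimes>\<^bsub>G\<^esub> \<delta> \<in> A"
  using assms unfolding bi_invariant_def by auto

lemma mem_dcoset_iff:
  "x \<in> dcoset G \<Gamma> a \<longleftrightarrow> (\<exists>\<gamma>\<in>\<Gamma>. \<exists>\<delta>\<in>\<Gamma>. x = \<gamma> \<otimes>\<^bsub>G\<^esub> a \<otimes>\<^bsub>G\<^esub> \<delta>)"
  by (auto simp: dcoset_def set_mult_def r_coset_def)

locale group_with_subgroup = group G + subgroup \<Gamma> G for G (structure) and \<Gamma>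
begin

lemma bi_invariant_left:
  assumes "bi_invariant G \<Gamma> A" "a \<in> A" "\<gamma> \<in> \<Gamma>" shows "\<gamma> \<otimes> a \<in> A"
  using bi_invariantD(2)[OF assms(1,2,3) one_closed] bi_invariantD(1)[OF assms(1,2)] assms(3)
  by simp

lemma bi_invariant_right:
  assumes "bi_invariant G \<Gamma> A" "a \<in> A" "\<gamma> \<in> \<Gamma>" shows "a \<otimes> \<gamma> \<in> A"
  using bi_invariantD(2)[OF assms(1,2) one_closed assms(3)] bi_invariantD(1)[OF assms(1,2)] assms(3)
  by simp

lemma self_mem_dcoset: "a \<in> carrier G \<Longrightarrow> a \<in> dcoset G \<Gamma> a"
  unfolding mem_dcoset_iff by (intro bexI[of _ \<one>]) auto

lemma dcoset_subset: "bi_invariant G \<Gamma> A \<Longrightarrow> a \<in> A \<Longrightarrow> dcoset G \<Gamma> a \<subseteq> A"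
  by (auto simp: mem_dcoset_iff dest: bi_invariantD)

lemma dcoset_eq:
  assumes a: "a \<in> carrier G" and b: "b \<in> dcoset G \<Gamma> a"
  shows "dcoset G \<Gamma> b = dcoset G \<Gamma> a"
proof -
  obtain g d where g: "g \<in> \<Gamma>" "d \<in> \<Gamma>" "b = g \<otimes> a \<otimes> d" using b unfolding mem_dcoset_iff by auto
  have gc: "g \<in> carrier G" "d \<in> carrier G" using g by auto
  show ?thesis
  proof (intro equalityI subsetI)
    fix x assume "x \<in> dcoset G \<Gamma> b"
    then obtain h k where h: "h \<in> \<Gamma>" "k \<in> \<Gamma>" "x = h \<otimes> b \<otimes> k" unfolding mem_dcoset_iff by auto
    then have "x = (h \<otimes> g) \<otimes> a \<otimes> (d \<otimes> k)" using g gc a h(1,2)[THEN mem_carrier] by (simp add: m_assoc)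
    then show "x \<in> dcoset G \<Gamma> a" unfolding mem_dcoset_iff using g h by blast
  next
    fix x assume "x \<in> dcoset G \<Gamma> a"
    then obtain h k where h: "h \<in> \<Gamma>" "k \<in> \<Gamma>" "x = h \<otimes> a \<otimes> k" unfolding mem_dcoset_iff by auto
    have cancel: "inv z \<otimes> (z \<otimes> w) = w" "z \<otimes> (inv z \<otimes> w) = w"
      if "z \<in> carrier G" "w \<in> carrier G" for z w
      using that by (simp_all flip: m_assoc)
    have "x = (h \<otimes> inv g) \<otimes> b \<otimes> (inv d \<otimes> k)"
      using g(3) gc a h(3) h(1,2)[THEN mem_carrier] by (simp add: m_assoc cancel)
    then show "x \<in> dcoset G \<Gamma> b" unfolding mem_dcoset_iff using g h by blast
  qed
qed

lemma dcoset_disjoint: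
  assumes "a \<in> carrier G" "b \<in> carrier G" "x \<in> dcoset G \<Gamma> a" "x \<in> dcoset G \<Gamma> b"
  shows "dcoset G \<Gamma> a = dcoset G \<Gamma> b"
  using dcoset_eq[OF assms(1,3)] dcoset_eq[OF assms(2,4)] by simp

lemma dcoset_bi_invariant: "a \<in> carrier G \<Longrightarrow> bi_invariant G \<Gamma> (dcoset G \<Gamma> a)"
  unfolding bi_invariant_def
proof (intro conjI ballI)
  assume a: "a \<in> carrier G"
  show "dcoset G \<Gamma> a \<subseteq> carrier G" using a by (auto simp: mem_dcoset_iff)
  fix g x d assume *: "g \<in> \<Gamma>" "x \<in> dcoset G \<Gamma> a" "d \<in> \<Gamma>"
  then have "g \<otimes> x \<otimes> d \<in> dcoset G \<Gamma> x" by (auto simp: mem_dcoset_iff)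
  then show "g \<otimes> x \<otimes> d \<in> dcoset G \<Gamma> a" using dcoset_eq[OF a *(2)] by simp
qed

lemma Union_dcosets: "bi_invariant G \<Gamma> A \<Longrightarrow> \<Union>(dcosets G \<Gamma> A) = A"
  using dcoset_subset self_mem_dcoset bi_invariantD(1)[of G \<Gamma> A] unfolding dcosets_def
  by blast

lemma dcoset_mem_dcosets_iff:
  assumes "bi_invariant G \<Gamma> A" "z \<in> carrier G"
  shows "dcoset G \<Gamma> z \<in> dcosets G \<Gamma> A \<longleftrightarrow> z \<in> A"
  using assms self_mem_dcoset[of z] dcoset_subset unfolding dcosets_def by blast

lemma bi_invariant_rcoset_subset:
  assumes "bi_invariant G \<Gamma> A" "a \<in> A" shows "\<Gamma> #> a \<subseteq> A"
  using bi_invariant_left[OF assms] by (auto simp: r_coset_def)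

lemma finite_dcosets:
  assumes A: "bi_invariant G \<Gamma> A" and fin: "finite (left_quotient G \<Gamma> A)"
  shows "finite (dcosets G \<Gamma> A)"
proof -
  have "dcosets G \<Gamma> A \<subseteq> (\<lambda>U. U <#> \<Gamma>) ` left_quotient G \<Gamma> A"
    by (auto simp: dcosets_def dcoset_def left_quotient_def)
  then show ?thesis using fin finite_surj by blast
qed

lemma hecke_sum_UN:
  assumes "finite I" "\<And>i. i \<in> I \<Longrightarrow> bi_invariant G \<Gamma> (A i)"
    and "\<And>i j. i \<in> I \<Longrightarrow> j \<in> I \<Longrightarrow> i \<noteq> j \<Longrightarrow> A i \<inter> A j = {}"
    and "\<And>i. i \<in> I \<Longrightarrow> finite (dcosets G \<Gamma> (A i))"
  shows "hecke_sum G \<Gamma> (\<Union>i\<in>I. A i) = (\<Sum>i\<in>I. hecke_sum G \<Gamma> (A i))"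
proof -
  have "dcosets G \<Gamma> (\<Union>i\<in>I. A i) = (\<Union>i\<in>I. dcosets G \<Gamma> (A i))"
    by (auto simp: dcosets_def)
  moreover have "dcosets G \<Gamma> (A i) \<inter> dcosets G \<Gamma> (A j) = {}"
    if ij: "i \<in> I" "j \<in> I" "i \<noteq> j" for i j
  proof (rule ccontr)
    assume "\<not> ?thesis"
    then obtain a where a: "a \<in> A i" "dcoset G \<Gamma> a \<in> dcosets G \<Gamma> (A j)" by (auto simp: dcosets_def)
    then have "a \<in> A j" using dcoset_mem_dcosets_iff[OF assms(2)[OF ij(2)]] bi_invariantD(1)[OF assms(2)[OF ij(1)]] by blast
    then show False using a assms(3)[OF ij] by auto
  qed
  ultimately show ?thesis unfolding hecke_sum_def
    using assms by (simp add: sum.UNION_disjoint)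
qed

lemma hecke_sum_subgroup: "hecke_sum G \<Gamma> \<Gamma> = frag_of \<Gamma>"
proof -
  have inv: "bi_invariant G \<Gamma> \<Gamma>" unfolding bi_invariant_def using subset by auto
  have "dcoset G \<Gamma> g = \<Gamma>" if "g \<in> \<Gamma>" for g
  proof (intro equalityI)
    show "\<Gamma> \<subseteq> dcoset G \<Gamma> g"
    proof
      fix x assume "x \<in> \<Gamma>"
      then have "x = (x \<otimes> inv g) \<otimes> g \<otimes> \<one>" using that by (simp add: m_assoc)
      then show "x \<in> dcoset G \<Gamma> g" unfolding mem_dcoset_iff
        using \<open>x \<in> \<Gamma>\<close> that by (meson m_closed m_inv_closed one_closed)
    qed
    show "dcoset G \<Gamma> g \<subseteq> \<Gamma>" by (rule dcoset_subset[OF inv that])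
  qed
  then have "dcosets G \<Gamma> \<Gamma> = (\<lambda>_. \<Gamma>) ` \<Gamma>" unfolding dcosets_def by (rule image_cong[OF refl])
  also have "\<dots> = {\<Gamma>}" using one_closed by (simp only: image_constant)
  finally have "dcosets G \<Gamma> \<Gamma> = {\<Gamma>}" .
  then show ?thesis by (simp add: hecke_sum_def)
qed

text \<open>Right invariance of \<open>X\<close> makes the condition in \<^const>\<open>hecke_coeff\<close> independent of the representative of
  the coset \<open>U\<close>.\<close>

lemma div_coset_invariant:
  assumes X: "bi_invariant G \<Gamma> X" and U: "b \<in> carrier G" "U = \<Gamma> #> b" and c: "c \<in> carrier G"
  shows "(\<exists>\<beta>\<in>U. c \<otimes> inv \<beta> \<in> X) \<longleftrightarrow> c \<otimes> inv b \<in> X"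
proof
  assume "\<exists>\<beta>\<in>U. c \<otimes> inv \<beta> \<in> X"
  then obtain g where g: "g \<in> \<Gamma>" "c \<otimes> inv (g \<otimes> b) \<in> X" using U by (auto simp: r_coset_def)
  have "c \<otimes> inv b = c \<otimes> inv (g \<otimes> b) \<otimes> g"
    using g(1)[THEN mem_carrier] U(1) c by (simp add: inv_mult_group m_assoc)
  then show "c \<otimes> inv b \<in> X" using bi_invariant_right[OF X g(2,1)] by simp
next
  assume "c \<otimes> inv b \<in> X"
  moreover have "b \<in> U" using U rcos_self[OF U(1)] subgroup_axioms by simp
  ultimately show "\<exists>\<beta>\<in>U. c \<otimes> inv \<beta> \<in> X" by blast
qed

text \<open>A coset \<open>\<Gamma>b\<close> in \<open>B\<close> with \<open>cb\<^sup>-\<^sup>1\<close> in \<open>A\<close> determines the double cosets \<open>Y\<close> of \<open>b\<close> and \<open>X\<close> of \<open>cb\<^sup>-\<^sup>1\<close>, so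
  the coefficients on the left sort the cosets counted on the right.\<close>

lemma sum_hecke_coeff:
  assumes A: "bi_invariant G \<Gamma> A" and B: "bi_invariant G \<Gamma> B"
    and finA: "finite (dcosets G \<Gamma> A)" and finB: "finite (left_quotient G \<Gamma> B)"
    and Z: "(SOME c. c \<in> Z) = c" and c: "c \<in> carrier G"
  shows "(\<Sum>X\<in>dcosets G \<Gamma> A. \<Sum>Y\<in>dcosets G \<Gamma> B. hecke_coeff G \<Gamma> X Y Z)
     = card {U \<in> left_quotient G \<Gamma> B. \<exists>\<beta>\<in>U. c \<otimes> inv \<beta> \<in> A}"
proof -
  have finB': "finite (dcosets G \<Gamma> B)" by (rule finite_dcosets[OF B finB])
  let ?S = "\<lambda>X Y. {U \<in> left_quotient G \<Gamma> Y. \<exists>\<beta>\<in>U. c \<otimes> inv \<beta> \<in> X}"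
  have lqB: "left_quotient G \<Gamma> Y \<subseteq> left_quotient G \<Gamma> B" if "Y \<in> dcosets G \<Gamma> B" for Y
    using Union_dcosets[OF B] that unfolding left_quotient_def by (intro image_mono) auto
  have fin: "finite (?S X Y)" if "Y \<in> dcosets G \<Gamma> B" for X Y
    using finite_subset[OF lqB[OF that] finB] by simp
  have binv: "bi_invariant G \<Gamma> X" if "X \<in> dcosets G \<Gamma> A" for X
    using that dcoset_bi_invariant bi_invariantD(1)[OF A] by (auto simp: dcosets_def)
  have binvB: "bi_invariant G \<Gamma> X" if "X \<in> dcosets G \<Gamma> B" for X
    using that dcoset_bi_invariant bi_invariantD(1)[OF B] by (auto simp: dcosets_def)
  have disj: "X = X'" if "X \<in> dcosets G \<Gamma> A'" "X' \<in> dcosets G \<Gamma> A'" "x \<in> X" "x \<in> X'" "A' \<subseteq> carrier G" for X X' x A'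
    using that dcoset_disjoint unfolding dcosets_def by blast
  have Bc: "B \<subseteq> carrier G" and Ac: "A \<subseteq> carrier G"
    using A B by (auto simp: bi_invariant_def)
  let ?P = "dcosets G \<Gamma> A \<times> dcosets G \<Gamma> B"
  have "(\<Sum>X\<in>dcosets G \<Gamma> A. \<Sum>Y\<in>dcosets G \<Gamma> B. hecke_coeff G \<Gamma> X Y Z)
      = (\<Sum>(X,Y)\<in>?P. card (?S X Y))"
    by (simp add: hecke_coeff_def Z sum.cartesian_product)
  also have "\<dots> = (\<Sum>i\<in>?P. card (?S (fst i) (snd i)))" by (simp add: case_prod_unfold)
  also have "\<dots> = card (\<Union>i\<in>?P. ?S (fst i) (snd i))"
  proof (rule card_UN_disjoint[symmetric])
    show "\<forall>i\<in>?P. \<forall>j\<in>?P. i \<noteq> j \<longrightarrow> ?S (fst i) (snd i) \<inter> ?S (fst j) (snd j) = {}"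
    proof (intro ballI impI, rule ccontr)
      fix i j assume ij: "i \<in> ?P" "j \<in> ?P" "i \<noteq> j" "?S (fst i) (snd i) \<inter> ?S (fst j) (snd j) \<noteq> {}"
      obtain X Y X' Y' where i: "i = (X, Y)" and j: "j = (X', Y')" by (cases i, cases j)
      have XY: "X \<in> dcosets G \<Gamma> A" "Y \<in> dcosets G \<Gamma> B" "X' \<in> dcosets G \<Gamma> A" "Y' \<in> dcosets G \<Gamma> B"
        using ij i j by auto
      obtain U where U: "U \<in> ?S X Y" "U \<in> ?S X' Y'" using ij i j by auto
      obtain b where b: "b \<in> Y" "U = \<Gamma> #> b" using U by (auto simp: left_quotient_def)
      obtain b' where b': "b' \<in> Y'" "U = \<Gamma> #> b'" using U by (auto simp: left_quotient_def)
      have bc: "b \<in> carrier G" using bi_invariantD(1)[OF binvB[OF XY(2)] b(1)] .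
      have "b \<in> U" using b(2) rcos_self[OF bc] subgroup_axioms by simp
      then have "b \<in> Y'" using bi_invariant_rcoset_subset[OF binvB[OF XY(4)] b'(1)] b'(2) by auto
      then have "Y = Y'" using disj[OF XY(2,4) b(1) _ Bc] by simp
      moreover have "c \<otimes> inv b \<in> X" "c \<otimes> inv b \<in> X'"
        using U div_coset_invariant[OF binv[OF XY(1)] bc b(2) c]
          div_coset_invariant[OF binv[OF XY(3)] bc b(2) c] by auto
      then have "X = X'" using disj[OF XY(1,3) _ _ Ac] by blast
      ultimately show False using ij i j by simp
    qed
  qed (use finA finB' fin in auto)
  also have "(\<Union>i\<in>?P. ?S (fst i) (snd i)) = {U \<in> left_quotient G \<Gamma> B. \<exists>\<beta>\<in>U. c \<otimes> inv \<beta> \<in> A}"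
  proof (intro equalityI subsetI)
    fix U assume "U \<in> (\<Union>i\<in>?P. ?S (fst i) (snd i))"
    then obtain X Y where "X \<in> dcosets G \<Gamma> A" "Y \<in> dcosets G \<Gamma> B" "U \<in> ?S X Y" by auto
    then show "U \<in> {U \<in> left_quotient G \<Gamma> B. \<exists>\<beta>\<in>U. c \<otimes> inv \<beta> \<in> A}"
      using lqB Union_dcosets[OF A] by blast
  next
    fix U assume "U \<in> {U \<in> left_quotient G \<Gamma> B. \<exists>\<beta>\<in>U. c \<otimes> inv \<beta> \<in> A}"
    then obtain b \<beta> where *: "b \<in> B" "U = \<Gamma> #> b" "\<beta> \<in> U" "c \<otimes> inv \<beta> \<in> A"
      by (auto simp: left_quotient_def)
    obtain X where X: "X \<in> dcosets G \<Gamma> A" "c \<otimes> inv \<beta> \<in> X" using * Union_dcosets[OF A] by auto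
    obtain Y where Y: "Y \<in> dcosets G \<Gamma> B" "b \<in> Y" using * Union_dcosets[OF B] by auto
    have "U \<in> ?S X Y" using * X Y by (auto simp: left_quotient_def)
    then show "U \<in> (\<Union>i\<in>?P. ?S (fst i) (snd i))" using X Y by auto
  qed
  finally show ?thesis .
qed

lemma lookup_sum: "Poly_Mapping.lookup (\<Sum>i\<in>I. f i) z = (\<Sum>i\<in>I. Poly_Mapping.lookup (f i) z)"
  by (induction I rule: infinite_finite_induct) (auto simp: lookup_add)

text \<open>The hypotheses say that each \<open>c\<close> in \<open>C\<close> factors as \<open>ab\<close> with \<open>b\<close> in \<open>B\<close> and \<open>a\<close> in \<open>A\<close>, uniquely up to
  replacing \<open>b\<close> by \<open>\<gamma>b\<close>, and that such products stay in \<open>C\<close>; by \<open>sum_hecke_coeff\<close> every double coset in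
  \<open>C\<close> then has coefficient 1, and all others have coefficient 0.\<close>

lemma hecke_mult_hecke_sum:
  assumes \<Delta>: "bi_invariant G \<Gamma> \<Delta>"
    and A: "bi_invariant G \<Gamma> A" and B: "bi_invariant G \<Gamma> B" and C: "bi_invariant G \<Gamma> C" "C \<subseteq> \<Delta>"
    and finA: "finite (left_quotient G \<Gamma> A)" and finB: "finite (left_quotient G \<Gamma> B)"
    and finC: "finite (left_quotient G \<Gamma> C)"
    and AB: "\<And>a b. a \<in> A \<Longrightarrow> b \<in> B \<Longrightarrow> a \<otimes> b \<in> C"
    and ex: "\<And>c. c \<in> C \<Longrightarrow> \<exists>b\<in>B. c \<otimes> inv b \<in> A"
    and uniq: "\<And>c b b'. c \<in> C \<Longrightarrow> b \<in> B \<Longrightarrow> b' \<in> B \<Longrightarrow> c \<otimes> inv b \<in> A \<Longrightarrow> c \<otimes> inv b' \<in> A \<Longrightarrow>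
      \<Gamma> #> b = \<Gamma> #> b'"
  shows "hecke_sum G \<Gamma> A \<otimes>\<^bsub>hecke_ring G \<Gamma> \<Delta>\<^esub> hecke_sum G \<Gamma> B = hecke_sum G \<Gamma> C"
proof -
  note dA = finite_dcosets[OF A finA] and dB = finite_dcosets[OF B finB]
    and dC = finite_dcosets[OF C(1) finC]
  have some: "\<exists>c. (SOME c. c \<in> Z) = c \<and> c \<in> C' \<and> dcoset G \<Gamma> c = Z"
    if Z: "Z \<in> dcosets G \<Gamma> C'" and C': "bi_invariant G \<Gamma> C'" for Z C'
  proof -
    obtain z where z: "z \<in> C'" "Z = dcoset G \<Gamma> z" using Z unfolding dcosets_def by auto
    then have zc: "z \<in> carrier G" using bi_invariantD(1)[OF C'] by blast
    have "(SOME c. c \<in> Z) \<in> Z" unfolding z(2) by (rule someI[of "\<lambda>c. c \<in> dcoset G \<Gamma> z", OF self_mem_dcoset[OF zc]])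
    then show ?thesis using dcoset_eq[OF zc] dcoset_subset[OF C' z(1)] z(2) by auto
  qed
  \<comment> \<open>Confines the support of each product of basis elements to the finite set of double cosets in \<open>C\<close>; a sum over an infinite support would be 0.\<close>
  have le: "{Z \<in> dcosets G \<Gamma> \<Delta>. hecke_coeff G \<Gamma> X Y Z \<noteq> 0} \<subseteq> dcosets G \<Gamma> C"
    if XY: "X \<in> dcosets G \<Gamma> A" "Y \<in> dcosets G \<Gamma> B" for X Y
  proof
    fix Z assume "Z \<in> {Z \<in> dcosets G \<Gamma> \<Delta>. hecke_coeff G \<Gamma> X Y Z \<noteq> 0}"
    then have Z: "Z \<in> dcosets G \<Gamma> \<Delta>" "hecke_coeff G \<Gamma> X Y Z \<noteq> 0" by auto
    obtain c where c: "(SOME c. c \<in> Z) = c" "c \<in> \<Delta>" "dcoset G \<Gamma> c = Z" using some[OF Z(1) \<Delta>] by auto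
    have cc: "c \<in> carrier G" using bi_invariantD(1)[OF \<Delta> c(2)] .
    have "{U \<in> left_quotient G \<Gamma> Y. \<exists>\<beta>\<in>U. c \<otimes> inv \<beta> \<in> X} \<noteq> {}"
      using Z(2) unfolding hecke_coeff_def c(1) by (metis card.empty)
    then obtain U \<beta> where U: "U \<in> left_quotient G \<Gamma> Y" "\<beta> \<in> U" "c \<otimes> inv \<beta> \<in> X" by blast
    have "U \<subseteq> B" using U(1) XY(2) Union_dcosets[OF B] bi_invariant_rcoset_subset[OF B]
      unfolding left_quotient_def by blast
    then have b: "\<beta> \<in> B" using U by auto
    have "c \<otimes> inv \<beta> \<in> A" using U XY Union_dcosets[OF A] by auto
    then have "c \<otimes> inv \<beta> \<otimes> \<beta> \<in> C" using AB b by blast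
    then have "c \<in> C" using cc bi_invariantD(1)[OF B b] by (simp add: m_assoc)
    then show "Z \<in> dcosets G \<Gamma> C" using c(3) by (auto simp: dcosets_def)
  qed
  have sub: "dcosets G \<Gamma> C \<subseteq> dcosets G \<Gamma> \<Delta>" using C(2) by (auto simp: dcosets_def)
  have coeff: "(\<Sum>X\<in>dcosets G \<Gamma> A. \<Sum>Y\<in>dcosets G \<Gamma> B. hecke_coeff G \<Gamma> X Y Z) = 1"
    if Z: "Z \<in> dcosets G \<Gamma> C" for Z
  proof -
    obtain c where c: "(SOME c. c \<in> Z) = c" "c \<in> C" using some[OF Z C(1)] by auto
    have cc: "c \<in> carrier G" using bi_invariantD(1)[OF C(1) c(2)] .
    obtain b where b: "b \<in> B" "c \<otimes> inv b \<in> A" using ex[OF c(2)] by auto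
    have "{U \<in> left_quotient G \<Gamma> B. \<exists>\<beta>\<in>U. c \<otimes> inv \<beta> \<in> A} = {\<Gamma> #> b}"
    proof (intro equalityI subsetI)
      fix U assume "U \<in> {U \<in> left_quotient G \<Gamma> B. \<exists>\<beta>\<in>U. c \<otimes> inv \<beta> \<in> A}"
      then obtain b' where b': "b' \<in> B" "U = \<Gamma> #> b'" "\<exists>\<beta>\<in>U. c \<otimes> inv \<beta> \<in> A"
        by (auto simp: left_quotient_def)
      then have "c \<otimes> inv b' \<in> A" using div_coset_invariant[OF A bi_invariantD(1)[OF B b'(1)] b'(2) cc] by simp
      then show "U \<in> {\<Gamma> #> b}" using uniq[OF c(2) b'(1) b(1) _ b(2)] b'(2) by simp
    next
      fix U assume "U \<in> {\<Gamma> #> b}"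
      then show "U \<in> {U \<in> left_quotient G \<Gamma> B. \<exists>\<beta>\<in>U. c \<otimes> inv \<beta> \<in> A}"
        using b div_coset_invariant[OF A bi_invariantD(1)[OF B b(1)] refl cc]
        by (auto simp: left_quotient_def)
    qed
    then show ?thesis using sum_hecke_coeff[OF A B dA finB c(1) cc] by simp
  qed
  have basis: "hecke_basis_mult G \<Gamma> \<Delta> X Y = (\<Sum>Z\<in>dcosets G \<Gamma> C. frag_cmul (int (hecke_coeff G \<Gamma> X Y Z)) (frag_of Z))"
    if XY: "X \<in> dcosets G \<Gamma> A" "Y \<in> dcosets G \<Gamma> B" for X Y
    unfolding hecke_basis_mult_def
    by (rule sum.mono_neutral_left[OF dC le[OF XY]]) (use sub in auto)
  have "hecke_sum G \<Gamma> A \<otimes>\<^bsub>hecke_ring G \<Gamma> \<Delta>\<^esub> hecke_sum G \<Gamma> B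
    = (\<Sum>X\<in>dcosets G \<Gamma> A. \<Sum>Y\<in>dcosets G \<Gamma> B. hecke_basis_mult G \<Gamma> \<Delta> X Y)"
    using dA dB by (simp add: hecke_ring_def hecke_sum_def frag_extend_sum o_def)
  also have "\<dots> = (\<Sum>X\<in>dcosets G \<Gamma> A. \<Sum>Y\<in>dcosets G \<Gamma> B. \<Sum>Z\<in>dcosets G \<Gamma> C.
      frag_cmul (int (hecke_coeff G \<Gamma> X Y Z)) (frag_of Z))"
    by (intro sum.cong refl) (simp add: basis)
  also have "\<dots> = (\<Sum>Z\<in>dcosets G \<Gamma> C. frag_of Z)" (is "?l = ?r")
  proof (rule poly_mapping_eqI)
    fix W
    have "Poly_Mapping.lookup ?l W
      = (\<Sum>X\<in>dcosets G \<Gamma> A. \<Sum>Y\<in>dcosets G \<Gamma> B. \<Sum>Z\<in>dcosets G \<Gamma> C.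
          int (hecke_coeff G \<Gamma> X Y Z) * (if W = Z then 1 else 0))"
      by (simp add: lookup_sum)
    also have "\<dots> = (if W \<in> dcosets G \<Gamma> C then
        int (\<Sum>X\<in>dcosets G \<Gamma> A. \<Sum>Y\<in>dcosets G \<Gamma> B. hecke_coeff G \<Gamma> X Y W) else 0)"
      using dC by (simp add: if_distrib cong: if_cong)
    also have "\<dots> = Poly_Mapping.lookup ?r W"
      using dC coeff by (simp add: lookup_sum)
    finally show "Poly_Mapping.lookup ?l W = Poly_Mapping.lookup ?r W" .
  qed
  finally show ?thesis by (simp add: hecke_sum_def)
qed

end

section \<open>The p-adic integers\<close>

context
  fixes p :: nat
  assumes p: "prime p"
begin

text \<open>\<^const>\<open>padic_abs\<close> is defined through the reduced fraction; additivity of multiplicities allows any fraction.\<close>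

lemma padic_abs_fraction:
  assumes "a \<noteq> 0" "b \<noteq> 0"
  shows "padic_abs p (of_int a / of_int b)
    = real p powi (int (multiplicity (int p) b) - int (multiplicity (int p) a))"
proof -
  obtain n d where nd: "quotient_of (of_int a / of_int b) = (n, d)" by fastforce
  have d: "d > 0" using quotient_of_denom_pos[OF nd] .
  have eq: "of_int a / of_int b = (of_int n / of_int d :: rat)" using quotient_of_div[OF nd] .
  then have "of_int (a * d) = (of_int (n * b) :: rat)" using assms d by (simp add: frac_eq_eq)
  then have ad: "a * d = n * b" by (simp only: of_int_eq_iff)
  then have n: "n \<noteq> 0" using assms d by auto
  have pe: "prime_elem (int p)" using p by simp
  have "multiplicity (int p) a + multiplicity (int p) d = multiplicity (int p) n + multiplicity (int p) b"
    using ad assms d n prime_elem_multiplicity_mult_distrib[OF pe]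
    by (metis less_irrefl)
  then have "int (multiplicity (int p) d) - int (multiplicity (int p) n)
      = int (multiplicity (int p) b) - int (multiplicity (int p) a)" by linarith
  then show ?thesis using assms nd by (simp add: padic_abs_def)
qed

lemma padic_abs_0 [simp]: "padic_abs p 0 = 0"
  by (simp add: padic_abs_def)

lemma padic_abs_nonneg [simp]: "padic_abs p x \<ge> 0"
  using p by (simp add: padic_abs_def)

lemma rat_common_denominator:
  fixes x y :: rat
  obtains a b c where "x = of_int a / of_int c" "y = of_int b / of_int c" "c \<noteq> 0"
proof -
  obtain a b where 1: "x = of_int a / of_int b" "b > 0" by (metis quotient_of_div quotient_of_denom_pos surj_pair)
  obtain c d where 2: "y = of_int c / of_int d" "d > 0" by (metis quotient_of_div quotient_of_denom_pos surj_pair)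
  show ?thesis
    by (rule that[of "a * d" "b * d" "c * b"]) (use 1 2 in auto)
qed

lemma padic_abs_mult: "padic_abs p (x * y) = padic_abs p x * padic_abs p y"
proof (cases "x = 0 \<or> y = 0")
  case False
  obtain a b c where 1: "x = of_int a / of_int c" "y = of_int b / of_int c" "c \<noteq> 0"
    by (rule rat_common_denominator)
  have ab: "a \<noteq> 0" "b \<noteq> 0" using False 1 by auto
  have xy: "x * y = of_int (a * b) / of_int (c * c)" using 1 by simp
  have pe: "prime_elem (int p)" using p by simp
  have p0: "real p \<noteq> 0" using p by auto
  have "padic_abs p (x * y) = real p powi (int (multiplicity (int p) (c * c)) - int (multiplicity (int p) (a * b)))"
    unfolding xy using ab 1 by (intro padic_abs_fraction) auto
  also have "\<dots> = real p powi ((int (multiplicity (int p) c) - int (multiplicity (int p) a))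
       + (int (multiplicity (int p) c) - int (multiplicity (int p) b)))"
    using ab 1 by (simp add: prime_elem_multiplicity_mult_distrib[OF pe] algebra_simps)
  also have "\<dots> = padic_abs p x * padic_abs p y"
    unfolding 1(1,2) padic_abs_fraction[OF ab(1) 1(3)] padic_abs_fraction[OF ab(2) 1(3)]
    using p0 by (intro power_int_add) simp
  finally show ?thesis .
qed auto

lemma padic_abs_minus [simp]: "padic_abs p (- x) = padic_abs p x"
proof -
  have "padic_abs p (-1) = 1"
    using padic_abs_fraction[of "-1" 1] p multiplicity_unit_right[of "-1" "int p"] by simp
  then show ?thesis using padic_abs_mult[of "-1" x] by simp
qed

lemma padic_abs_add_le: "padic_abs p (x + y) \<le> max (padic_abs p x) (padic_abs p y)"
proof (cases "x = 0 \<or> y = 0 \<or> x + y = 0")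
  case False
  obtain a b c where 1: "x = of_int a / of_int c" "y = of_int b / of_int c" "c \<noteq> 0"
    by (rule rat_common_denominator)
  have ab: "a \<noteq> 0" "b \<noteq> 0" using False 1 by auto
  have xy: "x + y = of_int (a + b) / of_int c" using 1 by (simp add: add_divide_distrib)
  have ab': "a + b \<noteq> 0" using False xy by auto
  have "int p ^ min (multiplicity (int p) a) (multiplicity (int p) b) dvd a + b"
    by (intro dvd_add multiplicity_dvd') auto
  then have m: "min (multiplicity (int p) a) (multiplicity (int p) b) \<le> multiplicity (int p) (a + b)"
    using ab' p by (intro multiplicity_geI) auto
  have p1: "real p \<ge> 1" using prime_ge_1_nat[OF p] by simp
  have "padic_abs p (x + y) = real p powi (int (multiplicity (int p) c) - int (multiplicity (int p) (a + b)))"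
    unfolding xy using ab' 1(3) by (intro padic_abs_fraction) auto
  also have "\<dots> \<le> real p powi (int (multiplicity (int p) c)
      - int (min (multiplicity (int p) a) (multiplicity (int p) b)))"
    using m p1 by (intro power_int_increasing) auto
  also have "\<dots> \<le> max (padic_abs p x) (padic_abs p y)"
    unfolding 1(1,2) using ab 1(3) by (auto simp: padic_abs_fraction min_def)
  finally show ?thesis .
qed (auto simp: le_max_iff_disj)

lemma padic_abs_diff_le: "padic_abs p (x - y) \<le> max (padic_abs p x) (padic_abs p y)"
  using padic_abs_add_le[of x "- y"] by simp

lemma padic_abs_le_1_iff: "padic_abs p x \<le> 1 \<longleftrightarrow> \<not> int p dvd snd (quotient_of x)"
proof (cases "x = 0")
  case True
  then show ?thesis using p by (simp add: prime_nat_iff)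
next
  case False
  obtain n d where nd: "quotient_of x = (n, d)" by fastforce
  have d: "d > 0" using quotient_of_denom_pos[OF nd] .
  have x: "x = of_int n / of_int d" using quotient_of_div[OF nd] .
  have n: "n \<noteq> 0" using False x by auto
  have cop: "coprime n d" using quotient_of_coprime[OF nd] .
  have abs: "padic_abs p x = real p powi (int (multiplicity (int p) d) - int (multiplicity (int p) n))"
    unfolding x using n d by (intro padic_abs_fraction) auto
  have p1: "real p > 1" using prime_gt_1_nat[OF p] by simp
  show ?thesis
  proof (cases "int p dvd d")
    case True
    then have "\<not> int p dvd n" using cop p
      by (meson coprime_common_divisor not_prime_unit prime_nat_int_transfer)
    then have "multiplicity (int p) n = 0" by (rule not_dvd_imp_multiplicity_0)
    moreover have "multiplicity (int p) d > 0"
      using True d p by (subst prime_multiplicity_gt_zero_iff) auto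
    ultimately have "padic_abs p x > 1"
      using abs one_less_power[OF p1, of "multiplicity (int p) d"]
      by (simp only: of_nat_0 diff_zero power_int_of_nat)
    then show ?thesis using True nd by simp
  next
    case False
    then have "multiplicity (int p) d = 0" by (rule not_dvd_imp_multiplicity_0)
    then show ?thesis using False abs nd p1
      by (auto simp: power_int_minus intro!: inverse_le_1_iff[THEN iffD2] one_le_power)
  qed
qed

lemma padic_abs_fraction_le_1:
  assumes "\<not> int p dvd b"
  shows "padic_abs p (of_int a / of_int b) \<le> 1"
proof (cases "a = 0")
  case False
  have b: "b \<noteq> 0" using assms by auto
  have "multiplicity (int p) b = 0" using assms by (rule not_dvd_imp_multiplicity_0)
  then have "padic_abs p (of_int a / of_int b) = inverse (real p ^ multiplicity (int p) a)"
    using padic_abs_fraction[OF False b] by (simp add: power_int_minus)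
  then show ?thesis using prime_ge_1_nat[OF p]
    by (auto intro!: inverse_le_1_iff[THEN iffD2] one_le_power)
qed auto

lemma padic_abs_of_int_le_1: "padic_abs p (of_int a) \<le> 1"
  using padic_abs_fraction_le_1[of 1 a] p by (simp add: prime_nat_iff)

lemma padic_abs_power_p: "padic_abs p (of_nat p ^ k) = inverse (real p ^ k)"
proof -
  have p0: "int p ^ k \<noteq> 0" using p by auto
  have "multiplicity (int p) (int p ^ k) = k"
    using p by (intro multiplicity_same_power) auto
  then show ?thesis using padic_abs_fraction[of "int p ^ k" 1] p0
    by (simp add: power_int_minus)
qed

lemma padic_integer_imp_int:
  assumes "padic_abs p x \<le> 1" "of_nat p ^ k * x \<in> \<int>"
  shows "x \<in> \<int>"
proof -
  obtain n d where nd: "quotient_of x = (n, d)" by fastforce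
  have d: "d > 0" using quotient_of_denom_pos[OF nd] .
  have x: "x = of_int n / of_int d" using quotient_of_div[OF nd] .
  have cop: "coprime n d" using quotient_of_coprime[OF nd] .
  have pd: "\<not> int p dvd d" using assms(1) nd padic_abs_le_1_iff by simp
  obtain z where "of_nat p ^ k * x = of_int z" using assms(2) by (auto elim: Ints_cases)
  then have "of_int (int p ^ k * n) = (of_int (z * d) :: rat)" using d x by (simp add: field_simps)
  then have "int p ^ k * n = z * d" by (simp only: of_int_eq_iff)
  then have "d dvd int p ^ k * n" by simp
  then have "d dvd int p ^ k" using cop by (metis coprime_commute coprime_dvd_mult_left_iff)
  moreover have "coprime d (int p ^ k)"
    using pd p by (metis coprime_commute coprime_power_right_iff prime_imp_coprime prime_nat_int_transfer)
  ultimately have "is_unit d" by (metis coprime_common_divisor dvd_refl)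
  then have "d = 1" using d by simp
  then show ?thesis using x by simp
qed

text \<open>Bezout's identity inverts the denominator modulo \<open>p\<^sup>k\<close>.\<close>

lemma padic_integer_approx:
  assumes "padic_abs p x \<le> 1"
  shows "\<exists>n w. x = of_int n + of_nat p ^ k * w \<and> padic_abs p w \<le> 1"
proof -
  obtain a b where nd: "quotient_of x = (a, b)" by fastforce
  have b: "b > 0" using quotient_of_denom_pos[OF nd] .
  have x: "x = of_int a / of_int b" using quotient_of_div[OF nd] .
  have pb: "\<not> int p dvd b" using assms(1) nd padic_abs_le_1_iff by simp
  then have "coprime b (int p ^ k)"
    using p by (metis coprime_commute coprime_power_right_iff prime_imp_coprime prime_nat_int_transfer)
  then obtain u v where uv: "u * b + v * int p ^ k = 1"
    by (metis bezout_int coprime_imp_gcd_eq_1)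
  define w :: rat where "w = of_int (a * v) / of_int b"
  have "of_int (u * b + v * int p ^ k) = (1::rat)" unfolding uv by simp
  then have "of_int u * of_int b + of_int v * of_nat p ^ k = (1::rat)" by simp
  then have "of_int a = of_int a * (of_int u * of_int b + of_int v * of_nat p ^ k :: rat)" by simp
  then have "x = of_int (a * u) + of_nat p ^ k * w"
    using b by (simp add: x w_def field_simps)
  moreover have "padic_abs p w \<le> 1" unfolding w_def by (rule padic_abs_fraction_le_1[OF pb])
  ultimately show ?thesis by blast
qed

subsection \<open>The completion\<close>

lemma padic_cauchyD:
  assumes "s \<in> padic_cauchy p" "e > 0"
  shows "\<exists>N. \<forall>m\<ge>N. \<forall>n\<ge>N. padic_abs p (s m - s n) < e"
  using assms unfolding padic_cauchy_def by blast

lemma padic_cauchy_bounded: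
  assumes "s \<in> padic_cauchy p"
  shows "\<exists>B>0. \<forall>n. padic_abs p (s n) \<le> B"
proof -
  obtain N where N: "\<And>m n. m \<ge> N \<Longrightarrow> n \<ge> N \<Longrightarrow> padic_abs p (s m - s n) < 1"
    using padic_cauchyD[OF assms, of 1] by auto
  define B where "B = 1 + (\<Sum>i\<le>N. padic_abs p (s i))"
  have part: "padic_abs p (s i) \<le> (\<Sum>i\<le>N. padic_abs p (s i))" if "i \<le> N" for i
    by (rule member_le_sum) (use that in auto)
  have "padic_abs p (s n) \<le> B" for n
  proof (cases "n \<le> N")
    case True then show ?thesis using part[OF True] unfolding B_def by simp
  next
    case False
    have "padic_abs p (s n - s N + s N) \<le> max (padic_abs p (s n - s N)) (padic_abs p (s N))"
      by (rule padic_abs_add_le)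
    also have "\<dots> \<le> B"
      using N[of n N] False part[of N] sum_nonneg[of "{..N}" "\<lambda>i. padic_abs p (s i)"]
      unfolding B_def by auto
    finally show ?thesis by simp
  qed
  moreover have "B > 0" unfolding B_def by (intro add_pos_nonneg sum_nonneg) auto
  ultimately show ?thesis by blast
qed

lemma padic_cauchy_add:
  assumes "s \<in> padic_cauchy p" "t \<in> padic_cauchy p"
  shows "(\<lambda>n. s n + t n) \<in> padic_cauchy p"
  unfolding padic_cauchy_def
proof (intro CollectI allI impI)
  fix e :: real assume e: "e > 0"
  obtain M where M: "\<And>m n. m \<ge> M \<Longrightarrow> n \<ge> M \<Longrightarrow> padic_abs p (s m - s n) < e"
    using padic_cauchyD[OF assms(1) e] by auto
  obtain N where N: "\<And>m n. m \<ge> N \<Longrightarrow> n \<ge> N \<Longrightarrow> padic_abs p (t m - t n) < e"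
    using padic_cauchyD[OF assms(2) e] by auto
  have "padic_abs p (s m + t m - (s n + t n)) < e" if "m \<ge> max M N" "n \<ge> max M N" for m n
  proof -
    have "padic_abs p ((s m - s n) + (t m - t n)) \<le> max (padic_abs p (s m - s n)) (padic_abs p (t m - t n))"
      by (rule padic_abs_add_le)
    also have "\<dots> < e" using M[of m n] N[of m n] that by simp
    finally show ?thesis by (simp add: algebra_simps)
  qed
  then show "\<exists>N. \<forall>m\<ge>N. \<forall>n\<ge>N. padic_abs p (s m + t m - (s n + t n)) < e" by blast
qed

lemma padic_cauchy_mult:
  assumes "s \<in> padic_cauchy p" "t \<in> padic_cauchy p"
  shows "(\<lambda>n. s n * t n) \<in> padic_cauchy p"
  unfolding padic_cauchy_def
proof (intro CollectI allI impI)
  fix e :: real assume e: "e > 0"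
  obtain A where A: "A > 0" "\<And>n. padic_abs p (s n) \<le> A" using padic_cauchy_bounded[OF assms(1)] by auto
  obtain B where B: "B > 0" "\<And>n. padic_abs p (t n) \<le> B" using padic_cauchy_bounded[OF assms(2)] by auto
  obtain M where M: "\<And>m n. m \<ge> M \<Longrightarrow> n \<ge> M \<Longrightarrow> padic_abs p (s m - s n) < e / B"
    using padic_cauchyD[OF assms(1), of "e / B"] e B by auto
  obtain N where N: "\<And>m n. m \<ge> N \<Longrightarrow> n \<ge> N \<Longrightarrow> padic_abs p (t m - t n) < e / A"
    using padic_cauchyD[OF assms(2), of "e / A"] e A by auto
  have "padic_abs p (s m * t m - s n * t n) < e" if mn: "m \<ge> max M N" "n \<ge> max M N" for m n
  proof -
    have 1: "padic_abs p (s m - s n) * padic_abs p (t m) \<le> padic_abs p (s m - s n) * B"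
      using B by (intro mult_left_mono) auto
    have 2: "padic_abs p (s m - s n) * B < e" using M[of m n] mn B(1) by (simp add: field_simps)
    have 3: "padic_abs p (s n) * padic_abs p (t m - t n) \<le> A * padic_abs p (t m - t n)"
      using A by (intro mult_right_mono) auto
    have 4: "A * padic_abs p (t m - t n) < e" using N[of m n] mn A(1) by (simp add: field_simps)
    have "padic_abs p ((s m - s n) * t m + s n * (t m - t n))
      \<le> max (padic_abs p ((s m - s n) * t m)) (padic_abs p (s n * (t m - t n)))"
      by (rule padic_abs_add_le)
    also have "\<dots> < e" using 1 2 3 4 by (simp add: padic_abs_mult)
    finally show ?thesis by (simp add: algebra_simps)
  qed
  then show "\<exists>N. \<forall>m\<ge>N. \<forall>n\<ge>N. padic_abs p (s m * t m - s n * t n) < e" by blast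
qed

lemma padic_cauchy_const: "(\<lambda>n. x) \<in> padic_cauchy p"
  by (simp add: padic_cauchy_def)

lemma padic_cauchy_minus: "s \<in> padic_cauchy p \<Longrightarrow> (\<lambda>n. - s n) \<in> padic_cauchy p"
  using padic_cauchy_mult[OF padic_cauchy_const[of "-1"]] by simp

lemma padic_null_iff: "s \<in> padic_null p \<longleftrightarrow> (\<forall>e>0. \<exists>N. \<forall>n\<ge>N. padic_abs p (s n) < e)"
  by (simp add: padic_null_def LIMSEQ_def)

lemma padic_null_subset: "padic_null p \<subseteq> padic_cauchy p"
proof
  fix s assume s: "s \<in> padic_null p"
  show "s \<in> padic_cauchy p"
    unfolding padic_cauchy_def
  proof (intro CollectI allI impI)
    fix e :: real assume "e > 0"
    then obtain N where N: "\<And>n. n \<ge> N \<Longrightarrow> padic_abs p (s n) < e" using s unfolding padic_null_iff by blast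
    have "padic_abs p (s m - s n) < e" if "m \<ge> N" "n \<ge> N" for m n
      using padic_abs_diff_le[of "s m" "s n"] N[OF that(1)] N[OF that(2)] by simp
    then show "\<exists>N. \<forall>m\<ge>N. \<forall>n\<ge>N. padic_abs p (s m - s n) < e" by blast
  qed
qed

lemma padic_null_add:
  assumes "s \<in> padic_null p" "t \<in> padic_null p"
  shows "(\<lambda>n. s n + t n) \<in> padic_null p"
  unfolding padic_null_iff
proof (intro allI impI)
  fix e :: real assume e: "e > 0"
  obtain M where M: "\<And>n. n \<ge> M \<Longrightarrow> padic_abs p (s n) < e" using assms(1) e unfolding padic_null_iff by blast
  obtain N where N: "\<And>n. n \<ge> N \<Longrightarrow> padic_abs p (t n) < e" using assms(2) e unfolding padic_null_iff by blast
  have "padic_abs p (s n + t n) < e" if "n \<ge> max M N" for n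
    using padic_abs_add_le[of "s n" "t n"] M[of n] N[of n] that by simp
  then show "\<exists>N. \<forall>n\<ge>N. padic_abs p (s n + t n) < e" by blast
qed

lemma padic_null_mult:
  assumes "s \<in> padic_cauchy p" "t \<in> padic_null p"
  shows "(\<lambda>n. s n * t n) \<in> padic_null p"
  unfolding padic_null_iff
proof (intro allI impI)
  fix e :: real assume e: "e > 0"
  obtain A where A: "A > 0" "\<And>n. padic_abs p (s n) \<le> A" using padic_cauchy_bounded[OF assms(1)] by auto
  have "e / A > 0" using e A by simp
  then obtain N where N: "\<And>n. n \<ge> N \<Longrightarrow> padic_abs p (t n) < e / A"
    using assms(2) unfolding padic_null_iff by blast
  have "padic_abs p (s n * t n) < e" if "n \<ge> N" for n
  proof -
    have "padic_abs p (s n) * padic_abs p (t n) \<le> A * padic_abs p (t n)"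
      using A by (intro mult_right_mono) auto
    also have "\<dots> < e" using N[OF that] A(1) by (simp add: field_simps)
    finally show ?thesis by (simp add: padic_abs_mult)
  qed
  then show "\<exists>N. \<forall>n\<ge>N. padic_abs p (s n * t n) < e" by blast
qed

lemma padic_null_mult_right:
  "t \<in> padic_null p \<Longrightarrow> s \<in> padic_cauchy p \<Longrightarrow> (\<lambda>n. t n * s n) \<in> padic_null p"
  using padic_null_mult by (simp add: mult.commute)

lemma cring_padic_cauchy_ring: "cring (padic_cauchy_ring p)"
proof (rule cringI)
  show "abelian_group (padic_cauchy_ring p)"
  proof (rule abelian_groupI)
    fix x assume "x \<in> carrier (padic_cauchy_ring p)"
    then show "\<exists>y\<in>carrier (padic_cauchy_ring p). y \<oplus>\<^bsub>padic_cauchy_ring p\<^esub> x = \<zero>\<^bsub>padic_cauchy_ring p\<^esub>"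
      by (intro bexI[of _ "\<lambda>n. - x n"]) (auto simp: padic_cauchy_ring_def padic_cauchy_minus)
  qed (auto simp: padic_cauchy_ring_def padic_cauchy_add padic_cauchy_const add_ac)
  show "Group.comm_monoid (padic_cauchy_ring p)"
    by (rule comm_monoidI) (auto simp: padic_cauchy_ring_def padic_cauchy_mult padic_cauchy_const mult_ac)
qed (auto simp: padic_cauchy_ring_def algebra_simps)

lemma ideal_padic_null: "ideal (padic_null p) (padic_cauchy_ring p)"
proof -
  interpret cring "padic_cauchy_ring p" by (rule cring_padic_cauchy_ring)
  have ainv: "\<ominus>\<^bsub>padic_cauchy_ring p\<^esub> s = (\<lambda>n. - s n)" if "s \<in> padic_cauchy p" for s
    using that by (intro minus_equality) (auto simp: padic_cauchy_ring_def padic_cauchy_minus)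
  show ?thesis
  proof (rule idealI)
    show "subgroup (padic_null p) (add_monoid (padic_cauchy_ring p))"
    proof (rule add.subgroupI)
      show "padic_null p \<subseteq> carrier (padic_cauchy_ring p)"
        using padic_null_subset by (simp add: padic_cauchy_ring_def)
      show "padic_null p \<noteq> {}" by (auto simp: padic_null_def intro!: exI[of _ "\<lambda>_. 0"])
      show "\<ominus>\<^bsub>padic_cauchy_ring p\<^esub> s \<in> padic_null p" if "s \<in> padic_null p" for s
        using ainv[of s] that padic_null_subset by (auto simp: padic_null_def)
      show "s \<oplus>\<^bsub>padic_cauchy_ring p\<^esub> t \<in> padic_null p"
        if "s \<in> padic_null p" "t \<in> padic_null p" for s t
        using padic_null_add[OF that] by (simp add: padic_cauchy_ring_def)
    qed
    qed (use padic_null_mult padic_null_mult_right ring_axioms in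
      \<open>auto simp: padic_cauchy_ring_def\<close>)
qed

interpretation null: ideal "padic_null p" "padic_cauchy_ring p"
  by (rule ideal_padic_null)

lemma cring_Qp: "cring (Qp p)"
  unfolding Qp_def by (rule null.quotient_is_cring[OF cring_padic_cauchy_ring])

text \<open>The element of \<^const>\<open>Qp\<close> that a Cauchy sequence represents.\<close>

definition padic_of_seq :: "(nat \<Rightarrow> rat) \<Rightarrow> (nat \<Rightarrow> rat) set" where
  "padic_of_seq s = padic_null p +>\<^bsub>padic_cauchy_ring p\<^esub> s"

lemma padic_of_seq_ring_hom: "padic_of_seq \<in> ring_hom (padic_cauchy_ring p) (Qp p)"
  unfolding padic_of_seq_def[abs_def] Qp_def by (rule null.rcos_ring_hom)

lemma carrier_Qp: "carrier (Qp p) = padic_of_seq ` padic_cauchy p"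
  by (auto simp: Qp_def FactRing_def A_RCOSETS_def' padic_of_seq_def padic_cauchy_ring_def)

lemma mem_padic_of_seq: "t \<in> padic_of_seq s \<longleftrightarrow> (\<exists>n\<in>padic_null p. t = (\<lambda>i. n i + s i))"
  by (auto simp: padic_of_seq_def a_r_coset_def' padic_cauchy_ring_def)

lemma padic_of_seq_mem_iff:
  "t \<in> padic_of_seq s \<longleftrightarrow> (\<lambda>i. t i - s i) \<in> padic_null p"
proof -
  have "t = (\<lambda>i. (t i - s i) + s i)" by simp
  then show ?thesis unfolding mem_padic_of_seq by force
qed

lemma padic_of_seq_eqI:
  assumes "(\<lambda>i. t i - s i) \<in> padic_null p" "s \<in> padic_cauchy p"
  shows "padic_of_seq t = padic_of_seq s"
proof -
  have "t \<in> padic_of_seq s" using assms(1) by (simp add: padic_of_seq_mem_iff)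
  then show ?thesis unfolding padic_of_seq_def
    using assms(2)
    by (intro null.a_repr_independence[symmetric] null.a_subgroup) (auto simp: padic_cauchy_ring_def)
qed

lemma padic_of_seq_add:
  "s \<in> padic_cauchy p \<Longrightarrow> t \<in> padic_cauchy p \<Longrightarrow>
    padic_of_seq s \<oplus>\<^bsub>Qp p\<^esub> padic_of_seq t = padic_of_seq (\<lambda>n. s n + t n)"
  using ring_hom_add[OF padic_of_seq_ring_hom, of s t] by (simp add: padic_cauchy_ring_def)

lemma padic_of_seq_mult:
  "s \<in> padic_cauchy p \<Longrightarrow> t \<in> padic_cauchy p \<Longrightarrow>
    padic_of_seq s \<otimes>\<^bsub>Qp p\<^esub> padic_of_seq t = padic_of_seq (\<lambda>n. s n * t n)"
  using ring_hom_mult[OF padic_of_seq_ring_hom, of s t] by (simp add: padic_cauchy_ring_def)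

lemma rat_to_Qp_eq: "rat_to_Qp p x = padic_of_seq (\<lambda>_. x)"
  by (simp add: rat_to_Qp_def padic_of_seq_def)

lemma rat_to_Qp_closed [simp]: "rat_to_Qp p x \<in> carrier (Qp p)"
  by (simp add: rat_to_Qp_eq carrier_Qp padic_cauchy_const)

lemma rat_to_Qp_add: "rat_to_Qp p (x + y) = rat_to_Qp p x \<oplus>\<^bsub>Qp p\<^esub> rat_to_Qp p y"
  by (simp add: rat_to_Qp_eq padic_of_seq_add padic_cauchy_const)

lemma rat_to_Qp_mult: "rat_to_Qp p (x * y) = rat_to_Qp p x \<otimes>\<^bsub>Qp p\<^esub> rat_to_Qp p y"
  by (simp add: rat_to_Qp_eq padic_of_seq_mult padic_cauchy_const)

lemma rat_to_Qp_one: "rat_to_Qp p 1 = \<one>\<^bsub>Qp p\<^esub>"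
  using ring_hom_one[OF padic_of_seq_ring_hom] by (simp add: rat_to_Qp_eq padic_cauchy_ring_def)

lemma rat_to_Qp_ring_hom: "rat_to_Qp p \<in> ring_hom rat_ring (Qp p)"
  by (rule ring_hom_memI) (auto simp: rat_to_Qp_add rat_to_Qp_mult rat_to_Qp_one)

lemma rat_to_Qp_zero: "rat_to_Qp p 0 = \<zero>\<^bsub>Qp p\<^esub>"
proof -
  interpret Q: cring "Qp p" by (rule cring_Qp)
  have "rat_to_Qp p 0 \<oplus>\<^bsub>Qp p\<^esub> rat_to_Qp p 0 = rat_to_Qp p 0" by (simp flip: rat_to_Qp_add)
  then show ?thesis by (metis Q.add.r_cancel_one rat_to_Qp_closed)
qed

text \<open>A representative differs from a Cauchy sequence by a null sequence, so the integral representative in the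
  definition of \<^const>\<open>Zp\<close> is itself Cauchy.\<close>

lemma mem_Zp_iff: "X \<in> carrier (Zp p) \<longleftrightarrow>
    (\<exists>s\<in>padic_cauchy p. (\<forall>n. padic_abs p (s n) \<le> 1) \<and> X = padic_of_seq s)"
proof
  assume "X \<in> carrier (Zp p)"
  then obtain s where s: "X \<in> carrier (Qp p)" "s \<in> X" "\<And>n. padic_abs p (s n) \<le> 1"
    unfolding Zp_def by auto
  then obtain t where t: "t \<in> padic_cauchy p" "X = padic_of_seq t" unfolding carrier_Qp by auto
  have n: "(\<lambda>i. s i - t i) \<in> padic_null p" using s(2) t(2) padic_of_seq_mem_iff by simp
  then have "(\<lambda>i. (s i - t i) + t i) \<in> padic_cauchy p"
    using padic_null_subset t(1) by (intro padic_cauchy_add) auto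
  then have "s \<in> padic_cauchy p" by simp
  moreover have "padic_of_seq s = X" using padic_of_seq_eqI[OF n t(1)] t(2) by simp
  ultimately show "\<exists>s\<in>padic_cauchy p. (\<forall>n. padic_abs p (s n) \<le> 1) \<and> X = padic_of_seq s"
    using s(3) by blast
next
  assume "\<exists>s\<in>padic_cauchy p. (\<forall>n. padic_abs p (s n) \<le> 1) \<and> X = padic_of_seq s"
  then obtain s where s: "s \<in> padic_cauchy p" "\<And>n. padic_abs p (s n) \<le> 1" "X = padic_of_seq s" by auto
  then have "s \<in> X" by (simp add: padic_of_seq_mem_iff padic_null_def)
  then show "X \<in> carrier (Zp p)" using s by (auto simp: Zp_def carrier_Qp)
qed

lemma Zp_subset: "carrier (Zp p) \<subseteq> carrier (Qp p)"
  by (auto simp: Zp_def)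

lemma Zp_simps [simp]:
  "monoid.mult (Zp p) = monoid.mult (Qp p)" "one (Zp p) = one (Qp p)"
  "ring.zero (Zp p) = ring.zero (Qp p)" "add (Zp p) = add (Qp p)"
  by (simp_all add: Zp_def)

lemma rat_to_Qp_mem_Zp_iff: "rat_to_Qp p x \<in> carrier (Zp p) \<longleftrightarrow> padic_abs p x \<le> 1"
proof
  assume "padic_abs p x \<le> 1"
  then show "rat_to_Qp p x \<in> carrier (Zp p)"
    unfolding mem_Zp_iff rat_to_Qp_eq by (intro bexI[of _ "\<lambda>_. x"]) (auto simp: padic_cauchy_const)
next
  assume "rat_to_Qp p x \<in> carrier (Zp p)"
  then obtain s where s: "\<And>n. padic_abs p (s n) \<le> 1" "s \<in> padic_of_seq (\<lambda>_. x)"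
    unfolding Zp_def rat_to_Qp_eq by auto
  then have "(\<lambda>i. s i - x) \<in> padic_null p" by (simp add: padic_of_seq_mem_iff)
  then obtain N where N: "padic_abs p (s N - x) < 1" unfolding padic_null_iff by (meson order_refl zero_less_one)
  have "padic_abs p (s N - (s N - x)) \<le> max (padic_abs p (s N)) (padic_abs p (s N - x))"
    by (rule padic_abs_diff_le)
  then show "padic_abs p x \<le> 1" using N s(1)[of N] by simp
qed

lemma Zp_add:
  assumes "X \<in> carrier (Zp p)" "Y \<in> carrier (Zp p)"
  shows "X \<oplus>\<^bsub>Qp p\<^esub> Y \<in> carrier (Zp p)"
proof -
  obtain s where s: "s \<in> padic_cauchy p" "\<And>n. padic_abs p (s n) \<le> 1" "X = padic_of_seq s"
    using assms(1) unfolding mem_Zp_iff by auto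
  obtain t where t: "t \<in> padic_cauchy p" "\<And>n. padic_abs p (t n) \<le> 1" "Y = padic_of_seq t"
    using assms(2) unfolding mem_Zp_iff by auto
  have "padic_abs p (s n + t n) \<le> 1" for n
    using padic_abs_add_le[of "s n" "t n"] s(2)[of n] t(2)[of n] by simp
  then show ?thesis unfolding mem_Zp_iff
    using s t by (intro bexI[of _ "\<lambda>n. s n + t n"]) (auto simp: padic_of_seq_add padic_cauchy_add)
qed

lemma Zp_mult:
  assumes "X \<in> carrier (Zp p)" "Y \<in> carrier (Zp p)"
  shows "X \<otimes>\<^bsub>Qp p\<^esub> Y \<in> carrier (Zp p)"
proof -
  obtain s where s: "s \<in> padic_cauchy p" "\<And>n. padic_abs p (s n) \<le> 1" "X = padic_of_seq s"
    using assms(1) unfolding mem_Zp_iff by auto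
  obtain t where t: "t \<in> padic_cauchy p" "\<And>n. padic_abs p (t n) \<le> 1" "Y = padic_of_seq t"
    using assms(2) unfolding mem_Zp_iff by auto
  have "padic_abs p (s n * t n) \<le> 1" for n
    using s(2)[of n] t(2)[of n] by (simp add: padic_abs_mult mult_le_one)
  then show ?thesis unfolding mem_Zp_iff
    using s t by (intro bexI[of _ "\<lambda>n. s n * t n"]) (auto simp: padic_of_seq_mult padic_cauchy_mult)
qed

lemma cring_Zp: "cring (Zp p)"
proof -
  interpret Q: cring "Qp p" by (rule cring_Qp)
  note [simp] = subsetD[OF Zp_subset] Zp_add Zp_mult
  have one: "\<one>\<^bsub>Qp p\<^esub> \<in> carrier (Zp p)"
    using rat_to_Qp_mem_Zp_iff[of 1] padic_abs_of_int_le_1[of 1] by (simp add: rat_to_Qp_one)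
  have zero: "\<zero>\<^bsub>Qp p\<^esub> \<in> carrier (Zp p)"
    using rat_to_Qp_mem_Zp_iff[of 0] by (simp add: rat_to_Qp_zero)
  have m1: "rat_to_Qp p (-1) \<in> carrier (Zp p)"
    using padic_abs_of_int_le_1[of "-1"] by (simp add: rat_to_Qp_mem_Zp_iff)
  \<comment> \<open>Additive inverses in \<open>Zp\<close> are multiples by the integer \<open>-1\<close>.\<close>
  have neg: "rat_to_Qp p (-1) \<otimes>\<^bsub>Qp p\<^esub> x \<oplus>\<^bsub>Qp p\<^esub> x = \<zero>\<^bsub>Qp p\<^esub>" if "x \<in> carrier (Qp p)" for x
  proof -
    have "rat_to_Qp p (-1) \<otimes>\<^bsub>Qp p\<^esub> x \<oplus>\<^bsub>Qp p\<^esub> x = (rat_to_Qp p (-1) \<oplus>\<^bsub>Qp p\<^esub> rat_to_Qp p 1) \<otimes>\<^bsub>Qp p\<^esub> x"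
      using that by (simp add: Q.l_distr rat_to_Qp_one)
    also have "\<dots> = \<zero>\<^bsub>Qp p\<^esub>" using that by (simp flip: rat_to_Qp_add add: rat_to_Qp_zero)
    finally show ?thesis .
  qed
  show ?thesis
  proof (rule cringI)
    show "abelian_group (Zp p)"
    proof (rule abelian_groupI)
      fix x assume "x \<in> carrier (Zp p)"
      then show "\<exists>y\<in>carrier (Zp p). y \<oplus>\<^bsub>Zp p\<^esub> x = \<zero>\<^bsub>Zp p\<^esub>"
        using m1 neg[of x] by (intro bexI[of _ "rat_to_Qp p (-1) \<otimes>\<^bsub>Qp p\<^esub> x"]) auto
    qed (simp_all add: zero Q.a_ac)
    show "Group.comm_monoid (Zp p)"
      by (rule comm_monoidI) (simp_all add: one Q.m_ac)
  qed (simp add: Q.l_distr)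
qed

text \<open>The integers are dense in the \<open>p\<close>-adic integers: a Cauchy sequence is eventually constant modulo \<open>p\<^sup>k\<close>,
  so an integer that approximates one late term approximates the limit.\<close>

lemma Zp_approx:
  assumes "X \<in> carrier (Zp p)"
  shows "\<exists>n. \<exists>Y\<in>carrier (Zp p). X = rat_to_Qp p (of_int n) \<oplus>\<^bsub>Qp p\<^esub> rat_to_Qp p (of_nat p ^ k) \<otimes>\<^bsub>Qp p\<^esub> Y"
proof -
  obtain s where s: "s \<in> padic_cauchy p" "\<And>n. padic_abs p (s n) \<le> 1" "X = padic_of_seq s"
    using assms(1) unfolding mem_Zp_iff by auto
  have pk: "inverse (real p ^ k) > 0" using prime_gt_0_nat[OF p] by simp
  obtain N where N: "\<And>m n. m \<ge> N \<Longrightarrow> n \<ge> N \<Longrightarrow> padic_abs p (s m - s n) < inverse (real p ^ k)"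
    using padic_cauchyD[OF s(1) pk] by auto
  obtain a w where aw: "s N = of_int a + of_nat p ^ k * w" "padic_abs p w \<le> 1"
    using padic_integer_approx[OF s(2)[of N], of k] by auto
  have q0: "of_nat p ^ k \<noteq> (0::rat)" using p by auto
  let ?q = "of_nat p ^ k :: rat"
  define t where "t = (\<lambda>n. inverse ?q * (s n + of_int (- a)))"
  have tc: "t \<in> padic_cauchy p"
    unfolding t_def by (intro padic_cauchy_mult padic_cauchy_add padic_cauchy_const s(1))
  have le: "padic_abs p (t n) \<le> 1" if "n \<ge> N" for n
  proof -
    have "padic_abs p ?q * padic_abs p (inverse ?q * (s n - s N)) = padic_abs p (s n - s N)"
      using q0 unfolding padic_abs_mult[symmetric] by (simp only: mult.assoc[symmetric] right_inverse) simp
    then have "inverse (real p ^ k) * padic_abs p (inverse ?q * (s n - s N)) < inverse (real p ^ k)"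
      using N[OF that order_refl] by (simp add: padic_abs_power_p)
    then have "padic_abs p (inverse ?q * (s n - s N)) < 1"
      using pk by (simp add: mult_less_cancel_left1)
    moreover have "t n = inverse ?q * (s n - s N) + w"
      using q0 aw(1) by (simp add: t_def field_simps)
    ultimately show ?thesis using padic_abs_add_le[of "inverse ?q * (s n - s N)" w] aw(2) by simp
  qed
  \<comment> \<open>The early terms of \<open>t\<close> need not be integral; freezing them changes \<open>t\<close> by a null sequence.\<close>
  define u where "u = (\<lambda>n. t (max n N))"
  have un: "(\<lambda>i. u i - t i) \<in> padic_null p"
    unfolding padic_null_iff u_def by (intro allI impI exI[of _ N]) (simp add: max_def)
  have uc: "u \<in> padic_cauchy p"
  proof -
    have "(\<lambda>i. (u i - t i) + t i) \<in> padic_cauchy p"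
      using un padic_null_subset tc by (intro padic_cauchy_add) auto
    then show ?thesis by simp
  qed
  have "padic_of_seq u \<in> carrier (Zp p)"
    unfolding mem_Zp_iff using uc le by (intro bexI[of _ u]) (auto simp: u_def)
  moreover have "X = rat_to_Qp p (of_int a) \<oplus>\<^bsub>Qp p\<^esub> rat_to_Qp p ?q \<otimes>\<^bsub>Qp p\<^esub> padic_of_seq u"
  proof -
    have "rat_to_Qp p (of_int a) \<oplus>\<^bsub>Qp p\<^esub> rat_to_Qp p ?q \<otimes>\<^bsub>Qp p\<^esub> padic_of_seq u
      = padic_of_seq (\<lambda>n. of_int a + ?q * t n)"
      unfolding padic_of_seq_eqI[OF un tc] rat_to_Qp_eq
      by (simp add: padic_of_seq_mult padic_of_seq_add padic_cauchy_const padic_cauchy_mult tc)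
    also have "(\<lambda>n. of_int a + ?q * t n) = s" using q0 by (simp add: t_def fun_eq_iff mult.assoc[symmetric] del: power_eq_0_iff)
    finally show ?thesis using s(3) by simp
  qed
  ultimately show ?thesis by blast
qed

end

text \<open>A denominator other than 1 has a prime divisor.\<close>

lemma padic_integer_everywhere_imp_int:
  fixes x :: rat
  assumes "\<And>p. prime p \<Longrightarrow> padic_abs p x \<le> 1"
  shows "x \<in> \<int>"
proof -
  obtain n d where nd: "quotient_of x = (n, d)" by fastforce
  have d: "d > 0" using quotient_of_denom_pos[OF nd] .
  have x: "x = of_int n / of_int d" using quotient_of_div[OF nd] .
  have "d = 1"
  proof (rule ccontr)
    assume "d \<noteq> 1"
    then have "nat d \<noteq> 1" using d by auto
    then obtain p where p: "prime p" "p dvd nat d" using prime_factor_nat by blast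
    then have "int p dvd d" using d by (metis int_dvd_int_iff int_nat_eq less_imp_le)
    then show False using padic_abs_le_1_iff[OF p(1), of x] assms[OF p(1)] nd by simp
  qed
  then show ?thesis using x by simp
qed

section \<open>Tensor products over the integers\<close>

lemma frag_extend_diff_fun: "frag_extend (\<lambda>a. f a - g a) c = frag_extend f c - frag_extend g c"
proof -
  have "Poly_Mapping.keys c \<subseteq> UNIV" by simp
  then show ?thesis
    by (induction c rule: frag_induction) (simp_all add: frag_extend_diff)
qed

text \<open>
  The operations of \<^const>\<open>tensor\<close> are unions over representatives. Each is induced by an additive map on
  formal sums that sends the bilinearity relations to relations (\<open>rels_map\<close>), so its value on the class of
  \<open>c\<close> is the class of the image of \<open>c\<close> (\<open>UN_cls\<close>). From then on elements are handled through
  \<open>tensor_induct\<close>, and maps out of the tensor product through \<open>tensor_universal\<close>.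
\<close>

locale tensor_product = L: nonassoc_algebra L + R: cring R
  for L :: "('a, 'm) ring_scheme" and R :: "('r, 'n) ring_scheme"
begin

abbreviation supported :: "('a \<times> 'r \<Rightarrow>\<^sub>0 int) \<Rightarrow> bool" where
  "supported c \<equiv> Poly_Mapping.keys c \<subseteq> carrier L \<times> carrier R"

abbreviation "V \<equiv> tensor L R"
abbreviation "rels \<equiv> tensor_relations L R"
abbreviation "cls \<equiv> tensor_class L R"
abbreviation "pt \<equiv> pure_tensor L R"

lemma supported_diff: "supported c \<Longrightarrow> supported d \<Longrightarrow> supported (c - d)"
  by (meson Un_least order_trans keys_diff)

lemma supported_add: "supported c \<Longrightarrow> supported d \<Longrightarrow> supported (c + d)"
  by (meson Un_least order_trans keys_add)

lemma supported_minus: "supported c \<Longrightarrow> supported (- c)"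
  by (simp add: keys_minus)

lemma supported_extend:
  "(\<And>a. a \<in> Poly_Mapping.keys c \<Longrightarrow> supported (f a)) \<Longrightarrow> supported (frag_extend f c)"
  using keys_frag_extend[of f c] by blast

interpretation F: comm_group "tensor_free L R"
  unfolding tensor_free_def by (rule abelian_free_Abelian_group)

lemma rels_subgroup: "subgroup rels (tensor_free L R)"
  unfolding tensor_relations_def
proof (rule F.generate_is_subgroup, safe)
  fix x y r assume "x \<in> carrier L" "y \<in> carrier L" "r \<in> carrier R"
  then show "frag_of (x \<oplus>\<^bsub>L\<^esub> y, r) - frag_of (x, r) - frag_of (y, r) \<in> carrier (tensor_free L R)"
    using supported_diff[OF supported_diff] by (simp add: tensor_free_def)
next
  fix x r s assume "x \<in> carrier L" "s \<in> carrier R" "r \<in> carrier R"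
  then show "frag_of (x, r \<oplus>\<^bsub>R\<^esub> s) - frag_of (x, r) - frag_of (x, s) \<in> carrier (tensor_free L R)"
    using supported_diff[OF supported_diff] by (simp add: tensor_free_def)
qed

interpretation rels: subgroup rels "tensor_free L R" by (rule rels_subgroup)

lemma rels_supported: "c \<in> rels \<Longrightarrow> supported c"
  using rels.subset by (auto simp: tensor_free_def dest!: subsetD)

lemma rels_zero: "0 \<in> rels"
  using rels.one_closed by (simp add: tensor_free_def)

lemma rels_minus: "c \<in> rels \<Longrightarrow> - c \<in> rels"
  using rels.m_inv_closed[of c] rels_supported[of c] by (simp add: tensor_free_def)

lemma rels_add: "c \<in> rels \<Longrightarrow> d \<in> rels \<Longrightarrow> c + d \<in> rels"
  using rels.m_closed[of c d] by (simp add: tensor_free_def)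

lemma rels_diff: "c \<in> rels \<Longrightarrow> d \<in> rels \<Longrightarrow> c - d \<in> rels"
  using rels_add[of c "- d"] rels_minus[of d] by simp

lemma rels_left:
  "x \<in> carrier L \<Longrightarrow> y \<in> carrier L \<Longrightarrow> r \<in> carrier R \<Longrightarrow>
    frag_of (x \<oplus>\<^bsub>L\<^esub> y, r) - frag_of (x, r) - frag_of (y, r) \<in> rels"
  unfolding tensor_relations_def by (rule generate.incl) blast

lemma rels_right:
  "x \<in> carrier L \<Longrightarrow> r \<in> carrier R \<Longrightarrow> s \<in> carrier R \<Longrightarrow>
    frag_of (x, r \<oplus>\<^bsub>R\<^esub> s) - frag_of (x, r) - frag_of (x, s) \<in> rels"
  unfolding tensor_relations_def by (rule generate.incl) blast

lemma rels_map:
  assumes c: "c \<in> rels"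
    and f: "\<And>a b. f (a - b) = f a - f b"
    and T: "0 \<in> T" "\<And>a b. a \<in> T \<Longrightarrow> b \<in> T \<Longrightarrow> a - b \<in> (T :: 'z :: ab_group_add set)"
    and l: "\<And>x y r. x \<in> carrier L \<Longrightarrow> y \<in> carrier L \<Longrightarrow> r \<in> carrier R \<Longrightarrow>
      f (frag_of (x \<oplus>\<^bsub>L\<^esub> y, r)) - f (frag_of (x, r)) - f (frag_of (y, r)) \<in> T"
    and r: "\<And>x r s. x \<in> carrier L \<Longrightarrow> r \<in> carrier R \<Longrightarrow> s \<in> carrier R \<Longrightarrow>
      f (frag_of (x, r \<oplus>\<^bsub>R\<^esub> s)) - f (frag_of (x, r)) - f (frag_of (x, s)) \<in> T"
  shows "f c \<in> T"
proof -
  have f0: "f 0 = 0" using f[of 0 0] by simp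
  have fm: "f (- a) = - f a" for a using f[of 0 a] f0 by simp
  have fa: "f (a + b) = f a + f b" for a b using f[of a "- b"] fm by simp
  have Tm: "- a \<in> T" if "a \<in> T" for a using T(2)[OF T(1) that] by simp
  have Ta: "a + b \<in> T" if "a \<in> T" "b \<in> T" for a b using T(2)[OF that(1) Tm[OF that(2)]] by simp
  show ?thesis
    using c unfolding tensor_relations_def
  proof (induction c rule: generate.induct)
    case one then show ?case using f0 T by (simp add: tensor_free_def)
  next
    case (incl h) then show ?case by (auto simp: f l r)
  next
    case (inv h)
    then have "f h \<in> T" by (auto simp: f l r)
    moreover have "h \<in> rels" using inv unfolding tensor_relations_def by (rule generate.incl)
    then have "inv\<^bsub>tensor_free L R\<^esub> h = - h" using rels_supported by (simp add: tensor_free_def)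
    ultimately show ?case using Tm fm by simp
  next
    case (eng h1 h2) then show ?case using Ta fa by (simp add: tensor_free_def)
  qed
qed

lemma mem_cls_iff: "d \<in> cls c \<longleftrightarrow> d - c \<in> rels"
proof -
  have "d \<in> cls c \<longleftrightarrow> (\<exists>h\<in>rels. d = h + c)"
    by (auto simp: tensor_class_def r_coset_def tensor_free_def)
  also have "\<dots> \<longleftrightarrow> d - c \<in> rels" by (metis add_diff_cancel_right' diff_add_cancel)
  finally show ?thesis .
qed

lemma cls_eq_iff: "cls c = cls d \<longleftrightarrow> c - d \<in> rels"
proof
  assume "cls c = cls d"
  moreover have "c \<in> cls c" by (simp add: mem_cls_iff rels_zero)
  ultimately show "c - d \<in> rels" by (simp add: mem_cls_iff)
next
  assume cd: "c - d \<in> rels"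
  have "e - c \<in> rels \<longleftrightarrow> e - d \<in> rels" for e
    using rels_add[OF _ cd, of "e - c"] rels_diff[OF _ cd, of "e - d"] by auto
  then show "cls c = cls d" by (auto simp: mem_cls_iff)
qed

lemma carrier_tensor: "carrier V = cls ` {c. supported c}"
  by (auto simp: tensor_def RCOSETS_def tensor_class_def tensor_free_def)

lemma cls_closed [simp]: "supported c \<Longrightarrow> cls c \<in> carrier V"
  by (auto simp: carrier_tensor)

lemma zero_tensor: "\<zero>\<^bsub>V\<^esub> = cls 0"
  by (auto simp: tensor_def mem_cls_iff)

lemma add_cls:
  assumes "supported c" "supported d"
  shows "cls c \<oplus>\<^bsub>V\<^esub> cls d = cls (c + d)"
proof -
  interpret N: normal rels "tensor_free L R" by (rule F.subgroup_imp_normal[OF rels_subgroup])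
  show ?thesis
    using N.rcos_sum[of c d] assms by (simp add: tensor_def tensor_class_def tensor_free_def)
qed

lemma UN_cls:
  assumes "\<And>a b. f (a - b) = f a - f b" "\<And>c. c \<in> rels \<Longrightarrow> g (f c) = g 0"
    and "\<And>c d. g c = g d \<longleftrightarrow> c - d \<in> T" 
  shows "(\<Union>c\<in>cls c0. g (f c :: 'z :: ab_group_add)) = g (f c0)"
proof -
  have "g (f c) = g (f c0)" if "c \<in> cls c0" for c
  proof -
    have "g (f (c - c0)) = g 0" using assms(2)[of "c - c0"] that by (simp add: mem_cls_iff)
    then have "f c - f c0 \<in> T" using assms(1)[of c c0] assms(3)[of "f (c - c0)" 0] by simp
    then show ?thesis using assms(3) by simp
  qed
  moreover have "c0 \<in> cls c0" by (simp add: mem_cls_iff rels_zero)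
  ultimately show ?thesis by blast
qed

lemma abelian_group_tensor: "abelian_group V"
proof (rule abelian_groupI)
  fix X assume "X \<in> carrier V"
  then obtain c where c: "supported c" "X = cls c" by (auto simp: carrier_tensor)
  then show "\<exists>Y\<in>carrier V. Y \<oplus>\<^bsub>V\<^esub> X = \<zero>\<^bsub>V\<^esub>"
    using supported_minus[OF c(1)] by (intro bexI[of _ "cls (- c)"]) (auto simp: add_cls zero_tensor)
qed (auto simp: carrier_tensor add_cls zero_tensor supported_add add_ac)

sublocale V: abelian_group V by (rule abelian_group_tensor)

lemma minus_cls: "supported c \<Longrightarrow> \<ominus>\<^bsub>V\<^esub> cls c = cls (- c)"
  using supported_minus[of c] by (intro V.minus_equality) (auto simp: add_cls zero_tensor)

lemma pt_closed [simp]: "x \<in> carrier L \<Longrightarrow> r \<in> carrier R \<Longrightarrow> pt x r \<in> carrier V"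
  by (simp add: pure_tensor_def)

lemma pt_add_left:
  "x \<in> carrier L \<Longrightarrow> y \<in> carrier L \<Longrightarrow> r \<in> carrier R \<Longrightarrow> pt (x \<oplus>\<^bsub>L\<^esub> y) r = pt x r \<oplus>\<^bsub>V\<^esub> pt y r"
  using rels_left[of x y r] by (simp add: pure_tensor_def add_cls cls_eq_iff diff_diff_eq)

lemma pt_add_right:
  "x \<in> carrier L \<Longrightarrow> r \<in> carrier R \<Longrightarrow> s \<in> carrier R \<Longrightarrow> pt x (r \<oplus>\<^bsub>R\<^esub> s) = pt x r \<oplus>\<^bsub>V\<^esub> pt x s"
  using rels_right[of x r s] by (simp add: pure_tensor_def add_cls cls_eq_iff diff_diff_eq)

lemma pt_zero_left: "r \<in> carrier R \<Longrightarrow> pt \<zero>\<^bsub>L\<^esub> r = \<zero>\<^bsub>V\<^esub>"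
  using pt_add_left[of "\<zero>\<^bsub>L\<^esub>" "\<zero>\<^bsub>L\<^esub>" r] by simp

lemma pt_minus_left: "x \<in> carrier L \<Longrightarrow> r \<in> carrier R \<Longrightarrow> \<ominus>\<^bsub>V\<^esub> pt x r = pt (\<ominus>\<^bsub>L\<^esub> x) r"
  by (intro V.minus_equality) (simp_all add: pt_zero_left L.l_neg flip: pt_add_left)

text \<open>The negative of a pure tensor is the pure tensor \<open>(-x) \<otimes> r\<close>, so that pure tensors generate the tensor product
  under addition alone.\<close>

lemma tensor_induct [consumes 1, case_names pure add]:
  assumes "X \<in> carrier V"
    and pure: "\<And>x r. x \<in> carrier L \<Longrightarrow> r \<in> carrier R \<Longrightarrow> P (pt x r)"
    and add: "\<And>X Y. X \<in> carrier V \<Longrightarrow> Y \<in> carrier V \<Longrightarrow> P X \<Longrightarrow> P Y \<Longrightarrow> P (X \<oplus>\<^bsub>V\<^esub> Y)"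
  shows "P X"
proof -
  obtain c where c: "supported c" "X = cls c" using assms(1) by (auto simp: carrier_tensor)
  have "P (cls c) \<and> P (cls (- c))"
    using c(1)
  proof (induction rule: free_Abelian_group_induct[consumes 1, case_names zero diff of])
    case zero
    have "cls 0 = pt \<zero>\<^bsub>L\<^esub> \<zero>\<^bsub>R\<^esub>" by (simp add: pt_zero_left zero_tensor)
    then show ?case using pure[of "\<zero>\<^bsub>L\<^esub>" "\<zero>\<^bsub>R\<^esub>"] by simp
  next
    case (diff a b)
    then have "P (cls a \<oplus>\<^bsub>V\<^esub> cls (- b))" "P (cls b \<oplus>\<^bsub>V\<^esub> cls (- a))"
      using supported_minus by (auto intro!: add)
    then show ?case using diff supported_minus by (simp add: add_cls)
  next
    case (of a)
    then obtain x r where a: "a = (x, r)" "x \<in> carrier L" "r \<in> carrier R" by auto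
    then have "cls (- frag_of a) = pt (\<ominus>\<^bsub>L\<^esub> x) r"
      using pt_minus_left[of x r] minus_cls[of "frag_of (x, r)"] by (simp add: pure_tensor_def)
    moreover have "cls (frag_of a) = pt x r" using a by (simp add: pure_tensor_def)
    ultimately show ?case using a by (simp add: pure)
  qed
  then show ?thesis using c by simp
qed

text \<open>The additive map from the free abelian group that extends \<open>b\<close> kills the generators of the relations
  because \<open>b\<close> is biadditive.\<close>

lemma tensor_universal:
  assumes W: "abelian_group W"
    and b: "\<And>x r. x \<in> carrier L \<Longrightarrow> r \<in> carrier R \<Longrightarrow> b x r \<in> carrier W"
    and l: "\<And>x y r. x \<in> carrier L \<Longrightarrow> y \<in> carrier L \<Longrightarrow> r \<in> carrier R \<Longrightarrow>
      b (x \<oplus>\<^bsub>L\<^esub> y) r = b x r \<oplus>\<^bsub>W\<^esub> b y r"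
    and r: "\<And>x r s. x \<in> carrier L \<Longrightarrow> r \<in> carrier R \<Longrightarrow> s \<in> carrier R \<Longrightarrow>
      b x (r \<oplus>\<^bsub>R\<^esub> s) = b x r \<oplus>\<^bsub>W\<^esub> b x s"
  obtains g where "\<And>X. X \<in> carrier V \<Longrightarrow> g X \<in> carrier W"
    "\<And>X Y. X \<in> carrier V \<Longrightarrow> Y \<in> carrier V \<Longrightarrow> g (X \<oplus>\<^bsub>V\<^esub> Y) = g X \<oplus>\<^bsub>W\<^esub> g Y"
    "\<And>x r. x \<in> carrier L \<Longrightarrow> r \<in> carrier R \<Longrightarrow> g (pt x r) = b x r"
proof -
  interpret W: abelian_group W by (rule W)
  have "comm_group (add_monoid W)" by (rule W.a_comm_group)
  then obtain h where h: "h \<in> hom (tensor_free L R) (add_monoid W)"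
    and hof: "\<And>z. z \<in> carrier L \<times> carrier R \<Longrightarrow> h (frag_of z) = case_prod b z"
  proof (rule comm_group.free_Abelian_group_universal)
    show "case_prod b ` (carrier L \<times> carrier R) \<subseteq> carrier (add_monoid W)" using b by auto
  qed (auto simp: tensor_free_def)
  interpret h: group_hom "tensor_free L R" "add_monoid W" h
    using h W.a_group by (simp add: group_hom_def group_hom_axioms_def)
  have hc: "h c \<in> carrier W" if "supported c" for c
    using h.hom_closed[of c] that by (simp add: tensor_free_def)
  have hadd: "h (c + d) = h c \<oplus>\<^bsub>W\<^esub> h d" if "supported c" "supported d" for c d
    using h.hom_mult[of c d] that by (simp add: tensor_free_def)
  have hdiff: "h (c - d) = h c \<ominus>\<^bsub>W\<^esub> h d" if "supported c" "supported d" for c d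
    using h.hom_inv[of d] hadd[OF that(1) supported_minus[OF that(2)]] that
    by (simp add: tensor_free_def a_inv_def a_minus_def)
  have cancel: "u \<oplus>\<^bsub>W\<^esub> (v \<oplus>\<^bsub>W\<^esub> (\<ominus>\<^bsub>W\<^esub> u \<oplus>\<^bsub>W\<^esub> \<ominus>\<^bsub>W\<^esub> v)) = \<zero>\<^bsub>W\<^esub>"
    if "u \<in> carrier W" "v \<in> carrier W" for u v
    using that by (simp add: W.minus_add[symmetric] W.r_neg flip: W.a_assoc)
  have "kernel (tensor_free L R) (add_monoid W) h = {c \<in> carrier (tensor_free L R). h c = \<zero>\<^bsub>W\<^esub>}"
    by (simp add: kernel_def)
  then have K: "subgroup {c \<in> carrier (tensor_free L R). h c = \<zero>\<^bsub>W\<^esub>} (tensor_free L R)"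
    using h.subgroup_kernel by simp
  have "rels \<subseteq> {c \<in> carrier (tensor_free L R). h c = \<zero>\<^bsub>W\<^esub>}"
    unfolding tensor_relations_def
  proof (rule F.generate_subgroup_incl[OF _ K], safe)
    fix x y r assume *: "x \<in> carrier L" "y \<in> carrier L" "r \<in> carrier R"
    show "frag_of (x \<oplus>\<^bsub>L\<^esub> y, r) - frag_of (x, r) - frag_of (y, r) \<in> carrier (tensor_free L R)"
      using rels_supported[OF rels_left[OF *]] by (simp add: tensor_free_def)
    have "supported (frag_of (x \<oplus>\<^bsub>L\<^esub> y, r) - frag_of (x, r))"
      using * by (intro supported_diff) auto
    then show "h (frag_of (x \<oplus>\<^bsub>L\<^esub> y, r) - frag_of (x, r) - frag_of (y, r)) = \<zero>\<^bsub>W\<^esub>"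
      using * b by (simp add: hdiff hof l a_minus_def W.minus_add W.a_ac W.r_neg W.r_neg1 W.r_neg2 cancel)
  next
    fix x r s assume *: "x \<in> carrier L" "r \<in> carrier R" "s \<in> carrier R"
    show "frag_of (x, r \<oplus>\<^bsub>R\<^esub> s) - frag_of (x, r) - frag_of (x, s) \<in> carrier (tensor_free L R)"
      using rels_supported[OF rels_right[OF *]] by (simp add: tensor_free_def)
    have "supported (frag_of (x, r \<oplus>\<^bsub>R\<^esub> s) - frag_of (x, r))"
      using * by (intro supported_diff) auto
    then show "h (frag_of (x, r \<oplus>\<^bsub>R\<^esub> s) - frag_of (x, r) - frag_of (x, s)) = \<zero>\<^bsub>W\<^esub>"
      using * b by (simp add: hdiff hof r a_minus_def W.minus_add W.a_ac W.r_neg W.r_neg1 W.r_neg2 cancel)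
  qed
  then have ker: "h c = \<zero>\<^bsub>W\<^esub>" if "c \<in> rels" for c using that by auto
  define g where "g = (\<lambda>X. h (SOME c. supported c \<and> X = cls c))"
  have g: "g (cls c) = h c" if c: "supported c" for c
  proof -
    have "supported (SOME d. supported d \<and> cls c = cls d) \<and> cls c = cls (SOME d. supported d \<and> cls c = cls d)"
      by (rule someI[of "\<lambda>d. supported d \<and> cls c = cls d" c]) (simp add: c)
    then obtain d where d: "d = (SOME d. supported d \<and> cls c = cls d)" "supported d" "cls c = cls d"
      by blast
    have "h ((c - d) + d) = h (c - d) \<oplus>\<^bsub>W\<^esub> h d"
      using c d(2) by (intro hadd supported_diff)
    then have "h c = h d" using ker[of "c - d"] d(3) hc[OF d(2)] by (simp add: cls_eq_iff)
    then show ?thesis using d(1) by (simp add: g_def)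
  qed
  show ?thesis
  proof
    show "g X \<in> carrier W" if "X \<in> carrier V" for X using that g hc by (auto simp: carrier_tensor)
    show "g (X \<oplus>\<^bsub>V\<^esub> Y) = g X \<oplus>\<^bsub>W\<^esub> g Y" if "X \<in> carrier V" "Y \<in> carrier V" for X Y
      using that g hadd supported_add by (auto simp: carrier_tensor add_cls)
    show "g (pt x r) = b x r" if "x \<in> carrier L" "r \<in> carrier R" for x r
      using that g[of "frag_of (x, r)"] hof[of "(x, r)"] by (simp add: pure_tensor_def)
  qed
qed

subsection \<open>Scalars and products\<close>

lemma smult_cls:
  assumes a: "a \<in> carrier R"
  shows "a \<odot>\<^bsub>V\<^esub> cls c = cls (frag_extend (\<lambda>(x, s). frag_of (x, a \<otimes>\<^bsub>R\<^esub> s)) c)"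
proof -
  let ?f = "frag_extend (\<lambda>(x, s). frag_of (x, a \<otimes>\<^bsub>R\<^esub> s))"
  have "cls (?f c) = cls 0" if "c \<in> rels" for c
  proof -
    have "?f c \<in> rels"
      by (rule rels_map[OF that frag_extend_diff rels_zero rels_diff])
        (use a in \<open>auto simp: R.r_distr intro!: rels_left rels_right\<close>)
    then show ?thesis by (simp add: cls_eq_iff)
  qed
  then show ?thesis
    using UN_cls[of ?f cls rels c] cls_eq_iff by (simp add: tensor_def frag_extend_diff)
qed

lemma supported_smult:
  "a \<in> carrier R \<Longrightarrow> supported c \<Longrightarrow> supported (frag_extend (\<lambda>(x, s). frag_of (x, a \<otimes>\<^bsub>R\<^esub> s)) c)"
  by (rule supported_extend) auto

lemma smult_closed: "a \<in> carrier R \<Longrightarrow> X \<in> carrier V \<Longrightarrow> a \<odot>\<^bsub>V\<^esub> X \<in> carrier V"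
  by (auto simp: carrier_tensor smult_cls supported_smult intro!: imageI)

lemma smult_add:
  "a \<in> carrier R \<Longrightarrow> X \<in> carrier V \<Longrightarrow> Y \<in> carrier V \<Longrightarrow>
    a \<odot>\<^bsub>V\<^esub> (X \<oplus>\<^bsub>V\<^esub> Y) = a \<odot>\<^bsub>V\<^esub> X \<oplus>\<^bsub>V\<^esub> a \<odot>\<^bsub>V\<^esub> Y"
  by (auto simp: carrier_tensor smult_cls supported_smult add_cls frag_extend_add)

lemma smult_pt:
  "a \<in> carrier R \<Longrightarrow> a \<odot>\<^bsub>V\<^esub> pt x r = pt x (a \<otimes>\<^bsub>R\<^esub> r)"
  by (simp add: pure_tensor_def smult_cls)

lemma module_tensor: "module R V"
proof (rule moduleI)
  fix a b X assume ab: "a \<in> carrier R" "b \<in> carrier R" and X: "X \<in> carrier V"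
  show "(a \<oplus>\<^bsub>R\<^esub> b) \<odot>\<^bsub>V\<^esub> X = a \<odot>\<^bsub>V\<^esub> X \<oplus>\<^bsub>V\<^esub> b \<odot>\<^bsub>V\<^esub> X"
    using X by (induction X rule: tensor_induct)
      (use ab in \<open>simp_all add: smult_pt R.l_distr pt_add_right smult_add smult_closed V.a_ac\<close>)
  show "(a \<otimes>\<^bsub>R\<^esub> b) \<odot>\<^bsub>V\<^esub> X = a \<odot>\<^bsub>V\<^esub> (b \<odot>\<^bsub>V\<^esub> X)"
    using X by (induction X rule: tensor_induct)
      (use ab in \<open>simp_all add: smult_pt R.m_assoc smult_add smult_closed\<close>)
next
  fix X assume "X \<in> carrier V"
  then show "\<one>\<^bsub>R\<^esub> \<odot>\<^bsub>V\<^esub> X = X"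
    by (induction X rule: tensor_induct) (simp_all add: smult_pt smult_add)
qed (auto simp: smult_closed smult_add R.is_cring abelian_group_tensor)

sublocale V: module R V by (rule module_tensor)

text \<open>The product of \<^const>\<open>tensor\<close> on the level of formal sums.\<close>

definition fmult :: "('a \<times> 'r \<Rightarrow>\<^sub>0 int) \<Rightarrow> ('a \<times> 'r \<Rightarrow>\<^sub>0 int) \<Rightarrow> ('a \<times> 'r \<Rightarrow>\<^sub>0 int)" where
  "fmult c d = frag_extend (\<lambda>(x, r). frag_extend (\<lambda>(y, s). frag_of (x \<otimes>\<^bsub>L\<^esub> y, r \<otimes>\<^bsub>R\<^esub> s)) d) c"

lemma fmult_diff_left: "fmult (c - d) e = fmult c e - fmult d e"
  by (simp add: fmult_def frag_extend_diff)

lemma fmult_diff_right: "fmult c (d - e) = fmult c d - fmult c e"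
  by (simp add: fmult_def frag_extend_diff frag_extend_diff_fun case_prod_unfold)

lemma fmult_0 [simp]: "fmult 0 d = 0" "fmult c 0 = 0"
  using fmult_diff_left[of 0 0 d] fmult_diff_right[of c 0 0] by simp_all

lemma fmult_add_left: "fmult (c + d) e = fmult c e + fmult d e"
  by (simp add: fmult_def frag_extend_add)

lemma fmult_add_right: "fmult c (d + e) = fmult c d + fmult c e"
  using fmult_diff_right[of c d "- e"] fmult_diff_right[of c 0 e] by simp

lemma fmult_of [simp]:
  "fmult (frag_of (x, r)) (frag_of (y, s)) = frag_of (x \<otimes>\<^bsub>L\<^esub> y, r \<otimes>\<^bsub>R\<^esub> s)"
  by (simp add: fmult_def)

lemma supported_fmult:
  assumes "supported c" "supported d" shows "supported (fmult c d)"
  unfolding fmult_def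
proof (rule supported_extend)
  fix a assume a: "a \<in> Poly_Mapping.keys c"
  have "supported (frag_extend (\<lambda>(y, s). frag_of (fst a \<otimes>\<^bsub>L\<^esub> y, snd a \<otimes>\<^bsub>R\<^esub> s)) d)"
  proof (rule supported_extend)
    fix b assume "b \<in> Poly_Mapping.keys d"
    then show "supported (case b of (y, s) \<Rightarrow> frag_of (fst a \<otimes>\<^bsub>L\<^esub> y, snd a \<otimes>\<^bsub>R\<^esub> s))"
      using a assms by (cases a, cases b) (auto intro!: L.prod_closed)
  qed
  then show "supported (case a of (x, r) \<Rightarrow> frag_extend (\<lambda>(y, s). frag_of (x \<otimes>\<^bsub>L\<^esub> y, r \<otimes>\<^bsub>R\<^esub> s)) d)"
    by (simp add: case_prod_unfold)
qed

lemma fmult_rels_left: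
  assumes c: "c \<in> rels" and d: "supported d"
  shows "fmult c d \<in> rels"
proof (rule rels_map[OF c fmult_diff_left rels_zero rels_diff])
  fix x y r assume *: "x \<in> carrier L" "y \<in> carrier L" "r \<in> carrier R"
  show "fmult (frag_of (x \<oplus>\<^bsub>L\<^esub> y, r)) d - fmult (frag_of (x, r)) d - fmult (frag_of (y, r)) d \<in> rels"
    using d
  proof (induction rule: free_Abelian_group_induct[consumes 1, case_names zero diff of])
    case (diff a b)
    show ?case using rels_diff[OF diff(3,4)] by (simp add: fmult_diff_left fmult_diff_right algebra_simps)
  next
    case (of a)
    then show ?case using * rels_left by (cases a) (auto simp: L.prod_add_left L.prod_closed)
  qed (simp add: rels_zero)
next
  fix x r s assume *: "x \<in> carrier L" "r \<in> carrier R" "s \<in> carrier R"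
  show "fmult (frag_of (x, r \<oplus>\<^bsub>R\<^esub> s)) d - fmult (frag_of (x, r)) d - fmult (frag_of (x, s)) d \<in> rels"
    using d
  proof (induction rule: free_Abelian_group_induct[consumes 1, case_names zero diff of])
    case (diff a b)
    show ?case using rels_diff[OF diff(3,4)] by (simp add: fmult_diff_left fmult_diff_right algebra_simps)
  next
    case (of a)
    then show ?case using * rels_right by (cases a) (auto simp: R.l_distr L.prod_closed)
  qed (simp add: rels_zero)
qed

lemma fmult_rels_right:
  assumes d: "d \<in> rels" and c: "supported c"
  shows "fmult c d \<in> rels"
proof (rule rels_map[OF d fmult_diff_right rels_zero rels_diff])
  fix x y r assume *: "x \<in> carrier L" "y \<in> carrier L" "r \<in> carrier R"
  show "fmult c (frag_of (x \<oplus>\<^bsub>L\<^esub> y, r)) - fmult c (frag_of (x, r)) - fmult c (frag_of (y, r)) \<in> rels"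
    using c
  proof (induction rule: free_Abelian_group_induct[consumes 1, case_names zero diff of])
    case (diff a b)
    show ?case using rels_diff[OF diff(3,4)] by (simp add: fmult_diff_left fmult_diff_right algebra_simps)
  next
    case (of a)
    then show ?case using * rels_left by (cases a) (auto simp: L.prod_add_right L.prod_closed)
  qed (simp add: rels_zero)
next
  fix x r s assume *: "x \<in> carrier L" "r \<in> carrier R" "s \<in> carrier R"
  show "fmult c (frag_of (x, r \<oplus>\<^bsub>R\<^esub> s)) - fmult c (frag_of (x, r)) - fmult c (frag_of (x, s)) \<in> rels"
    using c
  proof (induction rule: free_Abelian_group_induct[consumes 1, case_names zero diff of])
    case (diff a b)
    show ?case using rels_diff[OF diff(3,4)] by (simp add: fmult_diff_left fmult_diff_right algebra_simps)
  next
    case (of a)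
    then show ?case using * rels_right by (cases a) (auto simp: R.r_distr L.prod_closed)
  qed (simp add: rels_zero)
qed

lemma mult_cls:
  assumes c: "supported c" and d: "supported d"
  shows "cls c \<otimes>\<^bsub>V\<^esub> cls d = cls (fmult c d)"
proof -
  have "cls (fmult c' d') = cls (fmult c d)" if "c' \<in> cls c" "d' \<in> cls d" for c' d'
  proof -
    have cd: "c' - c \<in> rels" "d' - d \<in> rels" using that by (auto simp: mem_cls_iff)
    have "supported ((c' - c) + c)" using rels_supported[OF cd(1)] c by (rule supported_add)
    then have c': "supported c'" by simp
    have "fmult c' d' - fmult c d = fmult c' (d' - d) + fmult (c' - c) d"
      by (simp add: fmult_diff_right fmult_diff_left)
    then show ?thesis
      using rels_add[OF fmult_rels_right[OF cd(2) c'] fmult_rels_left[OF cd(1) d]]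
      by (simp add: cls_eq_iff)
  qed
  moreover have "c \<in> cls c" "d \<in> cls d" by (simp_all add: mem_cls_iff rels_zero)
  ultimately have "(\<Union>c'\<in>cls c. \<Union>d'\<in>cls d. cls (fmult c' d')) = cls (fmult c d)" by blast
  then show ?thesis by (simp add: tensor_def fmult_def)
qed

lemma nonassoc_algebra_tensor: "nonassoc_algebra V"
proof (intro nonassoc_algebra.intro nonassoc_algebra_axioms.intro abelian_group_tensor)
  fix X Y Z assume XYZ: "X \<in> carrier V" "Y \<in> carrier V" "Z \<in> carrier V"
  then obtain c d e where *: "supported c" "X = cls c" "supported d" "Y = cls d" "supported e" "Z = cls e"
    by (auto simp: carrier_tensor)
  show "(X \<oplus>\<^bsub>V\<^esub> Y) \<otimes>\<^bsub>V\<^esub> Z = X \<otimes>\<^bsub>V\<^esub> Z \<oplus>\<^bsub>V\<^esub> Y \<otimes>\<^bsub>V\<^esub> Z"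
    using * by (simp add: add_cls mult_cls supported_fmult supported_add fmult_add_left)
  show "X \<otimes>\<^bsub>V\<^esub> (Y \<oplus>\<^bsub>V\<^esub> Z) = X \<otimes>\<^bsub>V\<^esub> Y \<oplus>\<^bsub>V\<^esub> X \<otimes>\<^bsub>V\<^esub> Z"
    using * by (simp add: add_cls mult_cls supported_fmult supported_add fmult_add_right)
qed (auto simp: carrier_tensor mult_cls supported_fmult intro!: imageI)

sublocale V: nonassoc_algebra V by (rule nonassoc_algebra_tensor)

lemma mult_pt:
  "x \<in> carrier L \<Longrightarrow> y \<in> carrier L \<Longrightarrow> r \<in> carrier R \<Longrightarrow> s \<in> carrier R \<Longrightarrow>
    pt x r \<otimes>\<^bsub>V\<^esub> pt y s = pt (x \<otimes>\<^bsub>L\<^esub> y) (r \<otimes>\<^bsub>R\<^esub> s)"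
  by (simp add: pure_tensor_def mult_cls)

lemma smult_mult_left:
  assumes "a \<in> carrier R" "X \<in> carrier V" "Y \<in> carrier V"
  shows "(a \<odot>\<^bsub>V\<^esub> X) \<otimes>\<^bsub>V\<^esub> Y = a \<odot>\<^bsub>V\<^esub> (X \<otimes>\<^bsub>V\<^esub> Y)"
  using assms(2)
proof (induction X rule: tensor_induct)
  case (pure x r)
  show ?case using assms(3)
    by (induction Y rule: tensor_induct)
      (use assms(1) pure in \<open>simp_all add: smult_pt mult_pt R.m_assoc L.prod_closed V.prod_add_right
        V.prod_closed V.smult_r_distr\<close>)
qed (use assms in \<open>simp_all add: V.smult_r_distr V.prod_add_left V.prod_closed\<close>)

lemma smult_mult_right:
  assumes "a \<in> carrier R" "X \<in> carrier V" "Y \<in> carrier V"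
  shows "X \<otimes>\<^bsub>V\<^esub> (a \<odot>\<^bsub>V\<^esub> Y) = a \<odot>\<^bsub>V\<^esub> (X \<otimes>\<^bsub>V\<^esub> Y)"
  using assms(2)
proof (induction X rule: tensor_induct)
  case (pure x r)
  show ?case using assms(3)
    by (induction Y rule: tensor_induct)
      (use assms(1) pure in \<open>simp_all add: smult_pt mult_pt R.m_ac L.prod_closed V.prod_add_right
        V.prod_closed V.smult_r_distr\<close>)
qed (use assms in \<open>simp_all add: V.smult_r_distr V.prod_add_left V.prod_closed\<close>)

end

locale tensor_base_change = R: tensor_product L R + S: tensor_product L S
  for L :: "('a, 'm) ring_scheme" and R :: "('r, 'n) ring_scheme" and S :: "('s, 'k) ring_scheme" +
  fixes h :: "'r \<Rightarrow> 's"
  assumes h: "h \<in> ring_hom R S"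
begin

abbreviation "tm \<equiv> tensor_map L S h"

lemma tensor_map_cls: "tm (R.cls c) = S.cls (frag_extend (\<lambda>(x, r). frag_of (x, h r)) c)"
proof -
  let ?f = "frag_extend (\<lambda>(x, r). frag_of (x, h r))"
  have "S.cls (?f c) = S.cls 0" if "c \<in> R.rels" for c
  proof -
    have "?f c \<in> S.rels"
      by (rule R.rels_map[OF that frag_extend_diff S.rels_zero S.rels_diff])
        (use ring_hom_closed[OF h] ring_hom_add[OF h] in \<open>auto intro!: S.rels_left S.rels_right\<close>)
    then show ?thesis by (simp add: S.cls_eq_iff)
  qed
  then show ?thesis
    using R.UN_cls[of ?f S.cls S.rels c] S.cls_eq_iff by (simp add: tensor_map_def frag_extend_diff)
qed

lemma supported_map: "R.supported c \<Longrightarrow> S.supported (frag_extend (\<lambda>(x, r). frag_of (x, h r)) c)"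
  using ring_hom_closed[OF h] by (intro S.supported_extend) auto

lemma tensor_map_closed: "X \<in> carrier R.V \<Longrightarrow> tm X \<in> carrier S.V"
  by (auto simp: R.carrier_tensor tensor_map_cls supported_map)

lemma tensor_map_add:
  "X \<in> carrier R.V \<Longrightarrow> Y \<in> carrier R.V \<Longrightarrow> tm (X \<oplus>\<^bsub>R.V\<^esub> Y) = tm X \<oplus>\<^bsub>S.V\<^esub> tm Y"
  by (auto simp: R.carrier_tensor R.add_cls S.add_cls tensor_map_cls supported_map frag_extend_add)

lemma tensor_map_pt: "tm (R.pt x r) = S.pt x (h r)"
  by (simp add: pure_tensor_def tensor_map_cls)

lemma tensor_map_smult:
  assumes "a \<in> carrier R" "X \<in> carrier R.V"
  shows "tm (a \<odot>\<^bsub>R.V\<^esub> X) = h a \<odot>\<^bsub>S.V\<^esub> tm X"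
  using assms(2)
  by (induction X rule: R.tensor_induct)
    (use assms(1) in \<open>simp_all add: R.smult_pt S.smult_pt tensor_map_pt ring_hom_mult[OF h] ring_hom_closed[OF h]
      R.V.smult_r_distr S.V.smult_r_distr tensor_map_add tensor_map_closed\<close>)

lemma tensor_map_mult:
  assumes "X \<in> carrier R.V" "Y \<in> carrier R.V"
  shows "tm (X \<otimes>\<^bsub>R.V\<^esub> Y) = tm X \<otimes>\<^bsub>S.V\<^esub> tm Y"
  using assms(1)
proof (induction X rule: R.tensor_induct)
  case (pure x r)
  show ?case using assms(2)
    by (induction Y rule: R.tensor_induct)
      (use pure in \<open>simp_all add: R.mult_pt S.mult_pt tensor_map_pt ring_hom_mult[OF h] ring_hom_closed[OF h]
        R.V.prod_add_right S.V.prod_add_right R.V.prod_closed tensor_map_add tensor_map_closed\<close>)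
qed (use assms in \<open>simp_all add: R.V.prod_add_left S.V.prod_add_left R.V.prod_closed
        tensor_map_add tensor_map_closed\<close>)

end

section \<open>Automorphism groups of algebras\<close>

lemma alg_AutD:
  assumes "\<alpha> \<in> alg_Aut K V"
  shows "x \<in> carrier V \<Longrightarrow> \<alpha> x \<in> carrier V"
    and "x \<in> carrier V \<Longrightarrow> y \<in> carrier V \<Longrightarrow> \<alpha> (x \<oplus>\<^bsub>V\<^esub> y) = \<alpha> x \<oplus>\<^bsub>V\<^esub> \<alpha> y"
    and "x \<in> carrier V \<Longrightarrow> y \<in> carrier V \<Longrightarrow> \<alpha> (x \<otimes>\<^bsub>V\<^esub> y) = \<alpha> x \<otimes>\<^bsub>V\<^esub> \<alpha> y"
    and "r \<in> carrier K \<Longrightarrow> x \<in> carrier V \<Longrightarrow> \<alpha> (r \<odot>\<^bsub>V\<^esub> x) = r \<odot>\<^bsub>V\<^esub> \<alpha> x"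
    and "\<alpha> \<in> extensional (carrier V)" "bij_betw \<alpha> (carrier V) (carrier V)" "inj_on \<alpha> (carrier V)"
    "\<alpha> ` carrier V = carrier V"
  using assms unfolding alg_Aut_def alg_End_def bij_betw_def by (auto simp: PiE_def)

lemma alg_AutI:
  assumes "\<alpha> \<in> extensional (carrier V)" "bij_betw \<alpha> (carrier V) (carrier V)"
    and "\<And>x y. x \<in> carrier V \<Longrightarrow> y \<in> carrier V \<Longrightarrow> \<alpha> (x \<oplus>\<^bsub>V\<^esub> y) = \<alpha> x \<oplus>\<^bsub>V\<^esub> \<alpha> y"
    and "\<And>x y. x \<in> carrier V \<Longrightarrow> y \<in> carrier V \<Longrightarrow> \<alpha> (x \<otimes>\<^bsub>V\<^esub> y) = \<alpha> x \<otimes>\<^bsub>V\<^esub> \<alpha> y"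
    and "\<And>r x. r \<in> carrier K \<Longrightarrow> x \<in> carrier V \<Longrightarrow> \<alpha> (r \<odot>\<^bsub>V\<^esub> x) = r \<odot>\<^bsub>V\<^esub> \<alpha> x"
  shows "\<alpha> \<in> alg_Aut K V"
  using assms unfolding alg_Aut_def alg_End_def
  by (auto simp: PiE_def bij_betw_def)

lemma Aut_group_simps:
  "carrier (Aut_group K V) = alg_Aut K V"
  "\<one>\<^bsub>Aut_group K V\<^esub> = (\<lambda>x\<in>carrier V. x)"
  "\<alpha> \<otimes>\<^bsub>Aut_group K V\<^esub> \<beta> = compose (carrier V) \<beta> \<alpha>"
  by (simp_all add: Aut_group_def)

locale scalar_algebra = module K V + nonassoc_algebra V 
  for K :: "('k, 'n) ring_scheme" (structure) and V :: "('k, 'b, 'm) module_scheme" (structure)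
begin

lemma Aut_one: "(\<lambda>x\<in>carrier V. x) \<in> alg_Aut K V"
  by (rule alg_AutI) (auto simp: prod_closed bij_betw_def inj_on_def)

lemma Aut_compose:
  assumes "\<alpha> \<in> alg_Aut K V" "\<beta> \<in> alg_Aut K V"
  shows "compose (carrier V) \<beta> \<alpha> \<in> alg_Aut K V"
proof (rule alg_AutI)
  show "bij_betw (compose (carrier V) \<beta> \<alpha>) (carrier V) (carrier V)"
    using bij_betw_trans[OF alg_AutD(6)[OF assms(1)] alg_AutD(6)[OF assms(2)]]
    by (rule bij_betw_cong[THEN iffD1, rotated]) (simp add: compose_def)
qed (simp_all add: compose_def alg_AutD[OF assms(1)] alg_AutD[OF assms(2)] prod_closed)

lemma Aut_inverse:
  assumes "\<alpha> \<in> alg_Aut K V"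
  shows "restrict (inv_into (carrier V) \<alpha>) (carrier V) \<in> alg_Aut K V"
proof -
  note a = alg_AutD[OF assms]
  define \<beta> where "\<beta> = restrict (inv_into (carrier V) \<alpha>) (carrier V)"
  have bij: "bij_betw \<beta> (carrier V) (carrier V)"
    using bij_betw_inv_into[OF a(6)] unfolding \<beta>_def
    by (rule bij_betw_cong[THEN iffD1, rotated]) simp
  have \<beta>: "\<beta> x \<in> carrier V" "\<alpha> (\<beta> x) = x" if "x \<in> carrier V" for x
    using that a(6) bij_betwE[OF bij] by (auto simp: \<beta>_def bij_betw_inv_into_right)
  have eqI: "\<beta> x = y" if "y \<in> carrier V" "x = \<alpha> y" for x y
    using that a(6) by (auto simp: \<beta>_def bij_betw_inv_into_left a(1))
  show ?thesis
    unfolding \<beta>_def[symmetric]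
  proof (rule alg_AutI)
    show "\<beta> \<in> extensional (carrier V)" by (simp add: \<beta>_def)
  qed (use bij in \<open>auto intro!: eqI simp: \<beta> a prod_closed\<close>)
qed

lemma compose_Aut_id: "\<alpha> \<in> alg_Aut K V \<Longrightarrow> compose (carrier V) \<alpha> (\<lambda>x\<in>carrier V. x) = \<alpha>"
  using extensional_arb[OF alg_AutD(5)[of \<alpha> K V]] by (auto simp: compose_def restrict_def fun_eq_iff)

lemma group_Aut_group: "group (Aut_group K V)"
proof (rule groupI)
  fix \<alpha> assume \<alpha>: "\<alpha> \<in> carrier (Aut_group K V)"
  then have "\<alpha> \<in> alg_Aut K V" by (simp add: Aut_group_simps)
  note a = alg_AutD[OF this]
  have "compose (carrier V) \<alpha> (restrict (inv_into (carrier V) \<alpha>) (carrier V)) = (\<lambda>x\<in>carrier V. x)"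
    using a(6) by (auto simp: compose_def bij_betw_inv_into_right)
  then show "\<exists>\<beta>\<in>carrier (Aut_group K V). \<beta> \<otimes>\<^bsub>Aut_group K V\<^esub> \<alpha> = \<one>\<^bsub>Aut_group K V\<^esub>"
    using Aut_inverse \<alpha> by (auto simp: Aut_group_simps)
next
  fix \<alpha> \<beta> \<gamma> assume "\<alpha> \<in> carrier (Aut_group K V)"
  then have "\<alpha> \<in> carrier V \<rightarrow> carrier V" using alg_AutD(1)[of \<alpha> K V] by (auto simp: Aut_group_simps)
  then show "\<alpha> \<otimes>\<^bsub>Aut_group K V\<^esub> \<beta> \<otimes>\<^bsub>Aut_group K V\<^esub> \<gamma>
      = \<alpha> \<otimes>\<^bsub>Aut_group K V\<^esub> (\<beta> \<otimes>\<^bsub>Aut_group K V\<^esub> \<gamma>)"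
    by (simp add: Aut_group_simps compose_assoc)
qed (simp_all add: Aut_group_simps Aut_one Aut_compose compose_Aut_id)

end

text \<open>As \<open>\<iota>\<close> is injective and compatible with all operations, an automorphism \<open>\<alpha>\<close> that maps the image of \<open>M\<close>
  into itself restricts to an endomorphism of \<open>M\<close>; membership is a condition on that image alone.\<close>

lemma lattice_End_iff:
  assumes \<iota>: "\<And>x. x \<in> carrier M \<Longrightarrow> \<iota> x \<in> carrier V" "inj_on \<iota> (carrier M)"
    and closed: "\<And>x y. x \<in> carrier M \<Longrightarrow> y \<in> carrier M \<Longrightarrow> x \<oplus>\<^bsub>M\<^esub> y \<in> carrier M"
      "\<And>x y. x \<in> carrier M \<Longrightarrow> y \<in> carrier M \<Longrightarrow> x \<otimes>\<^bsub>M\<^esub> y \<in> carrier M"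
      "\<And>r x. r \<in> carrier R \<Longrightarrow> x \<in> carrier M \<Longrightarrow> r \<odot>\<^bsub>M\<^esub> x \<in> carrier M"
    and hom: "\<And>x y. x \<in> carrier M \<Longrightarrow> y \<in> carrier M \<Longrightarrow> \<iota> (x \<oplus>\<^bsub>M\<^esub> y) = \<iota> x \<oplus>\<^bsub>V\<^esub> \<iota> y"
      "\<And>x y. x \<in> carrier M \<Longrightarrow> y \<in> carrier M \<Longrightarrow> \<iota> (x \<otimes>\<^bsub>M\<^esub> y) = \<iota> x \<otimes>\<^bsub>V\<^esub> \<iota> y"
      "\<And>r x. r \<in> carrier R \<Longrightarrow> x \<in> carrier M \<Longrightarrow> \<iota> (r \<odot>\<^bsub>M\<^esub> x) = h r \<odot>\<^bsub>V\<^esub> \<iota> x"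
      "\<And>r. r \<in> carrier R \<Longrightarrow> h r \<in> carrier K"
  shows "\<alpha> \<in> lattice_End R M K V \<iota> \<longleftrightarrow> \<alpha> \<in> alg_Aut K V \<and> \<alpha> ` \<iota> ` carrier M \<subseteq> \<iota> ` carrier M"
      (is ?End)
    and "\<alpha> \<in> lattice_Aut R M K V \<iota> \<longleftrightarrow> \<alpha> \<in> alg_Aut K V \<and> \<alpha> ` \<iota> ` carrier M = \<iota> ` carrier M"
      (is ?Aut)
proof -
  have main: "\<exists>\<phi>\<in>alg_End R M. \<forall>x\<in>carrier M. \<alpha> (\<iota> x) = \<iota> (\<phi> x)"
    if \<alpha>: "\<alpha> \<in> alg_Aut K V" and sub: "\<alpha> ` \<iota> ` carrier M \<subseteq> \<iota> ` carrier M"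
  proof -
    note a = alg_AutD[OF \<alpha>]
    define \<phi> where "\<phi> = (\<lambda>x\<in>carrier M. inv_into (carrier M) \<iota> (\<alpha> (\<iota> x)))"
    have \<phi>: "\<phi> x \<in> carrier M" "\<iota> (\<phi> x) = \<alpha> (\<iota> x)" if "x \<in> carrier M" for x
      using that sub by (auto simp: \<phi>_def intro!: inv_into_into f_inv_into_f)
    have eqI: "\<phi> x = y" if "x \<in> carrier M" "y \<in> carrier M" "\<alpha> (\<iota> x) = \<iota> y" for x y
      using inj_onD[OF \<iota>(2), of "\<phi> x" y] \<phi> that by simp
    have "\<phi> \<in> alg_End R M"
      unfolding alg_End_def
    proof (intro CollectI conjI ballI)
      show "\<phi> \<in> carrier M \<rightarrow>\<^sub>E carrier M" using \<phi>(1) by (auto simp: \<phi>_def PiE_def)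
    qed (auto intro!: eqI simp: closed \<phi> hom a \<iota>)
    then show ?thesis using \<phi>(2) by (intro bexI[of _ \<phi>]) simp_all
  qed
  have img: "\<alpha> ` \<iota> ` carrier M = \<iota> ` \<phi> ` carrier M" if "\<forall>x\<in>carrier M. \<alpha> (\<iota> x) = \<iota> (\<phi> x)" for \<phi>
    using that by (auto simp: image_image)
  show ?End
  proof
    assume "\<alpha> \<in> lattice_End R M K V \<iota>"
    then obtain \<phi> where \<phi>: "\<alpha> \<in> alg_Aut K V" "\<phi> \<in> alg_End R M" "\<forall>x\<in>carrier M. \<alpha> (\<iota> x) = \<iota> (\<phi> x)"
      by (auto simp: lattice_End_def)
    then have "\<phi> ` carrier M \<subseteq> carrier M" by (auto simp: alg_End_def)
    then show "\<alpha> \<in> alg_Aut K V \<and> \<alpha> ` \<iota> ` carrier M \<subseteq> \<iota> ` carrier M"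
      using \<phi> img by auto
  qed (use main in \<open>auto simp: lattice_End_def\<close>)
  show ?Aut
  proof
    assume "\<alpha> \<in> lattice_Aut R M K V \<iota>"
    then obtain \<phi> where \<phi>: "\<alpha> \<in> alg_Aut K V" "\<phi> \<in> alg_Aut R M" "\<forall>x\<in>carrier M. \<alpha> (\<iota> x) = \<iota> (\<phi> x)"
      by (auto simp: lattice_Aut_def)
    then show "\<alpha> \<in> alg_Aut K V \<and> \<alpha> ` \<iota> ` carrier M = \<iota> ` carrier M"
      using img[OF \<phi>(3)] alg_AutD(8)[OF \<phi>(2)] by simp
  next
    assume *: "\<alpha> \<in> alg_Aut K V \<and> \<alpha> ` \<iota> ` carrier M = \<iota> ` carrier M"
    then obtain \<phi> where \<phi>: "\<phi> \<in> alg_End R M" "\<forall>x\<in>carrier M. \<alpha> (\<iota> x) = \<iota> (\<phi> x)" using main by auto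
    have \<phi>M: "\<phi> ` carrier M \<subseteq> carrier M" using \<phi>(1) by (auto simp: alg_End_def)
    have "\<iota> ` \<phi> ` carrier M = \<iota> ` carrier M" using img[OF \<phi>(2)] * by simp
    then have "\<phi> ` carrier M = carrier M" using inj_on_image_eq_iff[OF \<iota>(2) \<phi>M] by simp
    moreover have "inj_on \<phi> (carrier M)"
    proof (rule inj_onI)
      fix x y assume xy: "x \<in> carrier M" "y \<in> carrier M" "\<phi> x = \<phi> y"
      then have "\<alpha> (\<iota> x) = \<alpha> (\<iota> y)" using \<phi>(2) by simp
      then have "\<iota> x = \<iota> y" using * alg_AutD(7)[of \<alpha> K V] xy \<iota>(1) by (auto dest: inj_onD)
      then show "x = y" using \<iota>(2) xy by (auto dest: inj_onD)
    qed
    ultimately have "\<phi> \<in> alg_Aut R M" using \<phi>(1) by (simp add: alg_Aut_def bij_betw_def)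
    then show "\<alpha> \<in> lattice_Aut R M K V \<iota>" using * \<phi>(2) by (auto simp: lattice_Aut_def)
  qed
qed

section \<open>Endomorphisms of a lattice\<close>

text \<open>The global and the local pairs \<open>\<Gamma> \<subseteq> \<Delta>\<close> are both instances of this setting, with the index \<open>ind\<close>. The
  abelian group \<open>A\<close> is the lattice itself.\<close>

locale algebra_lattice = scalar_algebra K V
  for K :: "('k, 'n) ring_scheme" (structure) and V :: "('k, 'b, 'm) module_scheme" (structure) +
  fixes \<Lambda> :: "'b set"
  assumes \<Lambda>_subgroup: "subgroup \<Lambda> (add_monoid V)"
begin

definition "G = Aut_group K V"
definition "\<Gamma> = {\<alpha> \<in> alg_Aut K V. \<alpha> ` \<Lambda> = \<Lambda>}"
definition "\<Delta> = {\<alpha> \<in> alg_Aut K V. \<alpha> ` \<Lambda> \<subseteq> \<Lambda>}"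
definition "ind = lattice_index V \<Lambda>"

definition "A = (add_monoid V)\<lparr>carrier := \<Lambda>\<rparr>"

lemma A_simps [simp]:
  "carrier A = \<Lambda>" "x \<otimes>\<^bsub>A\<^esub> y = x \<oplus>\<^bsub>V\<^esub> y" "\<one>\<^bsub>A\<^esub> = \<zero>\<^bsub>V\<^esub>"
  by (simp_all add: A_def)

sublocale G: group G unfolding G_def by (rule group_Aut_group)

lemma \<Lambda>_subset: "\<Lambda> \<subseteq> carrier V"
  using subgroup.subset[OF \<Lambda>_subgroup] by simp

lemma \<Lambda>_carrier [simp]: "x \<in> \<Lambda> \<Longrightarrow> x \<in> carrier V"
  using \<Lambda>_subset by auto

lemma \<Lambda>_add: "x \<in> \<Lambda> \<Longrightarrow> y \<in> \<Lambda> \<Longrightarrow> x \<oplus>\<^bsub>V\<^esub> y \<in> \<Lambda>"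
  using subgroup.m_closed[OF \<Lambda>_subgroup] by simp

sublocale A: comm_group A
  unfolding A_def
  by (rule group.group_comm_groupI[OF group.subgroup_imp_group[OF a_group \<Lambda>_subgroup]])
    (auto intro: a_comm simp: subsetD[OF \<Lambda>_subset])

lemma G_simps:
  "carrier G = alg_Aut K V" "\<one>\<^bsub>G\<^esub> = (\<lambda>x\<in>carrier V. x)"
  "x \<in> carrier V \<Longrightarrow> (\<alpha> \<otimes>\<^bsub>G\<^esub> \<beta>) x = \<beta> (\<alpha> x)"
  by (simp_all add: G_def Aut_group_simps compose_def)

lemma image_mult: "S \<subseteq> carrier V \<Longrightarrow> (\<alpha> \<otimes>\<^bsub>G\<^esub> \<beta>) ` S = \<beta> ` \<alpha> ` S"
  by (auto simp: G_simps image_image subset_iff)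

lemma image_one: "S \<subseteq> carrier V \<Longrightarrow> \<one>\<^bsub>G\<^esub> ` S = S"
  by (auto simp: G_simps subset_iff image_iff)

lemma image_carrier: "\<alpha> \<in> carrier G \<Longrightarrow> S \<subseteq> carrier V \<Longrightarrow> \<alpha> ` S \<subseteq> carrier V"
  using alg_AutD(1)[of \<alpha> K V] by (auto simp: G_simps)

lemma image_inv_cancel:
  assumes "\<alpha> \<in> carrier G" "S \<subseteq> carrier V"
  shows "(inv\<^bsub>G\<^esub> \<alpha>) ` \<alpha> ` S = S" "\<alpha> ` (inv\<^bsub>G\<^esub> \<alpha>) ` S = S"
  using image_mult[OF assms(2), of \<alpha> "inv\<^bsub>G\<^esub> \<alpha>"] image_mult[OF assms(2), of "inv\<^bsub>G\<^esub> \<alpha>" \<alpha>]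
    image_one[OF assms(2)] assms(1) by simp_all

lemma \<Gamma>D: "\<gamma> \<in> \<Gamma> \<Longrightarrow> \<gamma> \<in> carrier G" "\<gamma> \<in> \<Gamma> \<Longrightarrow> \<gamma> ` \<Lambda> = \<Lambda>"
  by (simp_all add: \<Gamma>_def G_simps)

lemma \<Delta>D: "\<gamma> \<in> \<Delta> \<Longrightarrow> \<gamma> \<in> carrier G" "\<gamma> \<in> \<Delta> \<Longrightarrow> \<gamma> ` \<Lambda> \<subseteq> \<Lambda>"
  by (simp_all add: \<Delta>_def G_simps)

lemma \<Gamma>I: "\<gamma> \<in> carrier G \<Longrightarrow> \<gamma> ` \<Lambda> = \<Lambda> \<Longrightarrow> \<gamma> \<in> \<Gamma>"
  by (simp add: \<Gamma>_def G_simps)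

lemma \<Delta>I: "\<gamma> \<in> carrier G \<Longrightarrow> \<gamma> ` \<Lambda> \<subseteq> \<Lambda> \<Longrightarrow> \<gamma> \<in> \<Delta>"
  by (simp add: \<Delta>_def G_simps)

lemma \<Gamma>_subset_\<Delta>: "\<Gamma> \<subseteq> \<Delta>"
  by (auto simp: \<Gamma>_def \<Delta>_def)

lemma \<Delta>_mult: "\<alpha> \<in> \<Delta> \<Longrightarrow> \<beta> \<in> \<Delta> \<Longrightarrow> \<alpha> \<otimes>\<^bsub>G\<^esub> \<beta> \<in> \<Delta>"
  using \<Delta>D[of \<alpha>] \<Delta>D[of \<beta>] by (intro \<Delta>I) (auto simp: image_mult[OF \<Lambda>_subset])

lemma \<Gamma>_subgroup: "subgroup \<Gamma> G"
proof (rule G.subgroupI)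
  show "\<Gamma> \<noteq> {}" using \<Gamma>I[OF G.one_closed image_one[OF \<Lambda>_subset]] by auto
  show "inv\<^bsub>G\<^esub> \<gamma> \<in> \<Gamma>" if "\<gamma> \<in> \<Gamma>" for \<gamma>
    using \<Gamma>D[OF that] image_inv_cancel(1)[OF \<Gamma>D(1)[OF that] \<Lambda>_subset] by (intro \<Gamma>I) auto
  show "\<gamma> \<otimes>\<^bsub>G\<^esub> \<delta> \<in> \<Gamma>" if "\<gamma> \<in> \<Gamma>" "\<delta> \<in> \<Gamma>" for \<gamma> \<delta>
    using \<Gamma>D[OF that(1)] \<Gamma>D[OF that(2)] by (intro \<Gamma>I) (auto simp: image_mult[OF \<Lambda>_subset])
qed (auto dest: \<Gamma>D)

sublocale G: group_with_subgroup G \<Gamma>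
  by (intro group_with_subgroup.intro G.is_group \<Gamma>_subgroup)

lemma bi_invariant_\<Delta>: "bi_invariant G \<Gamma> \<Delta>"
  unfolding bi_invariant_def
proof (intro conjI subsetI ballI)
  fix \<gamma> \<alpha> \<delta> assume "\<gamma> \<in> \<Gamma>" "\<alpha> \<in> \<Delta>" "\<delta> \<in> \<Gamma>"
  then show "\<gamma> \<otimes>\<^bsub>G\<^esub> \<alpha> \<otimes>\<^bsub>G\<^esub> \<delta> \<in> \<Delta>" using \<Gamma>_subset_\<Delta> by (intro \<Delta>_mult) auto
qed (rule \<Delta>D(1))

text \<open>In \<open>\<gamma>\<alpha>\<close> the factor \<open>\<gamma>\<close> acts first, so it permutes \<open>\<Lambda>\<close> before \<open>\<alpha>\<close> is applied.\<close>

lemma rcos_eq_iff_image_eq: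
  assumes "\<alpha> \<in> carrier G" "\<beta> \<in> carrier G"
  shows "\<Gamma> #>\<^bsub>G\<^esub> \<alpha> = \<Gamma> #>\<^bsub>G\<^esub> \<beta> \<longleftrightarrow> \<alpha> ` \<Lambda> = \<beta> ` \<Lambda>"
proof -
  have "\<Gamma> #>\<^bsub>G\<^esub> \<alpha> = \<Gamma> #>\<^bsub>G\<^esub> \<beta> \<longleftrightarrow> \<alpha> \<otimes>\<^bsub>G\<^esub> inv\<^bsub>G\<^esub> \<beta> \<in> \<Gamma>"
    using G.rcos_eq_iff[OF \<Gamma>_subgroup assms] .
  also have "\<dots> \<longleftrightarrow> (inv\<^bsub>G\<^esub> \<beta>) ` \<alpha> ` \<Lambda> = \<Lambda>"
  proof -
    have gc: "\<alpha> \<otimes>\<^bsub>G\<^esub> inv\<^bsub>G\<^esub> \<beta> \<in> carrier G" using assms by simp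
    show ?thesis
      unfolding image_mult[OF \<Lambda>_subset, symmetric] using \<Gamma>I[OF gc] \<Gamma>D(2) by blast
  qed
  also have "\<dots> \<longleftrightarrow> \<alpha> ` \<Lambda> = \<beta> ` \<Lambda>"
    using image_inv_cancel[OF assms(2)] image_carrier[OF assms(1) \<Lambda>_subset] \<Lambda>_subset by metis
  finally show ?thesis .
qed

lemma \<Delta>_hom: "\<alpha> \<in> \<Delta> \<Longrightarrow> \<alpha> \<in> hom A A"
  using alg_AutD(2)[of \<alpha> K V] by (auto simp: \<Delta>_def hom_def)

lemma image_subgroup:
  assumes "\<alpha> \<in> \<Delta>" shows "subgroup (\<alpha> ` \<Lambda>) A"
proof -
  interpret group_hom A A \<alpha>
    using \<Delta>_hom[OF assms] by (simp add: group_hom_def group_hom_axioms_def A.is_group)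
  show ?thesis using subgroup_img_is_subgroup[OF A.subgroup_self] by simp
qed

lemma ind_eq: "ind \<alpha> = card (rcosets\<^bsub>A\<^esub> (\<alpha> ` \<Lambda>))"
  by (simp add: ind_def lattice_index_def A_def)

text \<open>Both indices appear in the chain of \<open>\<Lambda>\<close>, \<open>\<beta>(\<Lambda>)\<close> and \<open>\<beta>(\<alpha>(\<Lambda>))\<close>, as \<open>\<beta>\<close> carries \<open>\<Lambda> / \<alpha>(\<Lambda>)\<close> isomorphically to
  \<open>\<beta>(\<Lambda>) / \<beta>(\<alpha>(\<Lambda>))\<close>.\<close>

lemma ind_mult:
  assumes \<alpha>: "\<alpha> \<in> \<Delta>" and \<beta>: "\<beta> \<in> \<Delta>"
  shows "ind (\<alpha> \<otimes>\<^bsub>G\<^esub> \<beta>) = ind \<alpha> * ind \<beta>"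
proof -
  have inj: "inj_on \<beta> (carrier V)" using \<beta> alg_AutD(7)[of \<beta> K V] by (auto simp: \<Delta>_def)
  let ?B = "A\<lparr>carrier := \<beta> ` \<Lambda>\<rparr>"
  have ab: "\<beta> ` \<alpha> ` \<Lambda> \<subseteq> \<beta> ` \<Lambda>" using \<Delta>D(2)[OF \<alpha>] by auto
  have sub: "subgroup (\<beta> ` \<alpha> ` \<Lambda>) A"
    using image_subgroup[OF \<Delta>_mult[OF \<alpha> \<beta>]] image_mult[OF \<Lambda>_subset] by simp
  have B: "group ?B" using A.subgroup_imp_group[OF image_subgroup[OF \<beta>]] .
  have sub': "subgroup (\<beta> ` \<alpha> ` \<Lambda>) ?B"
    using A.subgroup_incl[OF sub image_subgroup[OF \<beta>] ab] .
  have "card (rcosets\<^bsub>A\<^esub> {x \<in> carrier A. \<beta> x \<in> \<beta> ` \<alpha> ` \<Lambda>}) = card (rcosets\<^bsub>?B\<^esub> (\<beta> ` \<alpha> ` \<Lambda>))"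
  proof (rule card_rcosets_vimage[OF A.is_group B _ sub'])
    show "\<beta> \<in> hom A ?B" using \<Delta>_hom[OF \<beta>] by (auto simp: hom_def)
    fix b assume "b \<in> carrier ?B"
    then obtain a where a: "a \<in> \<Lambda>" "b = \<beta> a" by auto
    have "b \<in> carrier V" using a \<Delta>D(2)[OF \<beta>] by auto
    then show "\<exists>a\<in>carrier A. \<exists>k\<in>\<beta> ` \<alpha> ` \<Lambda>. b = k \<otimes>\<^bsub>?B\<^esub> \<beta> a"
      using subgroup.one_closed[OF sub] a by (intro bexI[of _ a] bexI[of _ "\<zero>\<^bsub>V\<^esub>"]) auto
  qed
  moreover have "{x \<in> carrier A. \<beta> x \<in> \<beta> ` \<alpha> ` \<Lambda>} = \<alpha> ` \<Lambda>"
  proof (intro equalityI subsetI)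
    fix x assume "x \<in> {x \<in> carrier A. \<beta> x \<in> \<beta> ` \<alpha> ` \<Lambda>}"
    then obtain y where y: "x \<in> \<Lambda>" "y \<in> \<alpha> ` \<Lambda>" "\<beta> x = \<beta> y" by auto
    then have "x = y" using inj_onD[OF inj y(3)] \<Delta>D(2)[OF \<alpha>] by auto
    then show "x \<in> \<alpha> ` \<Lambda>" using y by simp
  qed (use \<Delta>D(2)[OF \<alpha>] in auto)
  ultimately have "card (rcosets\<^bsub>?B\<^esub> (\<beta> ` \<alpha> ` \<Lambda>)) = ind \<alpha>" by (simp add: ind_eq)
  moreover have "card (rcosets\<^bsub>A\<^esub> (\<beta> ` \<alpha> ` \<Lambda>)) = card (rcosets\<^bsub>?B\<^esub> (\<beta> ` \<alpha> ` \<Lambda>)) * card (rcosets\<^bsub>A\<^esub> (\<beta> ` \<Lambda>))"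
    by (rule A.card_rcosets_tower[OF image_subgroup[OF \<beta>] sub ab])
  ultimately show ?thesis by (simp add: ind_eq image_mult[OF \<Lambda>_subset])
qed

lemma ind_eq_1_iff:
  assumes "\<alpha> \<in> \<Delta>" shows "ind \<alpha> = 1 \<longleftrightarrow> \<alpha> \<in> \<Gamma>"
proof
  assume "ind \<alpha> = 1"
  then have "\<alpha> ` \<Lambda> = \<Lambda>" using A.card_rcosets_eq_1[OF image_subgroup[OF assms]] by (simp add: ind_eq)
  then show "\<alpha> \<in> \<Gamma>" using \<Delta>D(1)[OF assms] by (intro \<Gamma>I)
next
  assume "\<alpha> \<in> \<Gamma>"
  then have "rcosets\<^bsub>A\<^esub> (\<alpha> ` \<Lambda>) = {\<Lambda>}"
    using A.coset_join2[OF _ A.subgroup_self] A.one_closed by (auto simp: rcosets_eq_image \<Gamma>D(2))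
  then show "ind \<alpha> = 1" by (simp add: ind_eq)
qed

definition "level n = {\<alpha> \<in> \<Delta>. ind \<alpha> = n}"

lemma level_1: "level 1 = \<Gamma>"
  using ind_eq_1_iff \<Gamma>_subset_\<Delta> by (auto simp: level_def)

lemma level_mult: "\<alpha> \<in> level m \<Longrightarrow> \<beta> \<in> level n \<Longrightarrow> \<alpha> \<otimes>\<^bsub>G\<^esub> \<beta> \<in> level (m * n)"
  by (simp add: level_def \<Delta>_mult ind_mult)

lemma level_carrier: "level n \<subseteq> carrier G"
  by (auto simp: level_def dest: \<Delta>D)

lemma bi_invariant_level: "bi_invariant G \<Gamma> (level n)"
  unfolding bi_invariant_def
proof (intro conjI level_carrier ballI)
  fix \<gamma> a \<delta> assume "\<gamma> \<in> \<Gamma>" "a \<in> level n" "\<delta> \<in> \<Gamma>"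
  then have "\<gamma> \<otimes>\<^bsub>G\<^esub> a \<otimes>\<^bsub>G\<^esub> \<delta> \<in> level (1 * n * 1)"
    unfolding level_1[symmetric] by (intro level_mult)
  then show "\<gamma> \<otimes>\<^bsub>G\<^esub> a \<otimes>\<^bsub>G\<^esub> \<delta> \<in> level n" by simp
qed

lemma A_pow: "x [^]\<^bsub>A\<^esub> (k::nat) = [k] \<cdot>\<^bsub>V\<^esub> x"
  using monoid.nat_pow_consistent[OF add.is_monoid, of x k \<Lambda>] by (simp add: add_pow_def A_def)

lemma \<Lambda>_zero: "\<zero>\<^bsub>V\<^esub> \<in> \<Lambda>"
  using subgroup.one_closed[OF \<Lambda>_subgroup] by simp

lemma \<Lambda>_minus: "x \<in> \<Lambda> \<Longrightarrow> \<ominus>\<^bsub>V\<^esub> x \<in> \<Lambda>"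
  using subgroup.m_inv_closed[OF \<Lambda>_subgroup] by (simp add: a_inv_def)

lemma \<Lambda>_finsum:
  assumes "finite I" "\<And>i. i \<in> I \<Longrightarrow> g i \<in> \<Lambda>"
  shows "finsum V g I \<in> \<Lambda>"
  using assms by (induction I rule: finite_induct) (auto simp: \<Lambda>_zero \<Lambda>_add finsum_insert Pi_def)

lemma \<Lambda>_add_pow_int:
  fixes k :: int
  shows "x \<in> \<Lambda> \<Longrightarrow> [k] \<cdot>\<^bsub>V\<^esub> x \<in> \<Lambda>"
  using group.subgroup_int_pow_closed[OF a_group \<Lambda>_subgroup, of x k] by (simp add: add_pow_def)

lemma \<Lambda>_add_pow_nat:
  fixes k :: nat
  shows "x \<in> \<Lambda> \<Longrightarrow> [k] \<cdot>\<^bsub>V\<^esub> x \<in> \<Lambda>"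
  using A.nat_pow_closed[of x k] by (simp add: A_pow)

lemma level_add_pow:
  assumes "\<alpha> \<in> level n" "n > 0" "x \<in> \<Lambda>"
  shows "[n] \<cdot>\<^bsub>V\<^esub> x \<in> \<alpha> ` \<Lambda>"
  using A.pow_card_rcosets[of "\<alpha> ` \<Lambda>" x] image_subgroup[of \<alpha>] assms
  by (simp add: level_def ind_eq A_pow)

lemma Aut_add_pow:
  fixes n :: nat
  assumes "\<alpha> \<in> carrier G" "x \<in> carrier V"
  shows "\<alpha> ([n] \<cdot>\<^bsub>V\<^esub> x) = [n] \<cdot>\<^bsub>V\<^esub> \<alpha> x"
proof -
  have "\<alpha> \<in> alg_Aut K V" using assms(1) by (simp add: G_simps)
  note a = alg_AutD[OF this]
  have "\<alpha> \<in> hom (add_monoid V) (add_monoid V)" using a by (auto simp: hom_def)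
  then interpret group_hom "add_monoid V" "add_monoid V" \<alpha>
    by (simp add: group_hom_def group_hom_axioms_def a_group)
  show ?thesis using hom_nat_pow[of x n] assms(2) by (simp add: add_pow_def)
qed

text \<open>A coset is determined by the lattice \<open>\<alpha>(\<Lambda>)\<close>, and a lattice of index \<open>n\<close> contains \<open>n\<Lambda>\<close>, hence is a union of
  some of its finitely many cosets.\<close>

lemma finite_left_quotient_level:
  assumes n: "n > 0" and fin: "finite (rcosets\<^bsub>A\<^esub> ((\<lambda>x. [n] \<cdot>\<^bsub>V\<^esub> x) ` \<Lambda>))"
  shows "finite (left_quotient G \<Gamma> (level n))"
proof -
  let ?N = "(\<lambda>x. [n] \<cdot>\<^bsub>V\<^esub> x) ` \<Lambda>"
  have "(\<lambda>\<alpha>. \<alpha> ` \<Lambda>) ` level n \<subseteq> Union ` Pow (rcosets\<^bsub>A\<^esub> ?N)"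
  proof
    fix M assume "M \<in> (\<lambda>\<alpha>. \<alpha> ` \<Lambda>) ` level n"
    then obtain \<alpha> where \<alpha>: "\<alpha> \<in> level n" "M = \<alpha> ` \<Lambda>" by auto
    have NM: "?N \<subseteq> M" using level_add_pow[OF \<alpha>(1) n] \<alpha>(2) by auto
    interpret M: subgroup M A using image_subgroup[of \<alpha>] \<alpha> by (simp add: level_def)
    have "M = \<Union>{C \<in> rcosets\<^bsub>A\<^esub> ?N. C \<subseteq> M}"
    proof (intro equalityI subsetI)
      fix x assume x: "x \<in> M"
      then have xL: "x \<in> \<Lambda>" using M.subset by auto
      have "?N #>\<^bsub>A\<^esub> x \<subseteq> M" using NM x M.m_closed by (auto simp: r_coset_def)
      moreover have "x \<in> ?N #>\<^bsub>A\<^esub> x"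
      proof -
        have "\<zero>\<^bsub>V\<^esub> \<in> \<Lambda>" using A.one_closed by simp
        then have "\<zero>\<^bsub>V\<^esub> \<in> ?N" by (intro image_eqI[of _ _ "\<zero>\<^bsub>V\<^esub>"]) auto
        moreover have "x = \<zero>\<^bsub>V\<^esub> \<otimes>\<^bsub>A\<^esub> x" using xL by simp
        ultimately show ?thesis unfolding r_coset_def by blast
      qed
      ultimately show "x \<in> \<Union>{C \<in> rcosets\<^bsub>A\<^esub> ?N. C \<subseteq> M}" using xL by (auto simp: rcosets_eq_image)
    qed auto
    then show "M \<in> Union ` Pow (rcosets\<^bsub>A\<^esub> ?N)"
      by (rule image_eqI) auto
  qed
  then have fin': "finite ((\<lambda>\<alpha>. \<alpha> ` \<Lambda>) ` level n)"
    by (rule finite_subset) (use fin in simp)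
  have "left_quotient G \<Gamma> (level n) \<subseteq>
      (\<lambda>M. \<Gamma> #>\<^bsub>G\<^esub> (SOME \<alpha>. \<alpha> \<in> level n \<and> \<alpha> ` \<Lambda> = M)) ` (\<lambda>\<alpha>. \<alpha> ` \<Lambda>) ` level n"
  proof
    fix U assume "U \<in> left_quotient G \<Gamma> (level n)"
    then obtain \<alpha> where \<alpha>: "\<alpha> \<in> level n" "U = \<Gamma> #>\<^bsub>G\<^esub> \<alpha>" by (auto simp: left_quotient_def)
    define \<beta> where "\<beta> = (SOME \<beta>. \<beta> \<in> level n \<and> \<beta> ` \<Lambda> = \<alpha> ` \<Lambda>)"
    have \<beta>: "\<beta> \<in> level n \<and> \<beta> ` \<Lambda> = \<alpha> ` \<Lambda>"
      unfolding \<beta>_def by (rule someI[of _ \<alpha>]) (simp add: \<alpha>)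
    have "U = \<Gamma> #>\<^bsub>G\<^esub> \<beta>"
      unfolding \<alpha>(2) using \<beta> \<alpha>(1) level_carrier[of n] by (subst rcos_eq_iff_image_eq) auto
    then show "U \<in> (\<lambda>M. \<Gamma> #>\<^bsub>G\<^esub> (SOME \<alpha>. \<alpha> \<in> level n \<and> \<alpha> ` \<Lambda> = M)) ` (\<lambda>\<alpha>. \<alpha> ` \<Lambda>) ` level n"
      using \<alpha>(1) unfolding \<beta>_def by blast
  qed
  then show ?thesis by (rule finite_subset) (use fin' in simp)
qed

text \<open>With \<open>c = ab\<close> the lattice \<open>b(\<Lambda>)\<close> lies between \<open>c(\<Lambda>)\<close> and \<open>\<Lambda>\<close>, with indices \<open>m\<close> below and \<open>n\<close> above. So \<open>m\<close>
  maps it into \<open>c(\<Lambda>)\<close>. Conversely, if \<open>mx\<close> lies in \<open>c(\<Lambda>)\<close>, then both \<open>mx\<close> and \<open>nx\<close> lie in \<open>b(\<Lambda>)\<close>, and so does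
  \<open>x\<close> by Bezout. Thus \<open>c\<close> determines \<open>b(\<Lambda>)\<close>.\<close>

lemma coprime_factor_image:
  assumes mn: "m > 0" "n > 0" "coprime m n"
    and c: "c \<in> \<Delta>" and b: "b \<in> level n" and cb: "c \<otimes>\<^bsub>G\<^esub> inv\<^bsub>G\<^esub> b \<in> level m"
  shows "b ` \<Lambda> = {x \<in> \<Lambda>. [m] \<cdot>\<^bsub>V\<^esub> x \<in> c ` \<Lambda>}"
proof -
  define a where "a = c \<otimes>\<^bsub>G\<^esub> inv\<^bsub>G\<^esub> b"
  have bc: "b \<in> carrier G" "b \<in> \<Delta>" and cc: "c \<in> carrier G"
    using b c level_carrier by (auto simp: level_def dest: \<Delta>D)
  have "c = a \<otimes>\<^bsub>G\<^esub> b" using bc cc by (simp add: a_def G.m_assoc)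
  then have cimg: "c ` \<Lambda> = b ` a ` \<Lambda>" by (simp add: image_mult[OF \<Lambda>_subset])
  have a: "a \<in> level m" "a \<in> \<Delta>" using cb by (auto simp: a_def level_def)
  show ?thesis
  proof (intro equalityI subsetI)
    fix x assume "x \<in> b ` \<Lambda>"
    then obtain y where y: "y \<in> \<Lambda>" "x = b y" by auto
    then have "[m] \<cdot>\<^bsub>V\<^esub> x = b ([m] \<cdot>\<^bsub>V\<^esub> y)" using Aut_add_pow[OF bc(1)] by simp
    then show "x \<in> {x \<in> \<Lambda>. [m] \<cdot>\<^bsub>V\<^esub> x \<in> c ` \<Lambda>}"
      using level_add_pow[OF a(1) mn(1) y(1)] y \<Delta>D(2)[OF bc(2)] cimg by auto
  next
    fix x assume "x \<in> {x \<in> \<Lambda>. [m] \<cdot>\<^bsub>V\<^esub> x \<in> c ` \<Lambda>}"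
    then have x: "x \<in> \<Lambda>" "[m] \<cdot>\<^bsub>V\<^esub> x \<in> b ` \<Lambda>" using cimg \<Delta>D(2)[OF a(2)] by auto
    interpret M: subgroup "b ` \<Lambda>" A by (rule image_subgroup[OF bc(2)])
    have xn: "x [^]\<^bsub>A\<^esub> int n \<in> b ` \<Lambda>" and xm: "x [^]\<^bsub>A\<^esub> int m \<in> b ` \<Lambda>"
      using level_add_pow[OF b mn(2) x(1)] x(2) by (simp_all add: int_pow_int A_pow)
    obtain u v where uv: "u * int m + v * int n = 1"
      using mn(3) bezout_int[of "int m" "int n"] by (auto simp: coprime_iff_gcd_eq_1)
    have "x = x [^]\<^bsub>A\<^esub> (int m * u + int n * v)" using uv x(1) by (simp add: mult.commute)
    also have "\<dots> = (x [^]\<^bsub>A\<^esub> int m) [^]\<^bsub>A\<^esub> u \<otimes>\<^bsub>A\<^esub> (x [^]\<^bsub>A\<^esub> int n) [^]\<^bsub>A\<^esub> v"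
      using x(1) by (subst A.int_pow_mult) (auto simp: A.int_pow_pow)
    also have "\<dots> \<in> b ` \<Lambda>"
      by (intro M.m_closed A.subgroup_int_pow_closed[OF M.subgroup_axioms] xm xn)
    finally show "x \<in> b ` \<Lambda>" .
  qed
qed

text \<open>Uniqueness of the factorization \<open>c = ab\<close> is \<open>coprime_factor_image\<close>. Its existence is left as the hypothesis
  \<open>ex\<close>; the index of \<open>cb\<^sup>-\<^sup>1\<close> is then \<open>m\<close> by multiplicativity.\<close>

theorem hecke_sum_level_mult:
  assumes mn: "m > 0" "n > 0" "coprime m n"
    and fin: "\<And>k::nat. k > 0 \<Longrightarrow> finite (rcosets\<^bsub>A\<^esub> ((\<lambda>x. [k] \<cdot>\<^bsub>V\<^esub> x) ` \<Lambda>))"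
    and ex: "\<And>c. c \<in> level (m * n) \<Longrightarrow> \<exists>b\<in>level n. c \<otimes>\<^bsub>G\<^esub> inv\<^bsub>G\<^esub> b \<in> \<Delta>"
  shows "hecke_sum G \<Gamma> (level m) \<otimes>\<^bsub>hecke_ring G \<Gamma> \<Delta>\<^esub> hecke_sum G \<Gamma> (level n)
    = hecke_sum G \<Gamma> (level (m * n))"
proof (rule G.hecke_mult_hecke_sum)
  show "\<exists>b\<in>level n. c \<otimes>\<^bsub>G\<^esub> inv\<^bsub>G\<^esub> b \<in> level m" if c: "c \<in> level (m * n)" for c
  proof -
    obtain b where b: "b \<in> level n" "c \<otimes>\<^bsub>G\<^esub> inv\<^bsub>G\<^esub> b \<in> \<Delta>" using ex[OF c] by auto
    have cb: "c \<in> carrier G" "b \<in> carrier G" using b c level_carrier by auto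
    have "ind (c \<otimes>\<^bsub>G\<^esub> inv\<^bsub>G\<^esub> b \<otimes>\<^bsub>G\<^esub> b) = ind (c \<otimes>\<^bsub>G\<^esub> inv\<^bsub>G\<^esub> b) * n"
      using b by (subst ind_mult) (auto simp: level_def)
    moreover have "c \<otimes>\<^bsub>G\<^esub> inv\<^bsub>G\<^esub> b \<otimes>\<^bsub>G\<^esub> b = c" using cb by (simp add: G.m_assoc)
    ultimately have "ind (c \<otimes>\<^bsub>G\<^esub> inv\<^bsub>G\<^esub> b) = m" using c mn(2) by (simp add: level_def)
    then show ?thesis using b by (auto simp: level_def)
  qed
  show "\<Gamma> #>\<^bsub>G\<^esub> b = \<Gamma> #>\<^bsub>G\<^esub> b'"
    if "c \<in> level (m * n)" "b \<in> level n" "b' \<in> level n"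
      "c \<otimes>\<^bsub>G\<^esub> inv\<^bsub>G\<^esub> b \<in> level m" "c \<otimes>\<^bsub>G\<^esub> inv\<^bsub>G\<^esub> b' \<in> level m" for c b b'
  proof -
    have c: "c \<in> \<Delta>" using that(1) by (simp add: level_def)
    have "b ` \<Lambda> = b' ` \<Lambda>"
      using coprime_factor_image[OF mn c that(2,4)] coprime_factor_image[OF mn c that(3,5)] by simp
    then show ?thesis using that(2,3) subsetD[OF level_carrier[of n]]
      by (subst rcos_eq_iff_image_eq) simp_all
  qed
  show "level (m * n) \<subseteq> \<Delta>" by (auto simp: level_def)
  show "finite (left_quotient G \<Gamma> (level (m * n)))"
    using mn fin by (intro finite_left_quotient_level) simp_all
  show "finite (left_quotient G \<Gamma> (level m))" "finite (left_quotient G \<Gamma> (level n))"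
    using mn fin by (intro finite_left_quotient_level; simp)+
  show "a \<otimes>\<^bsub>G\<^esub> b \<in> level (m * n)" if "a \<in> level m" "b \<in> level n" for a b
    using that by (rule level_mult)
  show "bi_invariant G \<Gamma> \<Delta>" by (rule bi_invariant_\<Delta>)
  show "bi_invariant G \<Gamma> (level m)" by (rule bi_invariant_level)
  show "bi_invariant G \<Gamma> (level n)" by (rule bi_invariant_level)
  show "bi_invariant G \<Gamma> (level (m * n))" by (rule bi_invariant_level)
qed

end

section \<open>Coordinates on a tensor product\<close>

locale additive_map = A: abelian_group A + B: abelian_group B
  for A :: "('a, 'm) ring_scheme" and B :: "('b, 'n) ring_scheme" +
  fixes f :: "'a \<Rightarrow> 'b"
  assumes closed: "x \<in> carrier A \<Longrightarrow> f x \<in> carrier B"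
    and add: "x \<in> carrier A \<Longrightarrow> y \<in> carrier A \<Longrightarrow> f (x \<oplus>\<^bsub>A\<^esub> y) = f x \<oplus>\<^bsub>B\<^esub> f y"
begin

lemma group_hom: "group_hom (add_monoid A) (add_monoid B) f"
  using closed add by (auto simp: group_hom_def group_hom_axioms_def hom_def A.a_group B.a_group)

lemma zero: "f \<zero>\<^bsub>A\<^esub> = \<zero>\<^bsub>B\<^esub>"
  using group_hom.hom_one[OF group_hom] by simp

lemma minus: "x \<in> carrier A \<Longrightarrow> f (\<ominus>\<^bsub>A\<^esub> x) = \<ominus>\<^bsub>B\<^esub> f x"
  using group_hom.hom_inv[OF group_hom] by (simp add: a_inv_def)

lemma add_pow_int:
  fixes k :: int
  shows "x \<in> carrier A \<Longrightarrow> f ([k] \<cdot>\<^bsub>A\<^esub> x) = [k] \<cdot>\<^bsub>B\<^esub> f x"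
  using group_hom.hom_int_pow[OF group_hom, of x k] by (simp add: add_pow_def)

lemma finsum:
  assumes "finite I" "\<And>i. i \<in> I \<Longrightarrow> g i \<in> carrier A"
  shows "f (finsum A g I) = finsum B (\<lambda>i. f (g i)) I"
  using assms
proof (induction I rule: finite_induct)
  case (insert i I)
  then show ?case
    by (simp add: A.finsum_insert B.finsum_insert add closed Pi_def A.finsum_closed)
qed (simp add: zero)

lemma image_subgroup:
  assumes "subgroup H (add_monoid A)" shows "subgroup (f ` H) (add_monoid B)"
  using group_hom.subgroup_img_is_subgroup[OF group_hom assms] .

end

lemma cring_rat_ring: "cring rat_ring"
proof (rule cringI)
  show "abelian_group rat_ring"
  proof (rule abelian_groupI)
    fix x :: rat
    show "\<exists>y\<in>carrier rat_ring. y \<oplus>\<^bsub>rat_ring\<^esub> x = \<zero>\<^bsub>rat_ring\<^esub>" by (intro bexI[of _ "- x"]) auto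
  qed auto
  show "Group.comm_monoid rat_ring" by (rule comm_monoidI) auto
qed (auto simp: algebra_simps)

lemma add_pow_rat_ring:
  fixes k :: int
  shows "[k] \<cdot>\<^bsub>rat_ring\<^esub> q = of_int k * q"
proof -
  interpret R: cring rat_ring by (rule cring_rat_ring)
  have nat: "[n] \<cdot>\<^bsub>rat_ring\<^esub> q = of_nat n * q" for n :: nat
    by (induction n) (simp_all add: add_pow_def algebra_simps)
  have minus: "\<ominus>\<^bsub>rat_ring\<^esub> x = - x" for x by (rule R.minus_equality) auto
  show ?thesis
  proof (cases k)
    case (nonneg n)
    then show ?thesis using nat[of n] by (simp add: add_pow_def int_pow_int)
  next
    case (neg n)
    have "[k] \<cdot>\<^bsub>rat_ring\<^esub> q = \<ominus>\<^bsub>rat_ring\<^esub> ([int (Suc n)] \<cdot>\<^bsub>rat_ring\<^esub> q)"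
      unfolding neg using R.add.int_pow_neg[of q "int (Suc n)"] by simp
    also have "\<dots> = - (of_nat (Suc n) * q)"
      using nat[of "Suc n"] by (simp add: minus add_pow_def int_pow_int del: of_nat_Suc)
    also have "\<dots> = of_int k * q" by (simp add: neg algebra_simps)
    finally show ?thesis .
  qed
qed

text \<open>The axioms present the additive group of \<open>L\<close> as a direct summand of \<open>\<int>\<^sup>r\<close>, with a basis \<open>e\<close> and
  its coordinate functions \<open>c\<close> as the case of a free group of rank \<open>r\<close>.\<close>

locale based_algebra = nonassoc_algebra L for L :: "('a, 'm) ring_scheme" +
  fixes r :: nat and e :: "nat \<Rightarrow> 'a" and c :: "'a \<Rightarrow> nat \<Rightarrow> int"
  assumes e_closed: "i < r \<Longrightarrow> e i \<in> carrier L"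
    and c_add: "x \<in> carrier L \<Longrightarrow> y \<in> carrier L \<Longrightarrow> c (x \<oplus>\<^bsub>L\<^esub> y) i = c x i + c y i"
    and expansion: "x \<in> carrier L \<Longrightarrow> x = (\<Oplus>\<^bsub>L\<^esub>i\<in>{..<r}. [c x i] \<cdot>\<^bsub>L\<^esub> e i)"

lemma based_algebra_of_iso:
  fixes L :: "('a, 'm) ring_scheme"
  assumes L: "nonassoc_algebra L" and iso: "add_monoid L \<cong> free_Abelian_group {..<r}"
  shows "\<exists>e c. based_algebra L r e c"
proof -
  interpret L: nonassoc_algebra L by (rule L)
  let ?F = "free_Abelian_group {..<r}"
  obtain \<psi> where \<psi>: "\<psi> \<in> iso (add_monoid L) ?F" using iso by (auto simp: is_iso_def)
  have bij: "bij_betw \<psi> (carrier L) (carrier ?F)" using \<psi> by (simp add: iso_def)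
  interpret group_hom "add_monoid L" ?F \<psi>
    using \<psi> by (auto simp: group_hom_def group_hom_axioms_def iso_def L.a_group)
  define e where "e = (\<lambda>i. inv_into (carrier L) \<psi> (frag_of i))"
  define c where "c = (\<lambda>x i. Poly_Mapping.lookup (\<psi> x) i)"
  have e: "e i \<in> carrier L" "\<psi> (e i) = frag_of i" if "i < r" for i
  proof -
    have "frag_of i \<in> \<psi> ` carrier L" using that bij by (simp add: bij_betw_def)
    then show "e i \<in> carrier L" "\<psi> (e i) = frag_of i" by (auto simp: e_def inv_into_into f_inv_into_f)
  qed
  have \<psi>c: "Poly_Mapping.keys (\<psi> x) \<subseteq> {..<r}" if "x \<in> carrier L" for x
    using hom_closed[of x] that by simp
  have "based_algebra L r e c"
  proof (intro based_algebra.intro L based_algebra_axioms.intro)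
    fix x y i assume "x \<in> carrier L" "y \<in> carrier L"
    then show "c (x \<oplus>\<^bsub>L\<^esub> y) i = c x i + c y i" using hom_mult[of x y] by (simp add: c_def lookup_add)
  next
    fix x assume x: "x \<in> carrier L"
    have fin: "\<psi> (\<Oplus>\<^bsub>L\<^esub>i\<in>I. [c x i] \<cdot>\<^bsub>L\<^esub> e i) = (\<Sum>i\<in>I. frag_cmul (c x i) (frag_of i))"
      if "finite I" "I \<subseteq> {..<r}" for I
      using that
    proof (induction I rule: finite_induct)
      case empty show ?case using hom_one by simp
    next
      case (insert i I)
      have pow: "\<psi> ([c x i] \<cdot>\<^bsub>L\<^esub> e i) = frag_cmul (c x i) (frag_of i)"
        using hom_int_pow[of "e i" "c x i"] e[of i] insert(4) by (simp add: add_pow_def)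
      have cl: "(\<lambda>i. [c x i] \<cdot>\<^bsub>L\<^esub> e i) \<in> I \<rightarrow> carrier L" "[c x i] \<cdot>\<^bsub>L\<^esub> e i \<in> carrier L"
        using e(1) insert(4) by (auto intro!: L.add.int_pow_closed)
      show ?case
        using hom_mult[of "[c x i] \<cdot>\<^bsub>L\<^esub> e i" "\<Oplus>\<^bsub>L\<^esub>i\<in>I. [c x i] \<cdot>\<^bsub>L\<^esub> e i"] insert cl pow
        by (simp add: L.finsum_insert L.finsum_closed)
    qed
    have "\<psi> (\<Oplus>\<^bsub>L\<^esub>i\<in>{..<r}. [c x i] \<cdot>\<^bsub>L\<^esub> e i) = (\<Sum>i<r. frag_cmul (c x i) (frag_of i))"
      by (rule fin) auto
    also have "\<dots> = \<psi> x"
    proof (rule poly_mapping_eqI)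
      fix j
      have "Poly_Mapping.lookup (\<psi> x) j = 0" if "j \<notin> {..<r}"
        using \<psi>c[OF x] that by (meson in_keys_iff subsetD)
      then show "Poly_Mapping.lookup (\<Sum>i<r. frag_cmul (c x i) (frag_of i)) j = Poly_Mapping.lookup (\<psi> x) j"
        by (auto simp: lookup_sum c_def if_distrib cong: if_cong)
    qed
    finally show "x = (\<Oplus>\<^bsub>L\<^esub>i\<in>{..<r}. [c x i] \<cdot>\<^bsub>L\<^esub> e i)"
      using bij x e(1) by (auto simp: bij_betw_def dest!: inj_onD intro!: L.finsum_closed L.add.int_pow_closed)
  qed (use e in auto)
  then show ?thesis by blast
qed

locale based_tensor = based_algebra L r e c + tensor_product L R
  for L :: "('a, 'm) ring_scheme" and r e c and R :: "('r, 'n) ring_scheme"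
begin

lemma pt_additive_left: "a \<in> carrier R \<Longrightarrow> additive_map L V (\<lambda>x. pt x a)"
  by (intro additive_map.intro additive_map_axioms.intro)
    (auto simp: pt_add_left abelian_group_axioms abelian_group_tensor)

lemma pt_additive_right: "x \<in> carrier L \<Longrightarrow> additive_map R V (\<lambda>a. pt x a)"
  by (intro additive_map.intro additive_map_axioms.intro)
    (auto simp: pt_add_right abelian_group_tensor R.is_abelian_group)

lemma pt_add_pow_int:
  fixes k :: int
  assumes "x \<in> carrier L" "a \<in> carrier R"
  shows "pt ([k] \<cdot>\<^bsub>L\<^esub> x) a = pt x ([k] \<cdot>\<^bsub>R\<^esub> a)"
  using additive_map.add_pow_int[OF pt_additive_left[OF assms(2)] assms(1)]
    additive_map.add_pow_int[OF pt_additive_right[OF assms(1)] assms(2)] by simp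

text \<open>The coordinate functions for the generators \<open>e i \<otimes> 1\<close>; the universal property provides them from
  the biadditive map \<open>(x, a) \<mapsto> c x i a\<close>.\<close>

definition coord :: "nat \<Rightarrow> ('a \<times> 'r \<Rightarrow>\<^sub>0 int) set \<Rightarrow> 'r" where
  "coord i = (SOME g. additive_map V R g \<and>
     (\<forall>x\<in>carrier L. \<forall>a\<in>carrier R. g (pt x a) = [c x i] \<cdot>\<^bsub>R\<^esub> a))"

lemma coord:
  shows coord_additive: "additive_map V R (coord i)"
    and coord_pt: "x \<in> carrier L \<Longrightarrow> a \<in> carrier R \<Longrightarrow> coord i (pt x a) = [c x i] \<cdot>\<^bsub>R\<^esub> a"
proof -
  obtain g where g: "\<And>X. X \<in> carrier V \<Longrightarrow> g X \<in> carrier R"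
    "\<And>X Y. X \<in> carrier V \<Longrightarrow> Y \<in> carrier V \<Longrightarrow> g (X \<oplus>\<^bsub>V\<^esub> Y) = g X \<oplus>\<^bsub>R\<^esub> g Y"
    "\<And>x a. x \<in> carrier L \<Longrightarrow> a \<in> carrier R \<Longrightarrow> g (pt x a) = [c x i] \<cdot>\<^bsub>R\<^esub> a"
  proof (rule tensor_universal[where W = R and b = "\<lambda>x a. [c x i] \<cdot>\<^bsub>R\<^esub> a"])
    show "abelian_group R" by (rule R.is_abelian_group)
  qed (auto simp: c_add R.add.int_pow_mult R.add.int_pow_distrib)
  have "additive_map V R g \<and> (\<forall>x\<in>carrier L. \<forall>a\<in>carrier R. g (pt x a) = [c x i] \<cdot>\<^bsub>R\<^esub> a)"
    using g by (auto intro!: additive_map.intro additive_map_axioms.intro abelian_group_tensor R.is_abelian_group)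
  then have "additive_map V R (coord i) \<and> (\<forall>x\<in>carrier L. \<forall>a\<in>carrier R. coord i (pt x a) = [c x i] \<cdot>\<^bsub>R\<^esub> a)"
    unfolding coord_def
    by (rule someI[of "\<lambda>g. additive_map V R g \<and>
      (\<forall>x\<in>carrier L. \<forall>a\<in>carrier R. g (pt x a) = [c x i] \<cdot>\<^bsub>R\<^esub> a)"])
  then show "additive_map V R (coord i)"
    "x \<in> carrier L \<Longrightarrow> a \<in> carrier R \<Longrightarrow> coord i (pt x a) = [c x i] \<cdot>\<^bsub>R\<^esub> a" by auto
qed

lemma coord_closed [simp]: "X \<in> carrier V \<Longrightarrow> coord i X \<in> carrier R"
  using additive_map.closed[OF coord_additive] .

lemma coord_add: "X \<in> carrier V \<Longrightarrow> Y \<in> carrier V \<Longrightarrow> coord i (X \<oplus>\<^bsub>V\<^esub> Y) = coord i X \<oplus>\<^bsub>R\<^esub> coord i Y"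
  using additive_map.add[OF coord_additive] .

lemma coord_smult:
  assumes "a \<in> carrier R" "X \<in> carrier V"
  shows "coord i (a \<odot>\<^bsub>V\<^esub> X) = a \<otimes>\<^bsub>R\<^esub> coord i X"
  using assms(2)
proof (induction X rule: tensor_induct)
  case (pure x b)
  have "additive_map R R (\<lambda>b. a \<otimes>\<^bsub>R\<^esub> b)"
    using assms(1) by (intro additive_map.intro additive_map_axioms.intro R.is_abelian_group) (auto simp: R.r_distr)
  from additive_map.add_pow_int[OF this pure(2)] show ?case
    using pure assms(1) by (simp add: smult_pt coord_pt)
qed (use assms(1) in \<open>simp_all add: module.smult_r_distr[OF module_tensor] coord_add R.r_distr\<close>)

lemma tensor_expansion:
  assumes "X \<in> carrier V"
  shows "X = (\<Oplus>\<^bsub>V\<^esub>i\<in>{..<r}. pt (e i) (coord i X))"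
  using assms
proof (induction X rule: tensor_induct)
  case (pure x a)
  have cl: "[c x i] \<cdot>\<^bsub>L\<^esub> e i \<in> carrier L" if "i < r" for i
    using e_closed[OF that] by (rule add.int_pow_closed)
  have "pt x a = pt (\<Oplus>\<^bsub>L\<^esub>i\<in>{..<r}. [c x i] \<cdot>\<^bsub>L\<^esub> e i) a"
    using expansion[OF pure(1)] by simp
  also have "\<dots> = (\<Oplus>\<^bsub>V\<^esub>i\<in>{..<r}. pt ([c x i] \<cdot>\<^bsub>L\<^esub> e i) a)"
    by (rule additive_map.finsum[OF pt_additive_left[OF pure(2)]]) (use cl in auto)
  also have "\<dots> = (\<Oplus>\<^bsub>V\<^esub>i\<in>{..<r}. pt (e i) (coord i (pt x a)))"
    by (rule V.finsum_cong') (use pure e_closed in \<open>auto simp: coord_pt pt_add_pow_int\<close>)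
  finally show ?case .
next
  case (add X Y)
  have "(\<Oplus>\<^bsub>V\<^esub>i\<in>{..<r}. pt (e i) (coord i (X \<oplus>\<^bsub>V\<^esub> Y)))
      = (\<Oplus>\<^bsub>V\<^esub>i\<in>{..<r}. pt (e i) (coord i X) \<oplus>\<^bsub>V\<^esub> pt (e i) (coord i Y))"
    by (rule V.finsum_cong') (use add e_closed in \<open>auto simp: coord_add pt_add_right\<close>)
  also have "\<dots> = (\<Oplus>\<^bsub>V\<^esub>i\<in>{..<r}. pt (e i) (coord i X)) \<oplus>\<^bsub>V\<^esub> (\<Oplus>\<^bsub>V\<^esub>i\<in>{..<r}. pt (e i) (coord i Y))"
    by (rule V.finsum_addf) (use add e_closed in auto)
  finally show ?case using add(3,4) by simp
qed

lemma coord_inject: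
  assumes "X \<in> carrier V" "Y \<in> carrier V" "\<And>i. i < r \<Longrightarrow> coord i X = coord i Y"
  shows "X = Y"
proof -
  have "(\<Oplus>\<^bsub>V\<^esub>i\<in>{..<r}. pt (e i) (coord i X)) = (\<Oplus>\<^bsub>V\<^esub>i\<in>{..<r}. pt (e i) (coord i Y))"
    by (rule V.finsum_cong') (use assms e_closed in auto)
  then show ?thesis using tensor_expansion[OF assms(1)] tensor_expansion[OF assms(2)] by simp
qed

sublocale V: scalar_algebra R V
  by (intro scalar_algebra.intro module_tensor nonassoc_algebra_tensor)

end

locale based_base_change = based_algebra L r e c + tensor_base_change L R S h
  for L :: "('a, 'm) ring_scheme" and r e c
    and R :: "('r, 'n) ring_scheme" and S :: "('s, 'k) ring_scheme" and h
begin

sublocale R: based_tensor L r e c R ..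
sublocale S: based_tensor L r e c S ..

lemma h_additive: "additive_map R S h"
  using ring_hom_closed[OF h] ring_hom_add[OF h]
  by (intro additive_map.intro additive_map_axioms.intro R.R.is_abelian_group S.R.is_abelian_group) auto

lemma tensor_map_additive: "additive_map R.V S.V tm"
  by (intro additive_map.intro additive_map_axioms.intro R.abelian_group_tensor S.abelian_group_tensor
      tensor_map_closed tensor_map_add)

text \<open>Extension of scalars acts on each coordinate.\<close>

lemma coord_tensor_map:
  assumes "X \<in> carrier R.V"
  shows "S.coord i (tm X) = h (R.coord i X)"
  using assms
proof (induction X rule: R.tensor_induct)
  case (pure x a)
  then show ?case
    using additive_map.add_pow_int[OF h_additive, of a "c x i"] ring_hom_closed[OF h]
    by (simp add: tensor_map_pt S.coord_pt R.coord_pt)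
next
  case (add X Y)
  then show ?case
    by (simp add: tensor_map_add S.coord_add R.coord_add tensor_map_closed additive_map.add[OF h_additive])
qed

lemma tensor_map_inj:
  assumes "inj_on h (carrier R)"
  shows "inj_on tm (carrier R.V)"
proof (rule inj_onI)
  fix X Y assume XY: "X \<in> carrier R.V" "Y \<in> carrier R.V" "tm X = tm Y"
  show "X = Y"
  proof (rule R.coord_inject[OF XY(1,2)])
    fix i assume "i < r"
    have "h (R.coord i X) = h (R.coord i Y)"
      using XY coord_tensor_map[OF XY(1), of i] coord_tensor_map[OF XY(2), of i] by simp
    then show "R.coord i X = R.coord i Y" using assms XY by (auto dest: inj_onD)
  qed
qed

end

section \<open>The global and the local lattices\<close>

context based_algebra
begin

sublocale Q: based_tensor L r e c rat_ring
  by (intro based_tensor.intro based_algebra_axioms tensor_product.intro nonassoc_algebra_axioms cring_rat_ring)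

abbreviation "VQ \<equiv> tensor L rat_ring"

definition "\<Lambda>g = global_emb L ` carrier L"

lemma global_emb_additive: "additive_map L VQ (global_emb L)"
  using Q.pt_additive_left[of 1] by (simp add: global_emb_def[abs_def])

lemma coord_global_emb: "x \<in> carrier L \<Longrightarrow> Q.coord i (global_emb L x) = of_int (c x i)"
  by (simp add: global_emb_def Q.coord_pt add_pow_rat_ring)

lemma global_emb_closed: "x \<in> carrier L \<Longrightarrow> global_emb L x \<in> carrier VQ"
  by (simp add: global_emb_def)

lemma inj_global_emb: "inj_on (global_emb L) (carrier L)"
proof (rule inj_onI)
  fix x y assume xy: "x \<in> carrier L" "y \<in> carrier L" "global_emb L x = global_emb L y"
  have "c x i = c y i" for i
    using coord_global_emb[OF xy(1), of i] coord_global_emb[OF xy(2), of i] xy(3) by simp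
  then show "x = y" using expansion[OF xy(1)] expansion[OF xy(2)] by simp
qed

lemma pt_rat: "x \<in> carrier L \<Longrightarrow> Q.pt x q = q \<odot>\<^bsub>VQ\<^esub> global_emb L x"
  by (simp add: global_emb_def Q.smult_pt)

text \<open>If the coordinates \<open>n i\<close> are integers, they can be moved across the tensor sign, which makes \<open>X\<close> the image of
  \<open>\<Sum>i. n i e i\<close>.\<close>

lemma mem_lattice_iff_coord:
  assumes X: "X \<in> carrier VQ"
  shows "X \<in> \<Lambda>g \<longleftrightarrow> (\<forall>i<r. Q.coord i X \<in> \<int>)"
proof
  assume "X \<in> \<Lambda>g"
  then show "\<forall>i<r. Q.coord i X \<in> \<int>" by (auto simp: \<Lambda>g_def coord_global_emb)
next
  assume int: "\<forall>i<r. Q.coord i X \<in> \<int>"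
  define n where "n = (\<lambda>i. \<lfloor>Q.coord i X\<rfloor>)"
  have n: "Q.coord i X = of_int (n i)" if "i < r" for i using int that by (auto simp: n_def elim!: Ints_cases)
  have cl: "[n i] \<cdot>\<^bsub>L\<^esub> e i \<in> carrier L" if "i < r" for i
    using e_closed[OF that] by (rule add.int_pow_closed)
  have "X = (\<Oplus>\<^bsub>VQ\<^esub>i\<in>{..<r}. Q.pt (e i) (Q.coord i X))" by (rule Q.tensor_expansion[OF X])
  also have "\<dots> = (\<Oplus>\<^bsub>VQ\<^esub>i\<in>{..<r}. global_emb L ([n i] \<cdot>\<^bsub>L\<^esub> e i))"
    by (rule Q.V.finsum_cong')
      (use cl e_closed in \<open>auto simp: global_emb_def Q.pt_add_pow_int add_pow_rat_ring n\<close>)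
  also have "\<dots> = global_emb L (\<Oplus>\<^bsub>L\<^esub>i\<in>{..<r}. [n i] \<cdot>\<^bsub>L\<^esub> e i)"
    by (rule additive_map.finsum[OF global_emb_additive, symmetric]) (use cl in auto)
  finally show "X \<in> \<Lambda>g"
    unfolding \<Lambda>g_def using cl by (auto intro!: image_eqI finsum_closed)
qed

sublocale glob: algebra_lattice rat_ring VQ \<Lambda>g
proof (intro algebra_lattice.intro algebra_lattice_axioms.intro Q.V.scalar_algebra_axioms)
  show "subgroup \<Lambda>g (add_monoid VQ)"
    using additive_map.image_subgroup[OF global_emb_additive add.subgroup_self] by (simp add: \<Lambda>g_def)
qed

lemma global_emb_mult:
  "x \<in> carrier L \<Longrightarrow> y \<in> carrier L \<Longrightarrow> global_emb L (x \<otimes>\<^bsub>L\<^esub> y) = global_emb L x \<otimes>\<^bsub>VQ\<^esub> global_emb L y"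
  by (simp add: global_emb_def Q.mult_pt)

lemma global_emb_add_pow:
  fixes k :: int
  shows "x \<in> carrier L \<Longrightarrow> global_emb L ([k] \<cdot>\<^bsub>L\<^esub> x) = of_int k \<odot>\<^bsub>VQ\<^esub> global_emb L x"
  by (simp add: global_emb_def Q.smult_pt Q.pt_add_pow_int add_pow_rat_ring)

lemma int_algebra_simps:
  "carrier (int_algebra L) = carrier L" "x \<oplus>\<^bsub>int_algebra L\<^esub> y = x \<oplus>\<^bsub>L\<^esub> y"
  "x \<otimes>\<^bsub>int_algebra L\<^esub> y = x \<otimes>\<^bsub>L\<^esub> y" "k \<odot>\<^bsub>int_algebra L\<^esub> x = [k] \<cdot>\<^bsub>L\<^esub> x"
  by (simp_all add: int_algebra_def)

lemma global_lattice_iff: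
  "\<alpha> \<in> \<Delta>_glob L \<longleftrightarrow> \<alpha> \<in> glob.\<Delta>" "\<alpha> \<in> \<Gamma>_glob L \<longleftrightarrow> \<alpha> \<in> glob.\<Gamma>"
proof -
  note * = lattice_End_iff[of "int_algebra L" "global_emb L" VQ \<Z> of_int rat_ring \<alpha>]
  note [simp] = inj_global_emb global_emb_closed prod_closed int_algebra_simps
    additive_map.add[OF global_emb_additive] global_emb_mult global_emb_add_pow add.int_pow_closed
  show "\<alpha> \<in> \<Delta>_glob L \<longleftrightarrow> \<alpha> \<in> glob.\<Delta>"
    unfolding \<Delta>_glob_def by (subst *(1)) (simp_all add: glob.\<Delta>_def \<Lambda>g_def[symmetric])
  show "\<alpha> \<in> \<Gamma>_glob L \<longleftrightarrow> \<alpha> \<in> glob.\<Gamma>"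
    unfolding \<Gamma>_glob_def by (subst *(2)) (simp_all add: glob.\<Gamma>_def \<Lambda>g_def[symmetric])
qed

lemma global_eqs: "G_glob L = glob.G" "\<Delta>_glob L = glob.\<Delta>" "\<Gamma>_glob L = glob.\<Gamma>"
  "index_glob L = glob.ind"
proof -
  show "index_glob L = glob.ind"
    by (rule ext) (simp add: index_glob_def glob.ind_def \<Lambda>g_def[symmetric])
qed (use global_lattice_iff in \<open>auto simp: G_glob_def glob.G_def\<close>)

end

locale based_algebra_prime = based_algebra L r e c for L :: "('a, 'm) ring_scheme" and r e c +
  fixes p :: nat
  assumes p: "prime p"
begin

abbreviation "Vp \<equiv> tensor L (Qp p)"

sublocale P: based_tensor L r e c "Qp p"
  by (intro based_tensor.intro based_algebra_axioms tensor_product.intro nonassoc_algebra_axioms cring_Qp p)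

sublocale Z: based_tensor L r e c "Zp p"
  by (intro based_tensor.intro based_algebra_axioms tensor_product.intro nonassoc_algebra_axioms cring_Zp p)

sublocale I: based_base_change L r e c rat_ring "Qp p" "rat_to_Qp p"
  by (intro based_base_change.intro tensor_base_change.intro tensor_base_change_axioms.intro
      based_algebra_axioms Q.tensor_product_axioms P.tensor_product_axioms rat_to_Qp_ring_hom p)

sublocale E: based_base_change L r e c "Zp p" "Qp p" "\<lambda>z. z"
  using Zp_subset[OF p] Zp_simps[OF p]
  by (intro based_base_change.intro tensor_base_change.intro tensor_base_change_axioms.intro
      based_algebra_axioms Z.tensor_product_axioms P.tensor_product_axioms ring_hom_memI)
    (simp_all add: subset_iff)

definition "\<iota> = tensor_map L (Qp p) (rat_to_Qp p)"
definition "\<Lambda>p = local_emb L p ` carrier (tensor L (Zp p))"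

lemma iota_additive: "additive_map VQ Vp \<iota>"
  unfolding \<iota>_def by (rule I.tensor_map_additive)

lemma iota_closed [simp]: "X \<in> carrier VQ \<Longrightarrow> \<iota> X \<in> carrier Vp"
  unfolding \<iota>_def by (rule I.tensor_map_closed)

lemma iota_mult: "X \<in> carrier VQ \<Longrightarrow> Y \<in> carrier VQ \<Longrightarrow> \<iota> (X \<otimes>\<^bsub>VQ\<^esub> Y) = \<iota> X \<otimes>\<^bsub>Vp\<^esub> \<iota> Y"
  unfolding \<iota>_def by (rule I.tensor_map_mult)

lemma iota_smult: "X \<in> carrier VQ \<Longrightarrow> \<iota> (q \<odot>\<^bsub>VQ\<^esub> X) = rat_to_Qp p q \<odot>\<^bsub>Vp\<^esub> \<iota> X"
  unfolding \<iota>_def by (rule I.tensor_map_smult) auto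

lemma iota_global_emb: "x \<in> carrier L \<Longrightarrow> \<iota> (global_emb L x) = P.pt x \<one>\<^bsub>Qp p\<^esub>"
  by (simp add: \<iota>_def global_emb_def I.tensor_map_pt rat_to_Qp_one[OF p])

lemma pt_Qp: "x \<in> carrier L \<Longrightarrow> a \<in> carrier (Qp p) \<Longrightarrow> P.pt x a = a \<odot>\<^bsub>Vp\<^esub> \<iota> (global_emb L x)"
  by (simp add: iota_global_emb P.smult_pt)

lemma local_emb_additive: "additive_map (tensor L (Zp p)) Vp (local_emb L p)"
  unfolding local_emb_def by (rule E.tensor_map_additive)

lemma inj_local_emb: "inj_on (local_emb L p) (carrier (tensor L (Zp p)))"
  unfolding local_emb_def by (rule E.tensor_map_inj) auto

sublocale loc: algebra_lattice "Qp p" Vp \<Lambda>p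
proof (intro algebra_lattice.intro algebra_lattice_axioms.intro P.V.scalar_algebra_axioms)
  show "subgroup \<Lambda>p (add_monoid Vp)"
    using additive_map.image_subgroup[OF local_emb_additive Z.V.add.subgroup_self] by (simp add: \<Lambda>p_def)
qed

lemma local_lattice_iff:
  "\<alpha> \<in> \<Delta>_loc L p \<longleftrightarrow> \<alpha> \<in> loc.\<Delta>" "\<alpha> \<in> \<Gamma>_loc L p \<longleftrightarrow> \<alpha> \<in> loc.\<Gamma>"
proof -
  note * = lattice_End_iff[of "tensor L (Zp p)" "local_emb L p" Vp "Zp p" "\<lambda>z. z" "Qp p" \<alpha>]
  note [simp] = inj_local_emb subsetD[OF Zp_subset[OF p]] Z.V.prod_closed
    E.tensor_map_closed[folded local_emb_def] E.tensor_map_add[folded local_emb_def]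
    E.tensor_map_mult[folded local_emb_def] E.tensor_map_smult[folded local_emb_def]
  show "\<alpha> \<in> \<Delta>_loc L p \<longleftrightarrow> \<alpha> \<in> loc.\<Delta>"
    unfolding \<Delta>_loc_def by (subst *(1)) (simp_all add: loc.\<Delta>_def \<Lambda>p_def[symmetric])
  show "\<alpha> \<in> \<Gamma>_loc L p \<longleftrightarrow> \<alpha> \<in> loc.\<Gamma>"
    unfolding \<Gamma>_loc_def by (subst *(2)) (simp_all add: loc.\<Gamma>_def \<Lambda>p_def[symmetric])
qed

lemma local_eqs: "G_loc L p = loc.G" "\<Delta>_loc L p = loc.\<Delta>" "\<Gamma>_loc L p = loc.\<Gamma>"
  "index_loc L p = loc.ind"
proof -
  show "index_loc L p = loc.ind"
    by (rule ext) (simp add: index_loc_def loc.ind_def \<Lambda>p_def[symmetric])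
qed (use local_lattice_iff in \<open>auto simp: G_loc_def loc.G_def\<close>)

lemma local_lattice_smult:
  assumes "a \<in> carrier (Zp p)" "X \<in> \<Lambda>p"
  shows "a \<odot>\<^bsub>Vp\<^esub> X \<in> \<Lambda>p"
proof -
  obtain Y where Y: "Y \<in> carrier (tensor L (Zp p))" "X = local_emb L p Y" using assms(2) by (auto simp: \<Lambda>p_def)
  then have "a \<odot>\<^bsub>Vp\<^esub> X = local_emb L p (a \<odot>\<^bsub>tensor L (Zp p)\<^esub> Y)"
    using E.tensor_map_smult[OF assms(1) Y(1)] by (simp add: local_emb_def)
  then show ?thesis using Y assms(1) by (auto simp: \<Lambda>p_def)
qed

text \<open>\<open>L\<^sub>p\<close> is the \<open>\<int>\<^sub>p\<close>-span of \<open>L\<close>.\<close>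

lemma local_lattice_induct [consumes 1, case_names pure add]:
  assumes "X \<in> \<Lambda>p"
    and pure: "\<And>a x. a \<in> carrier (Zp p) \<Longrightarrow> x \<in> carrier L \<Longrightarrow> P (a \<odot>\<^bsub>Vp\<^esub> \<iota> (global_emb L x))"
    and add: "\<And>X Y. X \<in> \<Lambda>p \<Longrightarrow> Y \<in> \<Lambda>p \<Longrightarrow> P X \<Longrightarrow> P Y \<Longrightarrow> P (X \<oplus>\<^bsub>Vp\<^esub> Y)"
  shows "P X"
proof -
  obtain Y where Y: "Y \<in> carrier (tensor L (Zp p))" "X = local_emb L p Y" using assms(1) by (auto simp: \<Lambda>p_def)
  have "P (local_emb L p Y)"
    using Y(1)
  proof (induction Y rule: Z.tensor_induct)
    case (pure x a)
    then have "local_emb L p (Z.pt x a) = a \<odot>\<^bsub>Vp\<^esub> \<iota> (global_emb L x)"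
      using pt_Qp[of x a] Zp_subset[OF p] by (auto simp: local_emb_def E.tensor_map_pt)
    then show ?case using assms(2) pure by simp
  next
    case (add X Y)
    then show ?case
      using assms(3)[of "local_emb L p X" "local_emb L p Y"] additive_map.add[OF local_emb_additive add(1,2)]
      by (auto simp: \<Lambda>p_def)
  qed
  then show ?thesis using Y by simp
qed

lemma iota_lattice:
  assumes "X \<in> \<Lambda>g" shows "\<iota> X \<in> \<Lambda>p"
proof -
  obtain x where x: "x \<in> carrier L" "X = global_emb L x" using assms by (auto simp: \<Lambda>g_def)
  have "\<iota> X = local_emb L p (Z.pt x \<one>\<^bsub>Zp p\<^esub>)"
    using x by (simp add: iota_global_emb local_emb_def E.tensor_map_pt Zp_simps[OF p])
  then show ?thesis using Z.pt_closed[OF x(1) Z.R.one_closed] unfolding \<Lambda>p_def by (rule image_eqI)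
qed

text \<open>The coordinates of an element of \<open>L\<^sub>p\<close> are \<open>p\<close>-adic integers, and \<open>\<iota>\<close> preserves coordinates.\<close>

lemma padic_abs_coord_le_1:
  assumes "X \<in> carrier VQ" "\<iota> X \<in> \<Lambda>p"
  shows "padic_abs p (Q.coord i X) \<le> 1"
proof -
  obtain Y where Y: "Y \<in> carrier (tensor L (Zp p))" "\<iota> X = local_emb L p Y" using assms(2) by (auto simp: \<Lambda>p_def)
  have "rat_to_Qp p (Q.coord i X) = P.coord i (\<iota> X)"
    using I.coord_tensor_map[OF assms(1)] by (simp add: \<iota>_def)
  also have "\<dots> = Z.coord i Y" using E.coord_tensor_map[OF Y(1)] Y(2) by (simp add: local_emb_def)
  finally show ?thesis using rat_to_Qp_mem_Zp_iff[OF p, of "Q.coord i X"] Z.coord_closed[OF Y(1), of i] by simp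
qed

text \<open>The integers being dense in the \<open>p\<close>-adic integers, \<open>L\<close> is dense in \<open>L \<otimes> \<int>\<^sub>p\<close>.\<close>

lemma local_lattice_approx:
  assumes "X \<in> \<Lambda>p"
  shows "\<exists>x\<in>\<Lambda>g. \<exists>Y\<in>\<Lambda>p. X = \<iota> x \<oplus>\<^bsub>Vp\<^esub> rat_to_Qp p (of_nat p ^ k) \<odot>\<^bsub>Vp\<^esub> Y"
  using assms
proof (induction X rule: local_lattice_induct)
  case (pure a x)
  let ?u = "global_emb L x"
  have u: "?u \<in> \<Lambda>g" "?u \<in> carrier VQ" using pure by (auto simp: \<Lambda>g_def global_emb_closed)
  obtain n b where nb: "b \<in> carrier (Zp p)"
    "a = rat_to_Qp p (of_int n) \<oplus>\<^bsub>Qp p\<^esub> rat_to_Qp p (of_nat p ^ k) \<otimes>\<^bsub>Qp p\<^esub> b"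
    using Zp_approx[OF p pure(1), of k] by blast
  have b: "b \<in> carrier (Qp p)" using nb(1) Zp_subset[OF p] by auto
  have "a \<odot>\<^bsub>Vp\<^esub> \<iota> ?u = \<iota> (of_int n \<odot>\<^bsub>VQ\<^esub> ?u) \<oplus>\<^bsub>Vp\<^esub> rat_to_Qp p (of_nat p ^ k) \<odot>\<^bsub>Vp\<^esub> (b \<odot>\<^bsub>Vp\<^esub> \<iota> ?u)"
    unfolding nb(2) using u b rat_to_Qp_closed[OF p]
    by (simp add: P.V.smult_l_distr P.V.smult_assoc1 iota_smult)
  moreover have "of_int n \<odot>\<^bsub>VQ\<^esub> ?u \<in> \<Lambda>g"
  proof -
    have "of_int n \<odot>\<^bsub>VQ\<^esub> ?u = global_emb L ([n] \<cdot>\<^bsub>L\<^esub> x)"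
      using pure(2) by (simp add: global_emb_def Q.smult_pt Q.pt_add_pow_int add_pow_rat_ring)
    then show ?thesis using add.int_pow_closed[OF pure(2)] by (auto simp: \<Lambda>g_def)
  qed
  moreover have "b \<odot>\<^bsub>Vp\<^esub> \<iota> ?u \<in> \<Lambda>p" using local_lattice_smult[OF nb(1) iota_lattice[OF u(1)]] .
  ultimately show ?case by blast
next
  case (add X X')
  obtain x Y where 1: "x \<in> \<Lambda>g" "Y \<in> \<Lambda>p" "X = \<iota> x \<oplus>\<^bsub>Vp\<^esub> rat_to_Qp p (of_nat p ^ k) \<odot>\<^bsub>Vp\<^esub> Y"
    using add(3) by blast
  obtain x' Y' where 2: "x' \<in> \<Lambda>g" "Y' \<in> \<Lambda>p" "X' = \<iota> x' \<oplus>\<^bsub>Vp\<^esub> rat_to_Qp p (of_nat p ^ k) \<odot>\<^bsub>Vp\<^esub> Y'"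
    using add(4) by blast
  have "X \<oplus>\<^bsub>Vp\<^esub> X' = \<iota> (x \<oplus>\<^bsub>VQ\<^esub> x') \<oplus>\<^bsub>Vp\<^esub> rat_to_Qp p (of_nat p ^ k) \<odot>\<^bsub>Vp\<^esub> (Y \<oplus>\<^bsub>Vp\<^esub> Y')"
    using 1 2 rat_to_Qp_closed[OF p] by (simp add: additive_map.add[OF iota_additive] P.V.smult_r_distr P.V.a_ac)
  then show ?case using glob.\<Lambda>_add[OF 1(1) 2(1)] loc.\<Lambda>_add[OF 1(2) 2(2)] by blast
qed

section \<open>Base change\<close>

text \<open>\<open>L \<otimes> \<rat>\<close> spans \<open>L \<otimes> \<rat>\<^sub>p\<close> over \<open>\<rat>\<^sub>p\<close>.\<close>

lemma linear_eqI:
  assumes f: "additive_map Vp Vp f" "\<And>a X. a \<in> carrier (Qp p) \<Longrightarrow> X \<in> carrier Vp \<Longrightarrow> f (a \<odot>\<^bsub>Vp\<^esub> X) = a \<odot>\<^bsub>Vp\<^esub> f X"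
    and g: "additive_map Vp Vp g" "\<And>a X. a \<in> carrier (Qp p) \<Longrightarrow> X \<in> carrier Vp \<Longrightarrow> g (a \<odot>\<^bsub>Vp\<^esub> X) = a \<odot>\<^bsub>Vp\<^esub> g X"
    and eq: "\<And>X. X \<in> carrier VQ \<Longrightarrow> f (\<iota> X) = g (\<iota> X)"
    and X: "X \<in> carrier Vp"
  shows "f X = g X"
  using X
proof (induction X rule: P.tensor_induct)
  case (pure x a)
  then show ?case using pt_Qp[OF pure] global_emb_closed[OF pure(1)] by (simp add: f(2) g(2) eq)
qed (simp add: additive_map.add[OF f(1)] additive_map.add[OF g(1)])

lemma Aut_additive: "f \<in> alg_Aut (Qp p) Vp \<Longrightarrow> additive_map Vp Vp f"
  using alg_AutD[of f "Qp p" Vp]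
  by (intro additive_map.intro additive_map_axioms.intro P.abelian_group_tensor) auto

text \<open>The universal property turns the biadditive map \<open>(x, b) \<mapsto> b \<iota>(\<alpha>(x \<otimes> 1))\<close> into an additive map; that it is linear,
  multiplicative and extends \<open>\<alpha>\<close> need only be checked on pure tensors.\<close>

lemma linear_extension:
  assumes \<alpha>: "\<alpha> \<in> alg_Aut rat_ring VQ"
  obtains g where "additive_map Vp Vp g"
    "\<And>a X. a \<in> carrier (Qp p) \<Longrightarrow> X \<in> carrier Vp \<Longrightarrow> g (a \<odot>\<^bsub>Vp\<^esub> X) = a \<odot>\<^bsub>Vp\<^esub> g X"
    "\<And>X Y. X \<in> carrier Vp \<Longrightarrow> Y \<in> carrier Vp \<Longrightarrow> g (X \<otimes>\<^bsub>Vp\<^esub> Y) = g X \<otimes>\<^bsub>Vp\<^esub> g Y"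
    "\<And>X. X \<in> carrier VQ \<Longrightarrow> g (\<iota> X) = \<iota> (\<alpha> X)"
proof -
  note a = alg_AutD[OF \<alpha>]
  note em = global_emb_closed
  obtain g where g: "\<And>X. X \<in> carrier Vp \<Longrightarrow> g X \<in> carrier Vp"
    "\<And>X Y. X \<in> carrier Vp \<Longrightarrow> Y \<in> carrier Vp \<Longrightarrow> g (X \<oplus>\<^bsub>Vp\<^esub> Y) = g X \<oplus>\<^bsub>Vp\<^esub> g Y"
    "\<And>x b. x \<in> carrier L \<Longrightarrow> b \<in> carrier (Qp p) \<Longrightarrow> g (P.pt x b) = b \<odot>\<^bsub>Vp\<^esub> \<iota> (\<alpha> (global_emb L x))"
  proof (rule P.tensor_universal[where W = Vp and b = "\<lambda>x b. b \<odot>\<^bsub>Vp\<^esub> \<iota> (\<alpha> (global_emb L x))"])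
    show "abelian_group Vp" by (rule P.abelian_group_tensor)
  qed (auto simp: a em additive_map.add[OF global_emb_additive] additive_map.add[OF iota_additive]
      P.V.smult_l_distr P.V.smult_r_distr)
  have add: "additive_map Vp Vp g"
    using g by (intro additive_map.intro additive_map_axioms.intro P.abelian_group_tensor) auto
  have smult: "g (b \<odot>\<^bsub>Vp\<^esub> X) = b \<odot>\<^bsub>Vp\<^esub> g X" if b: "b \<in> carrier (Qp p)" and X: "X \<in> carrier Vp" for b X
    using X by (induction X rule: P.tensor_induct)
      (use b in \<open>simp_all add: P.smult_pt g a em P.V.smult_assoc1 P.V.smult_r_distr\<close>)
  have iota: "g (\<iota> X) = \<iota> (\<alpha> X)" if "X \<in> carrier VQ" for X
    using that
  proof (induction X rule: Q.tensor_induct)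
    case (pure x q)
    have "\<iota> (\<alpha> (Q.pt x q)) = rat_to_Qp p q \<odot>\<^bsub>Vp\<^esub> \<iota> (\<alpha> (global_emb L x))"
      using pure(1) by (simp add: pt_rat a em iota_smult)
    then show ?case using pure(1) rat_to_Qp_closed[OF p] by (simp add: \<iota>_def I.tensor_map_pt g)
  next
    case (add X Y)
    then show ?case by (simp add: additive_map.add[OF iota_additive] g a)
  qed
  have mult: "g (X \<otimes>\<^bsub>Vp\<^esub> Y) = g X \<otimes>\<^bsub>Vp\<^esub> g Y" if X: "X \<in> carrier Vp" and Y: "Y \<in> carrier Vp" for X Y
    using X
  proof (induction X rule: P.tensor_induct)
    case (pure x b)
    show ?case
      using Y
    proof (induction Y rule: P.tensor_induct)
      case (pure y d)
      let ?A = "\<iota> (\<alpha> (global_emb L x))" and ?B = "\<iota> (\<alpha> (global_emb L y))"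
      have AB: "?A \<in> carrier Vp" "?B \<in> carrier Vp"
        using \<open>x \<in> carrier L\<close> pure(1) by (simp_all add: a em)
      have "g (P.pt x b \<otimes>\<^bsub>Vp\<^esub> P.pt y d) = (b \<otimes>\<^bsub>Qp p\<^esub> d) \<odot>\<^bsub>Vp\<^esub> (?A \<otimes>\<^bsub>Vp\<^esub> ?B)"
        using \<open>x \<in> carrier L\<close> \<open>b \<in> carrier (Qp p)\<close> pure
        by (simp add: P.mult_pt g prod_closed global_emb_mult a em iota_mult)
      also have "\<dots> = b \<odot>\<^bsub>Vp\<^esub> (?A \<otimes>\<^bsub>Vp\<^esub> (d \<odot>\<^bsub>Vp\<^esub> ?B))"
        using AB \<open>b \<in> carrier (Qp p)\<close> pure(2)
        by (simp add: P.smult_mult_right P.V.smult_assoc1 P.V.prod_closed)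
      also have "\<dots> = (b \<odot>\<^bsub>Vp\<^esub> ?A) \<otimes>\<^bsub>Vp\<^esub> (d \<odot>\<^bsub>Vp\<^esub> ?B)"
        using AB \<open>b \<in> carrier (Qp p)\<close> pure(2) by (simp add: P.smult_mult_left)
      finally show ?case
        using \<open>x \<in> carrier L\<close> \<open>b \<in> carrier (Qp p)\<close> pure by (simp add: g)
    qed (use pure in \<open>simp_all add: P.V.prod_add_right P.V.prod_closed g a em\<close>)
  qed (use Y in \<open>simp_all add: P.V.prod_add_left P.V.prod_closed g\<close>)
  show ?thesis by (rule that[OF add smult mult iota])
qed

text \<open>The extension of the inverse of \<open>\<alpha>\<close> is inverse to the extension of \<open>\<alpha>\<close>, because both composites agree with the
  identity on \<open>L \<otimes> \<rat>\<close>.\<close>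

lemma base_change_exists:
  assumes \<alpha>: "\<alpha> \<in> alg_Aut rat_ring VQ"
  shows "\<exists>f\<in>alg_Aut (Qp p) Vp. \<forall>X\<in>carrier VQ. f (\<iota> X) = \<iota> (\<alpha> X)"
proof -
  note a = alg_AutD[OF \<alpha>]
  define \<beta> where "\<beta> = restrict (inv_into (carrier VQ) \<alpha>) (carrier VQ)"
  have \<beta>: "\<beta> \<in> alg_Aut rat_ring VQ" unfolding \<beta>_def by (rule Q.V.Aut_inverse[OF \<alpha>])
  have inv: "\<alpha> (\<beta> X) = X" "\<beta> (\<alpha> X) = X" if "X \<in> carrier VQ" for X
    using that a(1,6) by (auto simp: \<beta>_def bij_betw_inv_into_right bij_betw_inv_into_left)
  obtain f where f: "additive_map Vp Vp f"
    "\<And>a X. a \<in> carrier (Qp p) \<Longrightarrow> X \<in> carrier Vp \<Longrightarrow> f (a \<odot>\<^bsub>Vp\<^esub> X) = a \<odot>\<^bsub>Vp\<^esub> f X"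
    "\<And>X Y. X \<in> carrier Vp \<Longrightarrow> Y \<in> carrier Vp \<Longrightarrow> f (X \<otimes>\<^bsub>Vp\<^esub> Y) = f X \<otimes>\<^bsub>Vp\<^esub> f Y"
    "\<And>X. X \<in> carrier VQ \<Longrightarrow> f (\<iota> X) = \<iota> (\<alpha> X)"
    by (rule linear_extension[OF \<alpha>]) blast
  obtain g where g: "additive_map Vp Vp g"
    "\<And>a X. a \<in> carrier (Qp p) \<Longrightarrow> X \<in> carrier Vp \<Longrightarrow> g (a \<odot>\<^bsub>Vp\<^esub> X) = a \<odot>\<^bsub>Vp\<^esub> g X"
    "\<And>X. X \<in> carrier VQ \<Longrightarrow> g (\<iota> X) = \<iota> (\<beta> X)"
    by (rule linear_extension[OF \<beta>]) blast
  note fc = additive_map.closed[OF f(1)] and gc = additive_map.closed[OF g(1)]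
  note fa = additive_map.add[OF f(1)] and ga = additive_map.add[OF g(1)]
  have id: "additive_map Vp Vp (\<lambda>X. X)"
    by (intro additive_map.intro additive_map_axioms.intro P.abelian_group_tensor) auto
  have fg: "f (g X) = X" if "X \<in> carrier Vp" for X
  proof (rule linear_eqI[of "\<lambda>X. f (g X)" "\<lambda>X. X"])
    show "additive_map Vp Vp (\<lambda>X. f (g X))"
      by (intro additive_map.intro additive_map_axioms.intro P.abelian_group_tensor) (auto simp: fc gc fa ga)
  qed (use that id alg_AutD(1)[OF \<beta>] in \<open>auto simp: f g fc gc inv\<close>)
  have gf: "g (f X) = X" if "X \<in> carrier Vp" for X
  proof (rule linear_eqI[of "\<lambda>X. g (f X)" "\<lambda>X. X"])
    show "additive_map Vp Vp (\<lambda>X. g (f X))"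
      by (intro additive_map.intro additive_map_axioms.intro P.abelian_group_tensor) (auto simp: fc gc fa ga)
  qed (use that id a(1) in \<open>auto simp: f g fc gc inv\<close>)
  have "restrict f (carrier Vp) \<in> alg_Aut (Qp p) Vp"
  proof (rule alg_AutI)
    show "bij_betw (restrict f (carrier Vp)) (carrier Vp) (carrier Vp)"
      by (rule bij_betw_byWitness[where f' = g]) (use fc gc fg gf in auto)
  qed (auto simp: fa f P.V.prod_closed)
  then show ?thesis using f(4) by (intro bexI[of _ "restrict f (carrier Vp)"]) auto
qed

lemma base_change:
  assumes \<alpha>: "\<alpha> \<in> carrier glob.G"
  shows base_change_closed: "base_change L p \<alpha> \<in> carrier loc.G"
    and base_change_iota: "X \<in> carrier VQ \<Longrightarrow> base_change L p \<alpha> (\<iota> X) = \<iota> (\<alpha> X)"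
    and base_change_unique: "f \<in> carrier loc.G \<Longrightarrow> (\<And>X. X \<in> carrier VQ \<Longrightarrow> f (\<iota> X) = \<iota> (\<alpha> X)) \<Longrightarrow>
      f = base_change L p \<alpha>"
proof -
  let ?P = "\<lambda>f. f \<in> carrier (G_loc L p) \<and> (\<forall>X\<in>carrier VQ. f (\<iota> X) = \<iota> (\<alpha> X))"
  have uniq: "f = g" if "?P f" "?P g" for f g
  proof -
    have fg: "f \<in> alg_Aut (Qp p) Vp" "g \<in> alg_Aut (Qp p) Vp"
      using that by (auto simp: local_eqs loc.G_simps)
    have "f X = g X" if "X \<in> carrier Vp" for X
      by (rule linear_eqI[OF Aut_additive[OF fg(1)] alg_AutD(4)[OF fg(1)]
            Aut_additive[OF fg(2)] alg_AutD(4)[OF fg(2)] _ that])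
        (use \<open>?P f\<close> \<open>?P g\<close> in auto)
    then show ?thesis using extensionalityI[OF alg_AutD(5)[OF fg(1)] alg_AutD(5)[OF fg(2)]] by blast
  qed
  obtain f where f: "?P f"
    using base_change_exists[of \<alpha>] \<alpha> by (auto simp: local_eqs loc.G_simps glob.G_simps)
  have "(THE f. ?P f) = f"
    by (rule the_equality[where P = ?P and a = f]) (use f uniq in blast)+
  then have eq: "base_change L p \<alpha> = f" by (simp only: base_change_def \<iota>_def)
  show "base_change L p \<alpha> \<in> carrier loc.G" using f eq by (simp add: local_eqs)
  show "X \<in> carrier VQ \<Longrightarrow> base_change L p \<alpha> (\<iota> X) = \<iota> (\<alpha> X)" using f eq by simp
  show "f = base_change L p \<alpha>" if "f \<in> carrier loc.G" "\<And>X. X \<in> carrier VQ \<Longrightarrow> f (\<iota> X) = \<iota> (\<alpha> X)" for f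
    using that uniq[of f "base_change L p \<alpha>"] f eq by (simp add: local_eqs)
qed

lemma base_change_mult:
  assumes "\<alpha> \<in> carrier glob.G" "\<beta> \<in> carrier glob.G"
  shows "base_change L p (\<alpha> \<otimes>\<^bsub>glob.G\<^esub> \<beta>) = base_change L p \<alpha> \<otimes>\<^bsub>loc.G\<^esub> base_change L p \<beta>"
proof (rule base_change_unique[symmetric])
  fix X assume "X \<in> carrier VQ"
  then show "(base_change L p \<alpha> \<otimes>\<^bsub>loc.G\<^esub> base_change L p \<beta>) (\<iota> X) = \<iota> ((\<alpha> \<otimes>\<^bsub>glob.G\<^esub> \<beta>) X)"
    using assms alg_AutD(1)[of \<alpha> rat_ring VQ] by (simp add: loc.G_simps glob.G_simps base_change_iota)
qed (use assms base_change_closed in auto)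

lemma base_change_hom: "group_hom glob.G loc.G (base_change L p)"
  using base_change_closed base_change_mult
  by (auto simp: group_hom_def group_hom_axioms_def hom_def glob.G.is_group loc.G.is_group)

lemma base_change_\<Delta>:
  assumes \<alpha>: "\<alpha> \<in> glob.\<Delta>" shows "base_change L p \<alpha> \<in> loc.\<Delta>"
proof (rule loc.\<Delta>I)
  have G: "\<alpha> \<in> carrier glob.G" using glob.\<Delta>D(1)[OF \<alpha>] .
  let ?b = "base_change L p \<alpha>"
  show bG: "?b \<in> carrier loc.G" by (rule base_change_closed[OF G])
  then have "?b \<in> alg_Aut (Qp p) Vp" by (simp add: loc.G_simps)
  note b = alg_AutD[OF this]
  show "?b ` \<Lambda>p \<subseteq> \<Lambda>p"
  proof
    fix Y assume "Y \<in> ?b ` \<Lambda>p"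
    then obtain X where X: "X \<in> \<Lambda>p" "Y = ?b X" by auto
    have "?b X \<in> \<Lambda>p"
      using X(1)
    proof (induction X rule: local_lattice_induct)
      case (pure a x)
      have a: "a \<in> carrier (Qp p)" using pure(1) Zp_subset[OF p] by auto
      have gx: "global_emb L x \<in> carrier VQ" "global_emb L x \<in> \<Lambda>g"
        using pure(2) by (auto simp: global_emb_closed \<Lambda>g_def)
      have "\<alpha> (global_emb L x) \<in> \<Lambda>g" using glob.\<Delta>D(2)[OF \<alpha>] gx(2) by auto
      then show ?case
        using local_lattice_smult[OF pure(1) iota_lattice] a gx(1) by (simp add: b base_change_iota[OF G])
    next
      case (add X Y)
      then show ?case using loc.\<Lambda>_add[OF add(3,4)] by (simp add: b)
    qed
    then show "Y \<in> \<Lambda>p" using X by simp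
  qed
qed

lemma base_change_\<Gamma>:
  assumes "\<gamma> \<in> glob.\<Gamma>" shows "base_change L p \<gamma> \<in> loc.\<Gamma>"
proof -
  interpret h: group_hom glob.G loc.G "base_change L p" by (rule base_change_hom)
  have G: "\<gamma> \<in> carrier glob.G" using glob.\<Gamma>D(1)[OF assms] .
  have 1: "base_change L p \<gamma> \<in> loc.\<Delta>" using base_change_\<Delta> assms glob.\<Gamma>_subset_\<Delta> by auto
  have "inv\<^bsub>glob.G\<^esub> \<gamma> \<in> glob.\<Gamma>" using subgroup.m_inv_closed[OF glob.\<Gamma>_subgroup assms] .
  then have 2: "inv\<^bsub>loc.G\<^esub> (base_change L p \<gamma>) \<in> loc.\<Delta>"
    using base_change_\<Delta>[of "inv\<^bsub>glob.G\<^esub> \<gamma>"] glob.\<Gamma>_subset_\<Delta> G by auto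
  show ?thesis
  proof (rule loc.\<Gamma>I)
    show "base_change L p \<gamma> \<in> carrier loc.G" by (rule base_change_closed[OF G])
    have "\<Lambda>p = base_change L p \<gamma> ` (inv\<^bsub>loc.G\<^esub> (base_change L p \<gamma>)) ` \<Lambda>p"
      using loc.image_inv_cancel(2)[OF base_change_closed[OF G] loc.\<Lambda>_subset] by simp
    also have "\<dots> \<subseteq> base_change L p \<gamma> ` \<Lambda>p" using loc.\<Delta>D(2)[OF 2] by (rule image_mono)
    finally show "base_change L p \<gamma> ` \<Lambda>p = \<Lambda>p" using loc.\<Delta>D(2)[OF 1] by auto
  qed
qed

end

text \<open>If \<open>g\<close> preserves every local lattice, then the coordinates of \<open>g(x)\<close> for \<open>x\<close> in \<open>L\<close> are \<open>p\<close>-integral for all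
  \<open>p\<close>, hence integers.\<close>

lemma (in based_algebra) \<Delta>_local_global:
  assumes g: "g \<in> carrier glob.G" and loc: "\<And>p. prime p \<Longrightarrow> base_change L p g \<in> \<Delta>_loc L p"
  shows "g \<in> glob.\<Delta>"
proof (rule glob.\<Delta>I[OF g], rule image_subsetI)
  fix X assume X: "X \<in> \<Lambda>g"
  then have XV: "X \<in> carrier VQ" by simp
  then have gX: "g X \<in> carrier VQ" using g alg_AutD(1)[of g rat_ring VQ] by (simp add: glob.G_simps)
  have "padic_abs p (Q.coord i (g X)) \<le> 1" if "prime p" for p i
  proof -
    interpret based_algebra_prime L r e c p by unfold_locales (rule that)
    have "base_change L p g ` \<Lambda>p \<subseteq> \<Lambda>p" using loc[OF that] loc.\<Delta>D(2) by (simp add: local_eqs)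
    then have "base_change L p g (\<iota> X) \<in> \<Lambda>p" using iota_lattice[OF X] by auto
    then show ?thesis using padic_abs_coord_le_1[OF gX] base_change_iota[OF g XV] by simp
  qed
  then show "g X \<in> \<Lambda>g" using mem_lattice_iff_coord[OF gX] padic_integer_everywhere_imp_int by blast
qed

section \<open>Finiteness of the index\<close>

context based_algebra
begin

lemma add_pow_VQ:
  fixes n :: nat
  assumes "X \<in> carrier VQ"
  shows "[n] \<cdot>\<^bsub>VQ\<^esub> X = of_nat n \<odot>\<^bsub>VQ\<^esub> X"
proof -
  have "additive_map rat_ring VQ (\<lambda>q. q \<odot>\<^bsub>VQ\<^esub> X)"
    using assms Q.V.smult_l_distr[of _ _ X]
    by (intro additive_map.intro additive_map_axioms.intro Q.abelian_group_tensor Q.R.is_abelian_group) auto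
  from additive_map.add_pow_int[OF this, of 1 "int n"]
  have "of_nat n \<odot>\<^bsub>VQ\<^esub> X = [int n] \<cdot>\<^bsub>VQ\<^esub> X"
    using assms Q.V.smult_one by (simp add: add_pow_rat_ring)
  then show ?thesis by (simp add: add_pow_def int_pow_int)
qed

lemma smult_inverse_VQ:
  assumes "X \<in> carrier VQ" "q \<noteq> 0"
  shows "q \<odot>\<^bsub>VQ\<^esub> (inverse q \<odot>\<^bsub>VQ\<^esub> X) = X"
  using assms Q.V.smult_assoc1[of q "inverse q" X] Q.V.smult_one[of X] by simp

text \<open>A coset of \<open>n\<Lambda>\<close> is determined by the coordinates modulo \<open>n\<close>.\<close>

lemma finite_rcosets_multiples:
  fixes n :: nat
  assumes n: "n > 0"
  shows "finite (rcosets\<^bsub>glob.A\<^esub> ((\<lambda>x. [n] \<cdot>\<^bsub>VQ\<^esub> x) ` \<Lambda>g))"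
proof -
  let ?N = "(\<lambda>x. [n] \<cdot>\<^bsub>VQ\<^esub> x) ` \<Lambda>g"
  have N: "subgroup ?N glob.A"
  proof (rule glob.A.subgroupI)
    show "?N \<subseteq> carrier glob.A" using glob.\<Lambda>_add_pow_nat by auto
    show "?N \<noteq> {}" using glob.\<Lambda>_zero by auto
    show "inv\<^bsub>glob.A\<^esub> a \<in> ?N" if "a \<in> ?N" for a
    proof -
      obtain x where x: "x \<in> \<Lambda>g" "a = x [^]\<^bsub>glob.A\<^esub> n" using \<open>a \<in> ?N\<close> by (auto simp: glob.A_pow)
      then have "inv\<^bsub>glob.A\<^esub> a = [n] \<cdot>\<^bsub>VQ\<^esub> (inv\<^bsub>glob.A\<^esub> x)"
        by (simp add: glob.A.nat_pow_inv flip: glob.A_pow)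
      then show ?thesis using x(1) glob.A.inv_closed[of x] by auto
    qed
    show "a \<otimes>\<^bsub>glob.A\<^esub> b \<in> ?N" if "a \<in> ?N" "b \<in> ?N" for a b
    proof -
      obtain x y where x: "x \<in> \<Lambda>g" "a = [n] \<cdot>\<^bsub>VQ\<^esub> x" and y: "y \<in> \<Lambda>g" "b = [n] \<cdot>\<^bsub>VQ\<^esub> y" using \<open>a \<in> ?N\<close> \<open>b \<in> ?N\<close> by auto
      then have "a \<otimes>\<^bsub>glob.A\<^esub> b = [n] \<cdot>\<^bsub>VQ\<^esub> (x \<oplus>\<^bsub>VQ\<^esub> y)"
        using glob.A.nat_pow_distrib[of x y n] by (simp add: glob.A_pow)
      then show ?thesis using glob.\<Lambda>_add[OF x(1) y(1)] by auto
    qed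
  qed
  let ?F = "\<lambda>X. \<lambda>i\<in>{..<r}. \<lfloor>Q.coord i X\<rfloor> mod int n"
  have "finite ((\<lambda>X. ?N #>\<^bsub>glob.A\<^esub> X) ` \<Lambda>g)"
  proof (rule finite_image_of_coarser[where F = ?F])
    have "?F ` \<Lambda>g \<subseteq> {..<r} \<rightarrow>\<^sub>E {0..<int n}" using n by auto
    then show "finite (?F ` \<Lambda>g)" by (rule finite_subset) (simp add: finite_PiE)
    fix X Y assume XY: "X \<in> \<Lambda>g" "Y \<in> \<Lambda>g" "?F X = ?F Y"
    let ?D = "X \<oplus>\<^bsub>VQ\<^esub> (\<ominus>\<^bsub>VQ\<^esub> Y)"
    have D: "?D \<in> \<Lambda>g" using XY glob.\<Lambda>_add glob.\<Lambda>_minus by simp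
    define Z where "Z = inverse (of_nat n) \<odot>\<^bsub>VQ\<^esub> ?D"
    have ZV: "Z \<in> carrier VQ" unfolding Z_def using D by (simp add: Q.smult_closed)
    have "Q.coord i Z \<in> \<int>" if i: "i < r" for i
    proof -
      have "?F X i = ?F Y i" using XY(3) by (rule fun_cong)
      then have m: "\<lfloor>Q.coord i X\<rfloor> mod int n = \<lfloor>Q.coord i Y\<rfloor> mod int n" using i by simp
      then have "int n dvd \<lfloor>Q.coord i X\<rfloor> - \<lfloor>Q.coord i Y\<rfloor>" by (simp add: mod_eq_dvd_iff)
      then obtain k where k: "\<lfloor>Q.coord i X\<rfloor> - \<lfloor>Q.coord i Y\<rfloor> = int n * k" by auto
      have int: "of_int \<lfloor>Q.coord i X\<rfloor> = Q.coord i X" "of_int \<lfloor>Q.coord i Y\<rfloor> = Q.coord i Y"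
        using XY i mem_lattice_iff_coord[of X] mem_lattice_iff_coord[of Y] by auto
      have minus: "\<ominus>\<^bsub>rat_ring\<^esub> q = - q" for q by (rule Q.R.minus_equality) auto
      have "Q.coord i ?D = Q.coord i X - Q.coord i Y"
        using XY additive_map.minus[OF Q.coord_additive, of Y i] by (simp add: Q.coord_add minus)
      also have "\<dots> = of_int (int n * k)" unfolding k[symmetric] by (simp add: int)
      finally have "Q.coord i Z = of_int k" unfolding Z_def using n D by (simp add: Q.coord_smult)
      then show ?thesis by simp
    qed
    then have Z: "Z \<in> \<Lambda>g" using mem_lattice_iff_coord[OF ZV] by simp
    have "?D = [n] \<cdot>\<^bsub>VQ\<^esub> Z"
      using smult_inverse_VQ[of ?D "of_nat n"] n D by (simp add: add_pow_VQ[OF ZV]) (simp add: Z_def)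
    then have "?D \<in> ?N" using Z by auto
    moreover have "X \<otimes>\<^bsub>glob.A\<^esub> inv\<^bsub>glob.A\<^esub> Y = ?D"
    proof -
      have "inv\<^bsub>glob.A\<^esub> Y = \<ominus>\<^bsub>VQ\<^esub> Y"
        using XY glob.\<Lambda>_minus[OF XY(2)] by (intro glob.A.inv_equality) (auto simp: Q.V.l_neg)
      then show ?thesis by simp
    qed
    ultimately show "?N #>\<^bsub>glob.A\<^esub> X = ?N #>\<^bsub>glob.A\<^esub> Y"
      using XY by (subst glob.A.rcos_eq_iff[OF N]) auto
  qed
  then show ?thesis by (simp add: rcosets_eq_image)
qed

lemma multiple_in_lattice:
  assumes "X \<in> carrier VQ"
  shows "\<exists>N::nat. N > 0 \<and> [N] \<cdot>\<^bsub>VQ\<^esub> X \<in> \<Lambda>g"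
  using assms
proof (induction X rule: Q.tensor_induct)
  case (pure x q)
  obtain a b where ab: "quotient_of q = (a, b)" by fastforce
  have b: "b > 0" and q: "q = of_int a / of_int b"
    using quotient_of_denom_pos[OF ab] quotient_of_div[OF ab] by auto
  have "[nat b] \<cdot>\<^bsub>VQ\<^esub> Q.pt x q = of_int a \<odot>\<^bsub>VQ\<^esub> global_emb L x"
    using pure b by (simp add: add_pow_VQ Q.smult_pt global_emb_def q)
  also have "\<dots> = global_emb L ([a] \<cdot>\<^bsub>L\<^esub> x)" using pure(1) by (simp add: global_emb_add_pow)
  finally show ?case
    using b add.int_pow_closed[OF pure(1)] by (intro exI[of _ "nat b"]) (auto simp: \<Lambda>g_def)
next
  case (add X Y)
  obtain M N :: nat where MN: "M > 0" "[M] \<cdot>\<^bsub>VQ\<^esub> X \<in> \<Lambda>g" "N > 0" "[N] \<cdot>\<^bsub>VQ\<^esub> Y \<in> \<Lambda>g"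
    using add(3,4) by blast
  have "[(M * N)] \<cdot>\<^bsub>VQ\<^esub> (X \<oplus>\<^bsub>VQ\<^esub> Y) = ([N] \<cdot>\<^bsub>VQ\<^esub> ([M] \<cdot>\<^bsub>VQ\<^esub> X)) \<oplus>\<^bsub>VQ\<^esub> ([M] \<cdot>\<^bsub>VQ\<^esub> ([N] \<cdot>\<^bsub>VQ\<^esub> Y))"
    using add(1,2) by (simp add: Q.V.add.nat_pow_distrib Q.V.add.nat_pow_pow mult.commute)
  then show ?case using MN glob.\<Lambda>_add glob.\<Lambda>_add_pow_nat by (intro exI[of _ "M * N"]) simp
qed

text \<open>A common denominator \<open>M\<close> of the images of the generators \<open>e i\<close> under the inverse of \<open>\<alpha>\<close> satisfies \<open>M\<Lambda> \<subseteq> \<alpha>(\<Lambda>)\<close>, and \<open>M\<Lambda>\<close> has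
  finite index.\<close>

lemma ind_pos:
  assumes \<alpha>: "\<alpha> \<in> glob.\<Delta>" shows "glob.ind \<alpha> > 0"
proof -
  have G: "\<alpha> \<in> carrier glob.G" using glob.\<Delta>D(1)[OF \<alpha>] .
  define \<beta> where "\<beta> = inv\<^bsub>glob.G\<^esub> \<alpha>"
  have \<beta>: "\<beta> \<in> carrier glob.G" unfolding \<beta>_def using G by simp
  have \<beta>V: "\<beta> X \<in> carrier VQ" if "X \<in> carrier VQ" for X
    using \<beta> that alg_AutD(1)[of \<beta> rat_ring VQ] by (simp add: glob.G_simps)
  have \<alpha>\<beta>: "\<alpha> (\<beta> X) = X" if "X \<in> carrier VQ" for X
    using glob.G_simps(3)[OF that, of \<beta> \<alpha>] that G by (simp add: \<beta>_def glob.G_simps(2))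
  have "\<exists>N::nat. N > 0 \<and> [N] \<cdot>\<^bsub>VQ\<^esub> \<beta> (global_emb L (e i)) \<in> \<Lambda>g" if "i < r" for i
    using multiple_in_lattice[OF \<beta>V[OF global_emb_closed[OF e_closed[OF that]]]] by blast
  then obtain N :: "nat \<Rightarrow> nat" where N: "\<And>i. i < r \<Longrightarrow> N i > 0 \<and> [N i] \<cdot>\<^bsub>VQ\<^esub> \<beta> (global_emb L (e i)) \<in> \<Lambda>g"
    by metis
  define M where "M = (\<Prod>i<r. N i)"
  have M0: "M > 0" unfolding M_def using N by (simp add: prod_pos)
  have Me: "[M] \<cdot>\<^bsub>VQ\<^esub> \<beta> (global_emb L (e i)) \<in> \<Lambda>g" if i: "i < r" for i
  proof -
    define M' where "M' = (\<Prod>j\<in>{..<r} - {i}. N j)"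
    have "M = N i * M'" unfolding M_def M'_def using i by (simp add: prod.remove)
    then have "[M] \<cdot>\<^bsub>VQ\<^esub> \<beta> (global_emb L (e i))
        = [M'] \<cdot>\<^bsub>VQ\<^esub> ([N i] \<cdot>\<^bsub>VQ\<^esub> \<beta> (global_emb L (e i)))"
      using \<beta>V[OF global_emb_closed[OF e_closed[OF i]]] by (simp add: Q.V.add.nat_pow_pow)
    then show ?thesis using N[OF i] glob.\<Lambda>_add_pow_nat by simp
  qed
  have M: "[M] \<cdot>\<^bsub>VQ\<^esub> X \<in> \<alpha> ` \<Lambda>g" if X: "X \<in> \<Lambda>g" for X
  proof -
    obtain x where x: "x \<in> carrier L" "X = global_emb L x" using X by (auto simp: \<Lambda>g_def)
    have f: "additive_map L VQ (\<lambda>x. [M] \<cdot>\<^bsub>VQ\<^esub> \<beta> (global_emb L x))"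
      using \<beta> alg_AutD(2)[of \<beta> rat_ring VQ] global_emb_closed \<beta>V
      by (intro additive_map.intro additive_map_axioms.intro Q.abelian_group_tensor abelian_group_axioms)
        (simp_all add: glob.G_simps additive_map.add[OF global_emb_additive] Q.V.add.nat_pow_distrib)
    have cl: "[c x i] \<cdot>\<^bsub>L\<^esub> e i \<in> carrier L" if "i < r" for i
      using e_closed[OF that] by (rule add.int_pow_closed)
    have "[M] \<cdot>\<^bsub>VQ\<^esub> \<beta> (global_emb L (\<Oplus>\<^bsub>L\<^esub>i\<in>{..<r}. [c x i] \<cdot>\<^bsub>L\<^esub> e i))
        = (\<Oplus>\<^bsub>VQ\<^esub>i\<in>{..<r}. [M] \<cdot>\<^bsub>VQ\<^esub> \<beta> (global_emb L ([c x i] \<cdot>\<^bsub>L\<^esub> e i)))"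
      by (rule additive_map.finsum[OF f]) (use cl in auto)
    also have "\<dots> \<in> \<Lambda>g"
      by (rule glob.\<Lambda>_finsum)
        (use additive_map.add_pow_int[OF f] e_closed Me glob.\<Lambda>_add_pow_int in simp_all)
    finally have "[M] \<cdot>\<^bsub>VQ\<^esub> \<beta> X \<in> \<Lambda>g" using expansion[OF x(1)] x(2) by simp
    moreover have "\<alpha> ([M] \<cdot>\<^bsub>VQ\<^esub> \<beta> X) = [M] \<cdot>\<^bsub>VQ\<^esub> X"
      using glob.Aut_add_pow[OF G \<beta>V] \<alpha>\<beta> X by simp
    ultimately show ?thesis by (metis image_eqI)
  qed
  let ?N = "(\<lambda>x. [M] \<cdot>\<^bsub>VQ\<^esub> x) ` \<Lambda>g"
  note sub = glob.image_subgroup[OF \<alpha>]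
  have "finite ((\<lambda>X. \<alpha> ` \<Lambda>g #>\<^bsub>glob.A\<^esub> X) ` \<Lambda>g)"
  proof (rule finite_image_of_coarser)
    show "finite ((\<lambda>X. ?N #>\<^bsub>glob.A\<^esub> X) ` \<Lambda>g)"
      using finite_rcosets_multiples[OF M0] by (simp add: rcosets_eq_image)
    fix X Y assume XY: "X \<in> \<Lambda>g" "Y \<in> \<Lambda>g" "?N #>\<^bsub>glob.A\<^esub> X = ?N #>\<^bsub>glob.A\<^esub> Y"
    have "\<zero>\<^bsub>VQ\<^esub> = [M] \<cdot>\<^bsub>VQ\<^esub> \<zero>\<^bsub>VQ\<^esub>" by simp
    then have "\<zero>\<^bsub>VQ\<^esub> \<in> ?N" using glob.\<Lambda>_zero by blast
    moreover have "X = \<zero>\<^bsub>VQ\<^esub> \<otimes>\<^bsub>glob.A\<^esub> X" using XY(1) by simp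
    ultimately have "X \<in> ?N #>\<^bsub>glob.A\<^esub> X" unfolding r_coset_def by (intro UN_I[of "\<zero>\<^bsub>VQ\<^esub>"]) simp_all
    then have "X \<in> ?N #>\<^bsub>glob.A\<^esub> Y" using XY(3) by simp
    moreover have "?N #>\<^bsub>glob.A\<^esub> Y \<subseteq> \<alpha> ` \<Lambda>g #>\<^bsub>glob.A\<^esub> Y"
      unfolding r_coset_def by (rule UN_mono) (use M in auto)
    ultimately have "X \<in> \<alpha> ` \<Lambda>g #>\<^bsub>glob.A\<^esub> Y" by blast
    then show "\<alpha> ` \<Lambda>g #>\<^bsub>glob.A\<^esub> X = \<alpha> ` \<Lambda>g #>\<^bsub>glob.A\<^esub> Y"
      using glob.A.repr_independence[OF _ _ sub, of X Y] XY(2) by simp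
  qed
  then show ?thesis using glob.\<Lambda>_zero by (auto simp: glob.ind_eq rcosets_eq_image card_gt_0_iff)
qed

end

section \<open>Local and global indices\<close>

context based_algebra_prime
begin

lemma smult_inverse_Vp:
  assumes "X \<in> carrier Vp" "q \<noteq> 0"
  shows "rat_to_Qp p q \<odot>\<^bsub>Vp\<^esub> (rat_to_Qp p (inverse q) \<odot>\<^bsub>Vp\<^esub> X) = X"
proof -
  have "rat_to_Qp p q \<otimes>\<^bsub>Qp p\<^esub> rat_to_Qp p (inverse q) = \<one>\<^bsub>Qp p\<^esub>"
    using assms(2) by (simp flip: rat_to_Qp_mult[OF p] add: rat_to_Qp_one[OF p])
  then show ?thesis
    using assms(1) P.V.smult_assoc1[of "rat_to_Qp p q" "rat_to_Qp p (inverse q)" X] rat_to_Qp_closed[OF p]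
    by simp
qed

text \<open>A rational number that is \<open>p\<close>-integral and becomes an integer after multiplication by a power of \<open>p\<close> is an
  integer; apply this to the coordinates.\<close>

lemma lattice_saturated:
  assumes X: "X \<in> carrier VQ" and loc: "\<iota> X \<in> \<Lambda>p" and mult: "of_nat p ^ k \<odot>\<^bsub>VQ\<^esub> X \<in> \<Lambda>g"
  shows "X \<in> \<Lambda>g"
  unfolding mem_lattice_iff_coord[OF X]
proof (intro allI impI)
  fix i assume "i < r"
  then have "Q.coord i (of_nat p ^ k \<odot>\<^bsub>VQ\<^esub> X) \<in> \<int>"
    using mult mem_lattice_iff_coord[of "of_nat p ^ k \<odot>\<^bsub>VQ\<^esub> X"] by simp
  then have "of_nat p ^ k * Q.coord i X \<in> \<int>" using X by (simp add: Q.coord_smult)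
  then show "Q.coord i X \<in> \<int>"
    using padic_integer_imp_int[OF p padic_abs_coord_le_1[OF X loc]] by blast
qed

lemma base_change_add:
  "\<alpha> \<in> carrier glob.G \<Longrightarrow> X \<in> carrier Vp \<Longrightarrow> Y \<in> carrier Vp \<Longrightarrow>
    base_change L p \<alpha> (X \<oplus>\<^bsub>Vp\<^esub> Y) = base_change L p \<alpha> X \<oplus>\<^bsub>Vp\<^esub> base_change L p \<alpha> Y"
  using base_change_closed[of \<alpha>] alg_AutD(2)[of "base_change L p \<alpha>" "Qp p" Vp] by (simp add: loc.G_simps)

lemma base_change_smult:
  "\<alpha> \<in> carrier glob.G \<Longrightarrow> a \<in> carrier (Qp p) \<Longrightarrow> X \<in> carrier Vp \<Longrightarrow>
    base_change L p \<alpha> (a \<odot>\<^bsub>Vp\<^esub> X) = a \<odot>\<^bsub>Vp\<^esub> base_change L p \<alpha> X"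
  using base_change_closed[of \<alpha>] alg_AutD(4)[of "base_change L p \<alpha>" "Qp p" Vp] by (simp add: loc.G_simps)

lemma inverse_mem_Zp:
  assumes "coprime p m" shows "rat_to_Qp p (inverse (of_nat m)) \<in> carrier (Zp p)"
proof -
  have "\<not> p dvd m" using assms p by (metis coprime_common_divisor dvd_refl not_prime_unit)
  then have "\<not> int p dvd int m" by simp
  from padic_abs_fraction_le_1[OF p this, of 1] show ?thesis
    by (simp add: rat_to_Qp_mem_Zp_iff[OF p] inverse_eq_divide)
qed

text \<open>The index \<open>N\<close> of \<open>\<beta>\<close> satisfies \<open>N\<Lambda> \<subseteq> \<beta>(\<Lambda>)\<close> by Lagrange, and this inclusion extends to \<open>\<int>\<^sub>p\<close>-spans.\<close>

lemma local_image_multiples: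
  assumes \<beta>: "\<beta> \<in> glob.\<Delta>" and X: "X \<in> \<Lambda>p"
  shows "rat_to_Qp p (of_nat (glob.ind \<beta>)) \<odot>\<^bsub>Vp\<^esub> X \<in> base_change L p \<beta> ` \<Lambda>p"
  using X
proof (induction X rule: local_lattice_induct)
  let ?N = "of_nat (glob.ind \<beta>)"
  note G = glob.\<Delta>D(1)[OF \<beta>]
  note [simp] = rat_to_Qp_closed[OF p]
  {
    case (pure a x)
    have a: "a \<in> carrier (Qp p)" using pure(1) Zp_subset[OF p] by auto
    let ?u = "global_emb L x"
    have u: "?u \<in> \<Lambda>g" "?u \<in> carrier VQ" using pure(2) by (auto simp: \<Lambda>g_def global_emb_closed)
    have "[glob.ind \<beta>] \<cdot>\<^bsub>VQ\<^esub> ?u \<in> \<beta> ` \<Lambda>g"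
      using glob.level_add_pow[of \<beta> "glob.ind \<beta>" ?u] ind_pos[OF \<beta>] \<beta> u(1) by (simp add: glob.level_def)
    then obtain y where y: "y \<in> \<Lambda>g" "?N \<odot>\<^bsub>VQ\<^esub> ?u = \<beta> y" using u(2) by (auto simp: add_pow_VQ)
    have yV: "y \<in> carrier VQ" using y(1) by simp
    have "rat_to_Qp p ?N \<odot>\<^bsub>Vp\<^esub> (a \<odot>\<^bsub>Vp\<^esub> \<iota> ?u) = a \<odot>\<^bsub>Vp\<^esub> (rat_to_Qp p ?N \<odot>\<^bsub>Vp\<^esub> \<iota> ?u)"
      using a u(2) by (simp add: P.R.m_comm flip: P.V.smult_assoc1)
    also have "\<dots> = a \<odot>\<^bsub>Vp\<^esub> \<iota> (\<beta> y)" using u(2) y(2) by (simp flip: iota_smult)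
    also have "\<dots> = base_change L p \<beta> (a \<odot>\<^bsub>Vp\<^esub> \<iota> y)"
      using yV a by (simp add: base_change_smult[OF G] base_change_iota[OF G])
    finally show ?case using local_lattice_smult[OF pure(1) iota_lattice[OF y(1)]] by (metis image_eqI)
  next
    case (add X Y)
    obtain X' Y' where "X' \<in> \<Lambda>p" "rat_to_Qp p ?N \<odot>\<^bsub>Vp\<^esub> X = base_change L p \<beta> X'"
      "Y' \<in> \<Lambda>p" "rat_to_Qp p ?N \<odot>\<^bsub>Vp\<^esub> Y = base_change L p \<beta> Y'"
      using add(3,4) by auto
    then have "rat_to_Qp p ?N \<odot>\<^bsub>Vp\<^esub> (X \<oplus>\<^bsub>Vp\<^esub> Y) = base_change L p \<beta> (X' \<oplus>\<^bsub>Vp\<^esub> Y')" "X' \<oplus>\<^bsub>Vp\<^esub> Y' \<in> \<Lambda>p"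
      using add(1,2) loc.\<Lambda>_add by (simp_all add: P.V.smult_r_distr base_change_add[OF G])
    then show ?case by (metis image_eqI)
  }
qed

text \<open>Write the index as \<open>p\<^sup>v m\<close>, and let \<open>K\<close> be the image of \<open>L\<^sub>p\<close> under the base change of \<open>\<beta>\<close>. As \<open>m\<close> is a unit
  of \<open>\<int>\<^sub>p\<close>, \<open>K\<close> contains \<open>p\<^sup>v L\<^sub>p\<close>, so \<open>L\<close> maps onto \<open>L\<^sub>p / K\<close> by density. The preimage of \<open>K\<close> in \<open>L\<close> is
  \<open>{x. m x \<in> \<beta>(L)}\<close>, whose index is \<open>p\<^sup>v\<close> by \<open>card_rcosets_prime_part\<close>.\<close>

theorem local_index:
  assumes \<beta>: "\<beta> \<in> glob.\<Delta>"
  shows "loc.ind (base_change L p \<beta>) = p ^ multiplicity p (glob.ind \<beta>)"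
proof -
  define v where "v = multiplicity p (glob.ind \<beta>)"
  note G = glob.\<Delta>D(1)[OF \<beta>]
  note pos = ind_pos[OF \<beta>]
  note [simp] = rat_to_Qp_closed[OF p]
  have "\<not> is_unit p" using p not_prime_unit by blast
  then obtain m where m: "glob.ind \<beta> = p ^ v * m" "\<not> p dvd m"
    unfolding v_def using multiplicity_decompose'[of "glob.ind \<beta>" p] pos by auto
  have cop: "coprime p m" using m(2) p by (simp add: prime_imp_coprime)
  have m0: "m > 0" using m(1) pos by (cases m) auto
  let ?K = "base_change L p \<beta> ` \<Lambda>p" and ?q = "of_nat p ^ v :: rat" and ?m = "of_nat m :: rat"
  have q0: "?q \<noteq> 0" and m0': "?m \<noteq> 0" using p m0 by auto
  have bc\<Delta>: "base_change L p \<beta> \<in> loc.\<Delta>" by (rule base_change_\<Delta>[OF \<beta>])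
  have K: "subgroup ?K loc.A" by (rule loc.image_subgroup[OF bc\<Delta>])
  have N: "rat_to_Qp p (of_nat (glob.ind \<beta>)) = rat_to_Qp p ?q \<otimes>\<^bsub>Qp p\<^esub> rat_to_Qp p ?m"
    unfolding m(1) by (simp flip: rat_to_Qp_mult[OF p])
  have qK: "rat_to_Qp p ?q \<odot>\<^bsub>Vp\<^esub> Y \<in> ?K" if Y: "Y \<in> \<Lambda>p" for Y
  proof -
    let ?Y = "rat_to_Qp p (inverse ?m) \<odot>\<^bsub>Vp\<^esub> Y"
    have Y': "?Y \<in> \<Lambda>p" by (rule local_lattice_smult[OF inverse_mem_Zp[OF cop] Y])
    have "rat_to_Qp p (of_nat (glob.ind \<beta>)) \<odot>\<^bsub>Vp\<^esub> ?Y = rat_to_Qp p ?q \<odot>\<^bsub>Vp\<^esub> (rat_to_Qp p ?m \<odot>\<^bsub>Vp\<^esub> ?Y)"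
      unfolding N using Y' by (intro P.V.smult_assoc1) simp_all
    also have "\<dots> = rat_to_Qp p ?q \<odot>\<^bsub>Vp\<^esub> Y" using smult_inverse_Vp[of Y ?m] Y m0' by simp
    finally show ?thesis using local_image_multiples[OF \<beta> Y'] by simp
  qed
  have "card (rcosets\<^bsub>glob.A\<^esub> {x \<in> carrier glob.A. \<iota> x \<in> ?K}) = card (rcosets\<^bsub>loc.A\<^esub> ?K)"
  proof (rule card_rcosets_vimage[OF glob.A.is_group loc.A.is_group _ K])
    show "\<iota> \<in> hom glob.A loc.A"
      using iota_lattice additive_map.add[OF iota_additive] by (auto simp: hom_def)
    fix Y assume "Y \<in> carrier loc.A"
    then have Y: "Y \<in> \<Lambda>p" by simp
    obtain x Z where xZ: "x \<in> \<Lambda>g" "Z \<in> \<Lambda>p" "Y = \<iota> x \<oplus>\<^bsub>Vp\<^esub> rat_to_Qp p ?q \<odot>\<^bsub>Vp\<^esub> Z"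
      using local_lattice_approx[OF Y, of v] by blast
    then have "Y = rat_to_Qp p ?q \<odot>\<^bsub>Vp\<^esub> Z \<otimes>\<^bsub>loc.A\<^esub> \<iota> x"
      by (simp add: P.V.a_comm P.smult_closed)
    then show "\<exists>a\<in>carrier glob.A. \<exists>k\<in>?K. Y = k \<otimes>\<^bsub>loc.A\<^esub> \<iota> a"
      using qK[OF xZ(2)] xZ(1) by (intro bexI[of _ x] bexI[of _ "rat_to_Qp p ?q \<odot>\<^bsub>Vp\<^esub> Z"]) simp_all
  qed
  moreover have "{x \<in> carrier glob.A. \<iota> x \<in> ?K} = {x \<in> carrier glob.A. x [^]\<^bsub>glob.A\<^esub> m \<in> \<beta> ` \<Lambda>g}"
  proof (rule Collect_cong, rule conj_cong[OF refl])
    fix x assume "x \<in> carrier glob.A"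
    then have x: "x \<in> \<Lambda>g" by simp
    then have xV: "x \<in> carrier VQ" by simp
    show "\<iota> x \<in> ?K \<longleftrightarrow> x [^]\<^bsub>glob.A\<^esub> m \<in> \<beta> ` \<Lambda>g"
    proof
      assume "x [^]\<^bsub>glob.A\<^esub> m \<in> \<beta> ` \<Lambda>g"
      then obtain y where y: "y \<in> \<Lambda>g" "?m \<odot>\<^bsub>VQ\<^esub> x = \<beta> y" using xV by (auto simp: glob.A_pow add_pow_VQ)
      have "\<iota> x = rat_to_Qp p (inverse ?m) \<odot>\<^bsub>Vp\<^esub> (rat_to_Qp p ?m \<odot>\<^bsub>Vp\<^esub> \<iota> x)"
        using smult_inverse_Vp[of "\<iota> x" "inverse ?m"] xV m0' by simp
      also have "\<dots> = rat_to_Qp p (inverse ?m) \<odot>\<^bsub>Vp\<^esub> \<iota> (\<beta> y)" using xV y(2) by (simp flip: iota_smult)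
      also have "\<dots> = base_change L p \<beta> (rat_to_Qp p (inverse ?m) \<odot>\<^bsub>Vp\<^esub> \<iota> y)"
        using y(1) by (simp add: base_change_smult[OF G] base_change_iota[OF G])
      finally show "\<iota> x \<in> ?K"
        using local_lattice_smult[OF inverse_mem_Zp[OF cop] iota_lattice[OF y(1)]] by (metis image_eqI)
    next
      assume "\<iota> x \<in> ?K"
      then obtain Y where Y: "Y \<in> \<Lambda>p" "\<iota> x = base_change L p \<beta> Y" by auto
      \<comment> \<open>With \<open>\<iota> x = \<beta>(Y)\<close> and \<open>Y = y + p\<^sup>v Z\<close>, the difference \<open>d = x - \<beta> y\<close> is \<open>p\<^sup>v\<close> times an element \<open>z\<close> of \<open>L\<close>, so that \<open>m d\<close> is the index times \<open>z\<close>.\<close>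
      obtain y Z where yZ: "y \<in> \<Lambda>g" "Z \<in> \<Lambda>p" "Y = \<iota> y \<oplus>\<^bsub>Vp\<^esub> rat_to_Qp p ?q \<odot>\<^bsub>Vp\<^esub> Z"
        using local_lattice_approx[OF Y(1), of v] by blast
      have yV: "y \<in> carrier VQ" and ZV: "Z \<in> carrier Vp" using yZ by simp_all
      let ?Z = "base_change L p \<beta> Z"
      have Z': "?Z \<in> \<Lambda>p" "?Z \<in> carrier Vp" using loc.\<Delta>D(2)[OF bc\<Delta>] yZ(2) by auto
      have ix: "\<iota> x = \<iota> (\<beta> y) \<oplus>\<^bsub>Vp\<^esub> rat_to_Qp p ?q \<odot>\<^bsub>Vp\<^esub> ?Z"
        unfolding Y(2) yZ(3) using yV ZV
        by (simp add: base_change_add[OF G] base_change_smult[OF G] base_change_iota[OF G] P.smult_closed)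
      have \<beta>y: "\<beta> y \<in> \<Lambda>g" using glob.\<Delta>D(2)[OF \<beta>] yZ(1) by auto
      let ?d = "x \<oplus>\<^bsub>VQ\<^esub> (\<ominus>\<^bsub>VQ\<^esub> \<beta> y)"
      have d: "?d \<in> \<Lambda>g" "?d \<in> carrier VQ" using glob.\<Lambda>_add[OF x glob.\<Lambda>_minus[OF \<beta>y]] by simp_all
      have xd: "x = \<beta> y \<oplus>\<^bsub>VQ\<^esub> ?d"
        using xV \<beta>y by (simp add: Q.V.a_lcomm Q.V.r_neg)
      have "\<iota> x = \<iota> (\<beta> y) \<oplus>\<^bsub>Vp\<^esub> \<iota> ?d"
        using additive_map.add[OF iota_additive, of "\<beta> y" ?d] xd \<beta>y d by simp
      then have id: "\<iota> ?d = rat_to_Qp p ?q \<odot>\<^bsub>Vp\<^esub> ?Z"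
        using ix \<beta>y d Z' by (simp add: P.smult_closed)
      define z where "z = inverse ?q \<odot>\<^bsub>VQ\<^esub> ?d"
      have zV: "z \<in> carrier VQ" unfolding z_def using d by (simp add: Q.smult_closed)
      have "\<iota> z = rat_to_Qp p (inverse ?q) \<odot>\<^bsub>Vp\<^esub> (rat_to_Qp p ?q \<odot>\<^bsub>Vp\<^esub> ?Z)"
        unfolding z_def iota_smult[OF d(2)] id by simp
      also have "\<dots> = ?Z" using smult_inverse_Vp[of ?Z "inverse ?q"] Z' q0 by simp
      finally have "\<iota> z \<in> \<Lambda>p" using Z' by simp
      moreover have qz: "?q \<odot>\<^bsub>VQ\<^esub> z = ?d" unfolding z_def by (rule smult_inverse_VQ[OF d(2) q0])
      ultimately have z: "z \<in> \<Lambda>g" using lattice_saturated[OF zV, of v] d(1) by simp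
      have "[glob.ind \<beta>] \<cdot>\<^bsub>VQ\<^esub> z \<in> \<beta> ` \<Lambda>g"
        using glob.level_add_pow[of \<beta> "glob.ind \<beta>" z] pos \<beta> z by (simp add: glob.level_def)
      moreover have "[glob.ind \<beta>] \<cdot>\<^bsub>VQ\<^esub> z = [m] \<cdot>\<^bsub>VQ\<^esub> ?d"
      proof -
        have "[glob.ind \<beta>] \<cdot>\<^bsub>VQ\<^esub> z = (?m * ?q) \<odot>\<^bsub>VQ\<^esub> z" using zV m(1) by (simp add: add_pow_VQ mult.commute)
        also have "\<dots> = ?m \<odot>\<^bsub>VQ\<^esub> (?q \<odot>\<^bsub>VQ\<^esub> z)" using Q.V.smult_assoc1[of ?m ?q z] zV by simp
        finally show ?thesis using d(2) by (simp add: qz add_pow_VQ)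
      qed
      ultimately have md: "[m] \<cdot>\<^bsub>VQ\<^esub> ?d \<in> \<beta> ` \<Lambda>g" by simp
      have mb: "[m] \<cdot>\<^bsub>VQ\<^esub> \<beta> y \<in> \<beta> ` \<Lambda>g"
        using glob.Aut_add_pow[OF G yV, of m] glob.\<Lambda>_add_pow_nat[OF yZ(1), of m] by (metis image_eqI)
      have "[m] \<cdot>\<^bsub>VQ\<^esub> (\<beta> y \<oplus>\<^bsub>VQ\<^esub> ?d) = ([m] \<cdot>\<^bsub>VQ\<^esub> \<beta> y) \<oplus>\<^bsub>VQ\<^esub> ([m] \<cdot>\<^bsub>VQ\<^esub> ?d)"
        using \<beta>y d by (intro Q.V.add.nat_pow_distrib) simp_all
      then have "[m] \<cdot>\<^bsub>VQ\<^esub> x \<in> \<beta> ` \<Lambda>g"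
        using subgroup.m_closed[OF glob.image_subgroup[OF \<beta>] mb md] xd by simp
      then show "x [^]\<^bsub>glob.A\<^esub> m \<in> \<beta> ` \<Lambda>g" by (simp add: glob.A_pow)
    qed
  qed
  moreover have "card (rcosets\<^bsub>glob.A\<^esub> {x \<in> carrier glob.A. x [^]\<^bsub>glob.A\<^esub> m \<in> \<beta> ` \<Lambda>g}) = p ^ v"
    using m(1) by (intro glob.A.card_rcosets_prime_part[OF p glob.image_subgroup[OF \<beta>] _ cop m0])
      (simp add: glob.ind_eq)
  ultimately show ?thesis by (simp add: loc.ind_eq v_def)
qed

end

section \<open>The adelic comparison and the Euler product\<close>

context based_algebra_prime
begin

lemma group_with_subgroup_loc: "group_with_subgroup (G_loc L p) (\<Gamma>_loc L p)"
  unfolding local_eqs by (rule loc.G.group_with_subgroup_axioms)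

lemma \<Gamma>_loc_subset: "\<Gamma>_loc L p \<subseteq> \<Delta>_loc L p" "\<Delta>_loc L p \<subseteq> carrier (G_loc L p)"
  unfolding local_eqs using loc.\<Gamma>_subset_\<Delta> loc.\<Delta>D(1) by auto

lemma \<Delta>_loc_mult:
  "\<alpha> \<in> \<Delta>_loc L p \<Longrightarrow> \<beta> \<in> \<Delta>_loc L p \<Longrightarrow> \<alpha> \<otimes>\<^bsub>G_loc L p\<^esub> \<beta> \<in> \<Delta>_loc L p"
  unfolding local_eqs by (rule loc.\<Delta>_mult)

lemma index_loc_mult_left:
  assumes "\<gamma> \<in> \<Gamma>_loc L p" "\<alpha> \<in> \<Delta>_loc L p"
  shows "index_loc L p (\<gamma> \<otimes>\<^bsub>G_loc L p\<^esub> \<alpha>) = index_loc L p \<alpha>"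
proof -
  have "\<gamma> \<in> loc.\<Delta>" "loc.ind \<gamma> = 1"
    using assms(1) loc.\<Gamma>_subset_\<Delta> loc.ind_eq_1_iff unfolding local_eqs by auto
  then show ?thesis using assms(2) unfolding local_eqs by (simp add: loc.ind_mult)
qed

lemma index_loc_eq_1_iff: "\<alpha> \<in> \<Delta>_loc L p \<Longrightarrow> index_loc L p \<alpha> = 1 \<longleftrightarrow> \<alpha> \<in> \<Gamma>_loc L p"
  unfolding local_eqs by (rule loc.ind_eq_1_iff)

lemma bi_invariant_level_loc:
  "bi_invariant (G_loc L p) (\<Gamma>_loc L p) {\<alpha> \<in> \<Delta>_loc L p. index_loc L p \<alpha> = n}"
  unfolding local_eqs using loc.bi_invariant_level[of n] by (simp add: loc.level_def)

lemma base_change_hom_loc: "group_hom (G_glob L) (G_loc L p) (base_change L p)"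
  unfolding local_eqs global_eqs by (rule base_change_hom)

lemma base_change_\<Delta>_loc: "\<beta> \<in> \<Delta>_glob L \<Longrightarrow> base_change L p \<beta> \<in> \<Delta>_loc L p"
  unfolding local_eqs global_eqs by (rule base_change_\<Delta>)

lemma base_change_\<Gamma>_loc: "\<beta> \<in> \<Gamma>_glob L \<Longrightarrow> base_change L p \<beta> \<in> \<Gamma>_loc L p"
  unfolding local_eqs global_eqs by (rule base_change_\<Gamma>)

lemma index_loc_base_change:
  "\<beta> \<in> \<Delta>_glob L \<Longrightarrow> index_loc L p (base_change L p \<beta>) = p ^ multiplicity p (index_glob L \<beta>)"
  unfolding local_eqs global_eqs by (rule local_index)

lemma base_change_\<Gamma>_iff:
  assumes "\<beta> \<in> \<Delta>_glob L"
  shows "base_change L p \<beta> \<in> \<Gamma>_loc L p \<longleftrightarrow> multiplicity p (index_glob L \<beta>) = 0"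
  using index_loc_eq_1_iff[OF base_change_\<Delta>_loc[OF assms]] index_loc_base_change[OF assms]
    prime_gt_1_nat[OF p] by (metis nat_power_eq_Suc_0_iff One_nat_def less_irrefl power_0)

end

lemma hat_mult:
  "(a \<otimes>\<^bsub>G_hat L\<^esub> b) = (\<lambda>p\<in>primes. a p \<otimes>\<^bsub>G_loc L p\<^esub> b p)"
  by (simp add: G_hat_def)

text \<open>The name comes from the analogous statement for a number field: the nonzero integers of the field represent all
  integral ideles modulo unit ideles exactly when every ideal is principal.\<close>

locale class_number_one = based_algebra L r e c for L :: "('a, 'm) ring_scheme" and r e c +
  assumes surj: "\<eta>_lower L ` left_quotient (G_glob L) (\<Gamma>_glob L) (\<Delta>_glob L)
      = left_quotient (G_hat L) (\<Gamma>_hat L) (\<Delta>_hat L)"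
begin

lemma prime_locale: "prime p \<Longrightarrow> based_algebra_prime L r e c p"
  by unfold_locales

lemmas loc_group = based_algebra_prime.group_with_subgroup_loc[OF prime_locale]
lemmas loc_subset = based_algebra_prime.\<Gamma>_loc_subset[OF prime_locale]
lemmas bc_hom = based_algebra_prime.base_change_hom_loc[OF prime_locale]
lemmas bc_\<Delta> = based_algebra_prime.base_change_\<Delta>_loc[OF prime_locale]
lemmas bc_\<Gamma> = based_algebra_prime.base_change_\<Gamma>_loc[OF prime_locale]
lemmas bc_index = based_algebra_prime.index_loc_base_change[OF prime_locale]
lemmas bc_\<Gamma>_iff = based_algebra_prime.base_change_\<Gamma>_iff[OF prime_locale]

lemma loc_one_mem: "prime p \<Longrightarrow> \<one>\<^bsub>G_loc L p\<^esub> \<in> \<Gamma>_loc L p"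
  using group_with_subgroup.axioms(2)[OF loc_group] by (rule subgroup.one_closed)

text \<open>Surjectivity of \<^const>\<open>\<eta>_lower\<close>, read off in each component.\<close>

lemma adelic_approximation:
  assumes b: "b \<in> \<Delta>_hat L"
  shows "\<exists>\<beta>\<in>\<Delta>_glob L. \<forall>p. prime p \<longrightarrow> (\<exists>\<gamma>\<in>\<Gamma>_loc L p. base_change L p \<beta> = \<gamma> \<otimes>\<^bsub>G_loc L p\<^esub> b p)"
proof -
  have "\<Gamma>_hat L #>\<^bsub>G_hat L\<^esub> b \<in> \<eta>_lower L ` left_quotient (G_glob L) (\<Gamma>_glob L) (\<Delta>_glob L)"
    unfolding surj using b by (simp add: left_quotient_def)
  then obtain \<beta> where \<beta>: "\<beta> \<in> \<Delta>_glob L"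
    "\<eta>_lower L (\<Gamma>_glob L #>\<^bsub>G_glob L\<^esub> \<beta>) = \<Gamma>_hat L #>\<^bsub>G_hat L\<^esub> b"
    by (auto simp: left_quotient_def)
  have "\<beta> \<in> \<Gamma>_glob L #>\<^bsub>G_glob L\<^esub> \<beta>"
    using \<beta>(1) glob.G.rcos_self[OF glob.\<Delta>D(1) glob.\<Gamma>_subgroup] by (simp add: global_eqs)
  then have sub: "\<Gamma>_hat L #>\<^bsub>G_hat L\<^esub> \<eta> L \<beta> \<subseteq> \<Gamma>_hat L #>\<^bsub>G_hat L\<^esub> b"
    using \<beta>(2) unfolding \<eta>_lower_def by blast
  \<comment> \<open>The identity of the adelic group, which exhibits \<open>\<eta> L \<beta>\<close> as an element of its own coset.\<close>
  define u where "u = (\<lambda>p\<in>primes. \<one>\<^bsub>G_loc L p\<^esub>)"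
  have "u \<in> \<Gamma>_hat L" unfolding u_def \<Gamma>_hat_def using loc_one_mem by auto
  then have "u \<otimes>\<^bsub>G_hat L\<^esub> \<eta> L \<beta> \<in> \<Gamma>_hat L #>\<^bsub>G_hat L\<^esub> \<eta> L \<beta>" by (auto simp: r_coset_def)
  then obtain g where g: "g \<in> \<Gamma>_hat L" "u \<otimes>\<^bsub>G_hat L\<^esub> \<eta> L \<beta> = g \<otimes>\<^bsub>G_hat L\<^esub> b"
    using sub by (auto simp: r_coset_def)
  have "base_change L p \<beta> = g p \<otimes>\<^bsub>G_loc L p\<^esub> b p" if p: "prime p" for p
  proof -
    interpret group_with_subgroup "G_loc L p" "\<Gamma>_loc L p" by (rule loc_group[OF p])
    have "(u \<otimes>\<^bsub>G_hat L\<^esub> \<eta> L \<beta>) p = (g \<otimes>\<^bsub>G_hat L\<^esub> b) p" using g(2) by simp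
    then show ?thesis
      using p bc_\<Delta>[OF p \<beta>(1)] loc_subset[OF p] by (auto simp: hat_mult u_def \<eta>_def)
  qed
  then show ?thesis using \<beta>(1) g(1) by (intro bexI[of _ \<beta>]) (auto simp: \<Gamma>_hat_def)
qed

lemma \<Delta>_hatI:
  assumes "b \<in> extensional primes" "\<And>p. prime p \<Longrightarrow> b p \<in> \<Delta>_loc L p"
    and "finite P" "\<And>p. prime p \<Longrightarrow> p \<notin> P \<Longrightarrow> b p = \<one>\<^bsub>G_loc L p\<^esub>"
  shows "b \<in> \<Delta>_hat L"
proof -
  have "p \<in> P" if "prime p" "b p \<notin> \<Gamma>_loc L p" for p
    using assms(4)[OF that(1)] loc_one_mem[OF that(1)] that(2) by metis
  then have "{p \<in> primes. b p \<notin> \<Gamma>_loc L p} \<subseteq> P" by auto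
  then have "finite {p \<in> primes. b p \<notin> \<Gamma>_loc L p}" using assms(3) by (rule finite_subset)
  then show ?thesis
    using assms(1,2) loc_subset(2) by (auto simp: \<Delta>_hat_def G_hat_def PiE_def)
qed

lemma index_glob_pos: "\<beta> \<in> \<Delta>_glob L \<Longrightarrow> index_glob L \<beta> > 0"
  unfolding global_eqs by (rule ind_pos)

lemma index_glob_eqI:
  assumes \<beta>: "\<beta> \<in> \<Delta>_glob L" and n: "n > 0"
    and "\<And>p. prime p \<Longrightarrow> index_loc L p (base_change L p \<beta>) = p ^ multiplicity p n"
  shows "index_glob L \<beta> = n"
proof (rule multiplicity_eq_nat[OF index_glob_pos[OF \<beta>] n])
  fix p :: nat assume p: "prime p"
  have "p ^ multiplicity p (index_glob L \<beta>) = p ^ multiplicity p n"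
    using assms(3)[OF p] bc_index[OF p \<beta>] by simp
  then show "multiplicity p (index_glob L \<beta>) = multiplicity p n"
    using prime_gt_1_nat[OF p] by (simp add: power_inject_exp)
qed

text \<open>Let \<open>\<beta>\<close> agree, modulo \<open>\<Gamma>_loc\<close> on the left, with \<open>\<alpha>\<close> at the primes dividing \<open>n\<close> and with 1 elsewhere. Its local
  indices are the \<open>p\<close>-parts of \<open>m n\<close> at primes dividing \<open>n\<close> and 1 elsewhere, so by coprimality its index is \<open>n\<close>.
  At primes dividing \<open>n\<close> the quotient \<open>\<alpha>\<beta>\<^sup>-\<^sup>1\<close> is in \<open>\<Gamma>_loc\<close>, and at the others it differs from \<open>\<alpha>\<close> by an element
  of \<open>\<Gamma>_loc\<close>, so it preserves every local lattice.\<close>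

lemma divisor_of_coprime_index:
  assumes mn: "m > 0" "n > 0" "coprime m n" and \<alpha>: "\<alpha> \<in> glob.level (m * n)"
  shows "\<exists>b\<in>glob.level n. \<alpha> \<otimes>\<^bsub>glob.G\<^esub> inv\<^bsub>glob.G\<^esub> b \<in> glob.\<Delta>"
proof -
  have \<alpha>\<Delta>: "\<alpha> \<in> \<Delta>_glob L" and cind: "index_glob L \<alpha> = m * n"
    using \<alpha> by (auto simp: glob.level_def global_eqs)
  define b where "b = (\<lambda>p\<in>primes. if p dvd n then base_change L p \<alpha> else \<one>\<^bsub>G_loc L p\<^esub>)"
  have "b \<in> \<Delta>_hat L"
  proof (rule \<Delta>_hatI)
    show "b p \<in> \<Delta>_loc L p" if "prime p" for p
      using that bc_\<Delta>[OF that \<alpha>\<Delta>] loc_one_mem[OF that] loc_subset(1)[OF that] by (auto simp: b_def)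
    show "finite {p. p dvd n}" using mn(2) by simp
  qed (auto simp: b_def)
  then obtain \<beta> where \<beta>: "\<beta> \<in> \<Delta>_glob L"
    and \<beta>b: "\<And>p. prime p \<Longrightarrow> \<exists>\<gamma>\<in>\<Gamma>_loc L p. base_change L p \<beta> = \<gamma> \<otimes>\<^bsub>G_loc L p\<^esub> b p"
    using adelic_approximation[of b] by blast
  have "index_glob L \<beta> = n"
  proof (rule index_glob_eqI[OF \<beta> mn(2)])
    fix p :: nat assume p: "prime p"
    interpret based_algebra_prime L r e c p by (rule prime_locale[OF p])
    obtain \<gamma> where \<gamma>: "\<gamma> \<in> \<Gamma>_loc L p" "base_change L p \<beta> = \<gamma> \<otimes>\<^bsub>G_loc L p\<^esub> b p" using \<beta>b[OF p] by auto
    have "b p \<in> \<Delta>_loc L p"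
      using p bc_\<Delta>[OF p \<alpha>\<Delta>] loc_one_mem[OF p] loc_subset(1)[OF p] by (auto simp: b_def)
    then have "index_loc L p (base_change L p \<beta>) = index_loc L p (b p)"
      unfolding \<gamma>(2) by (rule index_loc_mult_left[OF \<gamma>(1)])
    also have "\<dots> = p ^ multiplicity p n"
    proof (cases "p dvd n")
      case True
      then have "\<not> p dvd m" using mn(3) p by (metis coprime_common_divisor not_prime_unit)
      then have "multiplicity p (m * n) = multiplicity p n"
        using mn p by (simp add: prime_elem_multiplicity_mult_distrib not_dvd_imp_multiplicity_0)
      then show ?thesis using True p bc_index[OF p \<alpha>\<Delta>] cind by (simp add: b_def)
    next
      case False
      then show ?thesis
        using p index_loc_eq_1_iff[of "\<one>\<^bsub>G_loc L p\<^esub>"] loc_one_mem[OF p] loc_subset(1)[OF p]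
        by (auto simp: b_def not_dvd_imp_multiplicity_0)
    qed
    finally show "index_loc L p (base_change L p \<beta>) = p ^ multiplicity p n" .
  qed
  then have \<beta>n: "\<beta> \<in> glob.level n" using \<beta> by (simp add: glob.level_def global_eqs)
  have G: "\<alpha> \<in> carrier (G_glob L)" "\<beta> \<in> carrier (G_glob L)"
    using \<alpha>\<Delta> \<beta> glob.\<Delta>D(1) by (auto simp: global_eqs)
  have "\<alpha> \<otimes>\<^bsub>glob.G\<^esub> inv\<^bsub>glob.G\<^esub> \<beta> \<in> glob.\<Delta>"
  proof (rule \<Delta>_local_global)
    show "\<alpha> \<otimes>\<^bsub>glob.G\<^esub> inv\<^bsub>glob.G\<^esub> \<beta> \<in> carrier glob.G" using G by (simp add: global_eqs)
    fix p :: nat assume p: "prime p"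
    interpret based_algebra_prime L r e c p by (rule prime_locale[OF p])
    interpret l: group_with_subgroup "G_loc L p" "\<Gamma>_loc L p" by (rule loc_group[OF p])
    interpret h: group_hom "G_glob L" "G_loc L p" "base_change L p" by (rule bc_hom[OF p])
    obtain \<gamma> where \<gamma>: "\<gamma> \<in> \<Gamma>_loc L p" "base_change L p \<beta> = \<gamma> \<otimes>\<^bsub>G_loc L p\<^esub> b p" using \<beta>b[OF p] by auto
    have \<gamma>\<alpha>: "\<gamma> \<in> carrier (G_loc L p)" "inv\<^bsub>G_loc L p\<^esub> \<gamma> \<in> \<Delta>_loc L p"
      using \<gamma>(1) l.m_inv_closed[OF \<gamma>(1)] loc_subset(1)[OF p] by auto
    let ?a = "base_change L p \<alpha>"
    have cp: "?a \<in> carrier (G_loc L p)" "?a \<in> \<Delta>_loc L p"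
      using bc_\<Delta>[OF p \<alpha>\<Delta>] loc_subset(2)[OF p] by auto
    have "base_change L p (\<alpha> \<otimes>\<^bsub>G_glob L\<^esub> inv\<^bsub>G_glob L\<^esub> \<beta>) = ?a \<otimes>\<^bsub>G_loc L p\<^esub> inv\<^bsub>G_loc L p\<^esub> (\<gamma> \<otimes>\<^bsub>G_loc L p\<^esub> b p)"
      using G \<gamma>(2) by simp
    also have "\<dots> \<in> \<Delta>_loc L p"
    proof (cases "p dvd n")
      case True
      then have "b p = ?a" using p by (simp add: b_def)
      then have "?a \<otimes>\<^bsub>G_loc L p\<^esub> inv\<^bsub>G_loc L p\<^esub> (\<gamma> \<otimes>\<^bsub>G_loc L p\<^esub> b p) = inv\<^bsub>G_loc L p\<^esub> \<gamma>"
        using cp(1) \<gamma>\<alpha>(1) by (simp add: l.inv_mult_group flip: l.m_assoc)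
      then show ?thesis using \<gamma>\<alpha>(2) by simp
    next
      case False
      then have "b p = \<one>\<^bsub>G_loc L p\<^esub>" using p by (simp add: b_def)
      then show ?thesis using \<gamma>\<alpha> cp(2) \<Delta>_loc_mult by simp
    qed
    finally show "base_change L p (\<alpha> \<otimes>\<^bsub>glob.G\<^esub> inv\<^bsub>glob.G\<^esub> \<beta>) \<in> \<Delta>_loc L p" by (simp add: global_eqs)
  qed
  then show ?thesis using \<beta>n by blast
qed

lemma T_glob_eq: "T_glob L n = hecke_sum glob.G glob.\<Gamma> (glob.level n)"
  by (simp add: T_glob_def global_eqs glob.level_def)

lemma R_glob_eq: "R_glob L = hecke_ring glob.G glob.\<Gamma> glob.\<Delta>"
  by (simp add: R_glob_def global_eqs)

lemma T_glob_mult: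
  assumes "m > 0" "n > 0" "coprime m n"
  shows "T_glob L m \<otimes>\<^bsub>R_glob L\<^esub> T_glob L n = T_glob L (m * n)"
  unfolding T_glob_eq R_glob_eq
  by (rule glob.hecke_sum_level_mult[OF assms finite_rcosets_multiples divisor_of_coprime_index[OF assms]])

lemma T_glob_1: "T_glob L 1 = \<one>\<^bsub>R_glob L\<^esub>"
  unfolding T_glob_eq R_glob_eq glob.level_1 glob.G.hecke_sum_subgroup by (simp add: hecke_ring_def)

text \<open>Double cosets in the restricted product are computed component by component, and the component of
  \<^const>\<open>at_prime\<close> at a prime other than \<open>p\<close> is 1.\<close>

lemma mem_hat_dcoset_iff:
  assumes p: "prime p" and X: "bi_invariant (G_loc L p) (\<Gamma>_loc L p) X" and \<beta>: "\<beta> \<in> \<Delta>_glob L"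
  shows "\<eta> L \<beta> \<in> (\<Union>\<alpha>\<in>X. dcoset (G_hat L) (\<Gamma>_hat L) (at_prime L p \<alpha>)) \<longleftrightarrow>
    base_change L p \<beta> \<in> X \<and> (\<forall>q. prime q \<longrightarrow> q \<noteq> p \<longrightarrow> base_change L q \<beta> \<in> \<Gamma>_loc L q)"
proof
  assume "\<eta> L \<beta> \<in> (\<Union>\<alpha>\<in>X. dcoset (G_hat L) (\<Gamma>_hat L) (at_prime L p \<alpha>))"
  then obtain \<alpha> g d where *: "\<alpha> \<in> X" "g \<in> \<Gamma>_hat L" "d \<in> \<Gamma>_hat L"
    "\<eta> L \<beta> = g \<otimes>\<^bsub>G_hat L\<^esub> at_prime L p \<alpha> \<otimes>\<^bsub>G_hat L\<^esub> d"
    by (auto simp: mem_dcoset_iff)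
  have comp: "base_change L q \<beta> = g q \<otimes>\<^bsub>G_loc L q\<^esub> at_prime L p \<alpha> q \<otimes>\<^bsub>G_loc L q\<^esub> d q" if "prime q" for q
    using fun_cong[OF *(4), of q] that by (simp add: hat_mult \<eta>_def)
  have gd: "g q \<in> \<Gamma>_loc L q" "d q \<in> \<Gamma>_loc L q" if "prime q" for q
    using *(2,3) that by (auto simp: \<Gamma>_hat_def)
  have "base_change L p \<beta> \<in> X"
    using comp[OF p] bi_invariantD(2)[OF X *(1) gd[OF p]] p by (simp add: at_prime_def)
  moreover have "base_change L q \<beta> \<in> \<Gamma>_loc L q" if q: "prime q" "q \<noteq> p" for q
  proof -
    interpret l: group_with_subgroup "G_loc L q" "\<Gamma>_loc L q" by (rule loc_group[OF q(1)])
    show ?thesis using comp[OF q(1)] gd[OF q(1)] q by (simp add: at_prime_def)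
  qed
  ultimately show "base_change L p \<beta> \<in> X \<and> (\<forall>q. prime q \<longrightarrow> q \<noteq> p \<longrightarrow> base_change L q \<beta> \<in> \<Gamma>_loc L q)"
    by blast
next
  assume *: "base_change L p \<beta> \<in> X \<and> (\<forall>q. prime q \<longrightarrow> q \<noteq> p \<longrightarrow> base_change L q \<beta> \<in> \<Gamma>_loc L q)"
  define u where "u = (\<lambda>q\<in>primes. \<one>\<^bsub>G_loc L q\<^esub>)"
  interpret lp: group_with_subgroup "G_loc L p" "\<Gamma>_loc L p" by (rule loc_group[OF p])
  define g where "g = (\<lambda>q\<in>primes. if q = p then \<one>\<^bsub>G_loc L q\<^esub> else base_change L q \<beta>)"
  have "\<eta> L \<beta> = g \<otimes>\<^bsub>G_hat L\<^esub> at_prime L p (base_change L p \<beta>) \<otimes>\<^bsub>G_hat L\<^esub> u"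
  proof
    fix q
    show "\<eta> L \<beta> q = (g \<otimes>\<^bsub>G_hat L\<^esub> at_prime L p (base_change L p \<beta>) \<otimes>\<^bsub>G_hat L\<^esub> u) q"
    proof (cases "prime q")
      case True
      interpret l: group_with_subgroup "G_loc L q" "\<Gamma>_loc L q" by (rule loc_group[OF True])
      have "base_change L q \<beta> \<in> carrier (G_loc L q)" using bc_\<Delta>[OF True \<beta>] loc_subset(2)[OF True] by auto
      then show ?thesis using True by (auto simp: hat_mult \<eta>_def g_def u_def at_prime_def)
    qed (simp add: hat_mult \<eta>_def)
  qed
  moreover have "u \<in> \<Gamma>_hat L" "g \<in> \<Gamma>_hat L"
    using * loc_one_mem by (auto simp: u_def g_def \<Gamma>_hat_def)
  ultimately show "\<eta> L \<beta> \<in> (\<Union>\<alpha>\<in>X. dcoset (G_hat L) (\<Gamma>_hat L) (at_prime L p \<alpha>))"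
    using * by (auto simp: mem_dcoset_iff)
qed

lemma index_prime_power_iff:
  assumes p: "prime p" and \<beta>: "\<beta> \<in> \<Delta>_glob L"
  shows "index_glob L \<beta> = p ^ k \<longleftrightarrow>
    index_loc L p (base_change L p \<beta>) = p ^ k \<and> (\<forall>q. prime q \<longrightarrow> q \<noteq> p \<longrightarrow> base_change L q \<beta> \<in> \<Gamma>_loc L q)"
proof
  assume i: "index_glob L \<beta> = p ^ k"
  have "base_change L q \<beta> \<in> \<Gamma>_loc L q" if q: "prime q" "q \<noteq> p" for q
    using bc_\<Gamma>_iff[OF q(1) \<beta>] i p q by (simp add: multiplicity_distinct_prime_power)
  then show "index_loc L p (base_change L p \<beta>) = p ^ k \<and> (\<forall>q. prime q \<longrightarrow> q \<noteq> p \<longrightarrow> base_change L q \<beta> \<in> \<Gamma>_loc L q)"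
    using bc_index[OF p \<beta>] i p by simp
next
  assume *: "index_loc L p (base_change L p \<beta>) = p ^ k \<and> (\<forall>q. prime q \<longrightarrow> q \<noteq> p \<longrightarrow> base_change L q \<beta> \<in> \<Gamma>_loc L q)"
  show "index_glob L \<beta> = p ^ k"
  proof (rule index_glob_eqI[OF \<beta>])
    show "p ^ k > 0" using prime_gt_0_nat[OF p] by simp
    fix q :: nat assume q: "prime q"
    show "index_loc L q (base_change L q \<beta>) = q ^ multiplicity q (p ^ k)"
    proof (cases "q = p")
      case True
      then show ?thesis using * p by simp
    next
      case False
      then have "multiplicity q (index_glob L \<beta>) = 0" using * bc_\<Gamma>_iff[OF q \<beta>] q by simp
      then show ?thesis
        using False p q bc_index[OF q \<beta>] by (simp add: multiplicity_distinct_prime_power)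
    qed
  qed
qed

lemma level_left_quotient_finite: "n > 0 \<Longrightarrow> finite (left_quotient glob.G glob.\<Gamma> (glob.level n))"
  by (rule glob.finite_left_quotient_level[OF _ finite_rcosets_multiples])

text \<open>The map sends the local double coset \<open>X\<close> to the sum of the double cosets in \<open>B X\<close>, the set of global elements whose
  component at \<open>p\<close> is in \<open>X\<close> and whose other components are in \<open>\<Gamma>_loc\<close>. By \<open>index_prime_power_iff\<close> these
  sets partition the global elements of index \<open>p\<^sup>k\<close>. Finiteness of the set of local double cosets, without which the
  sum defining \<^const>\<open>T_loc\<close> would be 0, is inherited from the global one: by \<open>adelic_approximation\<close> each of them
  meets the image of a global element of index \<open>p\<^sup>k\<close>.\<close>

theorem loc_to_glob_T_loc:
  assumes p: "prime p"
  shows "loc_to_glob L p (T_loc L p (p ^ k)) = T_glob L (p ^ k)"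
proof -
  interpret based_algebra_prime L r e c p by (rule prime_locale[OF p])
  interpret l: group_with_subgroup "G_loc L p" "\<Gamma>_loc L p" by (rule loc_group[OF p])
  interpret h: group_hom "G_glob L" "G_loc L p" "base_change L p" by (rule bc_hom[OF p])
  let ?A = "{\<alpha> \<in> \<Delta>_loc L p. index_loc L p \<alpha> = p ^ k}"
  let ?D = "dcosets (G_loc L p) (\<Gamma>_loc L p) ?A"
  let ?hat = "\<lambda>X. \<Union>\<alpha>\<in>X. dcoset (G_hat L) (\<Gamma>_hat L) (at_prime L p \<alpha>)"
  let ?B = "\<lambda>X. {\<beta> \<in> \<Delta>_glob L. \<eta> L \<beta> \<in> ?hat X}"
  have pk: "p ^ k > 0" using prime_gt_0_nat[OF p] by simp
  have A: "bi_invariant (G_loc L p) (\<Gamma>_loc L p) ?A" by (rule bi_invariant_level_loc)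
  have X: "bi_invariant (G_loc L p) (\<Gamma>_loc L p) X" if "X \<in> ?D" for X
    using that l.dcoset_bi_invariant bi_invariantD(1)[OF A] unfolding dcosets_def by blast
  have finC: "finite (left_quotient glob.G glob.\<Gamma> (glob.level (p ^ k)))"
    by (rule level_left_quotient_finite[OF pk])
  have Bmem: "\<beta> \<in> ?B X \<longleftrightarrow> \<beta> \<in> \<Delta>_glob L \<and> base_change L p \<beta> \<in> X \<and>
      (\<forall>q. prime q \<longrightarrow> q \<noteq> p \<longrightarrow> base_change L q \<beta> \<in> \<Gamma>_loc L q)" if "X \<in> ?D" for X \<beta>
    using mem_hat_dcoset_iff[OF p X[OF that], of \<beta>] by blast
  have level: "(\<Union>X\<in>?D. ?B X) = glob.level (p ^ k)"
  proof (intro equalityI subsetI)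
    fix \<beta> assume "\<beta> \<in> (\<Union>X\<in>?D. ?B X)"
    then obtain Y where Y: "Y \<in> ?D" "\<beta> \<in> ?B Y" by blast
    then have "base_change L p \<beta> \<in> ?A" using Bmem[OF Y(1)] l.Union_dcosets[OF A] by blast
    then have "index_glob L \<beta> = p ^ k" using Bmem[OF Y(1)] Y(2) index_prime_power_iff[OF p, of \<beta> k] by simp
    then show "\<beta> \<in> glob.level (p ^ k)" using Y(2) by (simp add: glob.level_def global_eqs)
  next
    fix \<beta> assume "\<beta> \<in> glob.level (p ^ k)"
    then have \<beta>: "\<beta> \<in> \<Delta>_glob L" "index_glob L \<beta> = p ^ k" by (simp_all add: glob.level_def global_eqs)
    then have i: "index_loc L p (base_change L p \<beta>) = p ^ k"
      "\<forall>q. prime q \<longrightarrow> q \<noteq> p \<longrightarrow> base_change L q \<beta> \<in> \<Gamma>_loc L q"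
      using index_prime_power_iff[OF p \<beta>(1)] by simp_all
    then have "base_change L p \<beta> \<in> ?A" using bc_\<Delta>[OF p \<beta>(1)] by simp
    then obtain Y where Y: "Y \<in> ?D" "base_change L p \<beta> \<in> Y" using l.Union_dcosets[OF A] by blast
    have "\<beta> \<in> ?B Y" unfolding Bmem[OF Y(1)] using \<beta>(1) Y(2) i(2) by simp
    with Y(1) show "\<beta> \<in> (\<Union>X\<in>?D. ?B X)" by (rule UN_I)
  qed
  have finD: "finite ?D"
  proof -
    have "?D \<subseteq> (\<lambda>\<beta>. dcoset (G_loc L p) (\<Gamma>_loc L p) (base_change L p \<beta>)) ` glob.level (p ^ k)"
    proof
      fix Y assume "Y \<in> ?D"
      then obtain \<alpha> where \<alpha>: "\<alpha> \<in> ?A" "Y = dcoset (G_loc L p) (\<Gamma>_loc L p) \<alpha>" by (auto simp: dcosets_def)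
      have "at_prime L p \<alpha> \<in> \<Delta>_hat L"
      proof (rule \<Delta>_hatI)
        show "at_prime L p \<alpha> q \<in> \<Delta>_loc L q" if "prime q" for q
          using that \<alpha>(1) loc_one_mem[OF that] loc_subset(1)[OF that] by (auto simp: at_prime_def)
        show "finite {p}" by simp
      qed (auto simp: at_prime_def)
      then obtain \<beta> where \<beta>: "\<beta> \<in> \<Delta>_glob L"
        and \<beta>a: "\<And>q. prime q \<Longrightarrow> \<exists>\<gamma>\<in>\<Gamma>_loc L q. base_change L q \<beta> = \<gamma> \<otimes>\<^bsub>G_loc L q\<^esub> at_prime L p \<alpha> q"
        using adelic_approximation by blast
      obtain \<gamma> where \<gamma>: "\<gamma> \<in> \<Gamma>_loc L p" "base_change L p \<beta> = \<gamma> \<otimes>\<^bsub>G_loc L p\<^esub> \<alpha>"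
        using \<beta>a[OF p] p by (auto simp: at_prime_def)
      have "base_change L q \<beta> \<in> \<Gamma>_loc L q" if q: "prime q" "q \<noteq> p" for q
      proof -
        interpret lq: group_with_subgroup "G_loc L q" "\<Gamma>_loc L q" by (rule loc_group[OF q(1)])
        show ?thesis using \<beta>a[OF q(1)] q by (auto simp: at_prime_def)
      qed
      then have "index_glob L \<beta> = p ^ k"
        using index_prime_power_iff[OF p \<beta>, of k] index_loc_mult_left[OF \<gamma>(1), of \<alpha>] \<alpha>(1) \<gamma>(2) by simp
      then have "\<beta> \<in> glob.level (p ^ k)" using \<beta> by (simp add: glob.level_def global_eqs)
      moreover have "Y = dcoset (G_loc L p) (\<Gamma>_loc L p) (base_change L p \<beta>)"
      proof -
        have \<alpha>c: "\<alpha> \<in> carrier (G_loc L p)" using bi_invariantD(1)[OF A \<alpha>(1)] .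
        have "base_change L p \<beta> = \<gamma> \<otimes>\<^bsub>G_loc L p\<^esub> \<alpha> \<otimes>\<^bsub>G_loc L p\<^esub> \<one>\<^bsub>G_loc L p\<^esub>"
          using \<gamma> \<alpha>c by simp
        then have "base_change L p \<beta> \<in> dcoset (G_loc L p) (\<Gamma>_loc L p) \<alpha>"
          unfolding mem_dcoset_iff using \<gamma>(1) l.one_closed by blast
        then show ?thesis using l.dcoset_eq[OF \<alpha>c] \<alpha>(2) by simp
      qed
      ultimately show "Y \<in> (\<lambda>\<beta>. dcoset (G_loc L p) (\<Gamma>_loc L p) (base_change L p \<beta>)) ` glob.level (p ^ k)"
        by blast
    qed
    moreover have "finite ((\<lambda>\<beta>. dcoset (G_loc L p) (\<Gamma>_loc L p) (base_change L p \<beta>)) ` glob.level (p ^ k))"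
    proof (rule finite_image_of_coarser[where F = "\<lambda>\<beta>. glob.\<Gamma> #>\<^bsub>glob.G\<^esub> \<beta>"])
      show "finite ((\<lambda>\<beta>. glob.\<Gamma> #>\<^bsub>glob.G\<^esub> \<beta>) ` glob.level (p ^ k))"
        using finC by (simp add: left_quotient_def)
      fix x y assume xy: "x \<in> glob.level (p ^ k)" "y \<in> glob.level (p ^ k)"
        "glob.\<Gamma> #>\<^bsub>glob.G\<^esub> x = glob.\<Gamma> #>\<^bsub>glob.G\<^esub> y"
      have xyc: "x \<in> carrier glob.G" "y \<in> carrier glob.G" using xy glob.level_carrier by auto
      have "x \<in> glob.\<Gamma> #>\<^bsub>glob.G\<^esub> y"
        using glob.G.rcos_self[OF xyc(1) glob.\<Gamma>_subgroup] xy(3) by simp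
      then obtain g where g: "g \<in> glob.\<Gamma>" "x = g \<otimes>\<^bsub>glob.G\<^esub> y" by (auto simp: r_coset_def)
      have gc: "g \<in> carrier glob.G" using g(1) glob.\<Gamma>D(1) by simp
      have bg: "base_change L p g \<in> \<Gamma>_loc L p" using bc_\<Gamma>[OF p, of g] g(1) by (simp add: global_eqs)
      have yc: "base_change L p y \<in> carrier (G_loc L p)" using h.hom_closed[of y] xyc by (simp add: global_eqs)
      have "base_change L p x = base_change L p g \<otimes>\<^bsub>G_loc L p\<^esub> base_change L p y"
        using h.hom_mult[of g y] gc xyc g(2) by (simp add: global_eqs)
      also have "\<dots> = base_change L p g \<otimes>\<^bsub>G_loc L p\<^esub> base_change L p y \<otimes>\<^bsub>G_loc L p\<^esub> \<one>\<^bsub>G_loc L p\<^esub>"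
        using bg yc by simp
      finally have "base_change L p x \<in> dcoset (G_loc L p) (\<Gamma>_loc L p) (base_change L p y)"
        unfolding mem_dcoset_iff using bg l.one_closed by blast
      then show "dcoset (G_loc L p) (\<Gamma>_loc L p) (base_change L p x)
          = dcoset (G_loc L p) (\<Gamma>_loc L p) (base_change L p y)"
        by (rule l.dcoset_eq[OF yc])
    qed
    ultimately show ?thesis by (rule finite_subset)
  qed
  have Binv: "bi_invariant glob.G glob.\<Gamma> (?B Y)" if Y: "Y \<in> ?D" for Y
    unfolding bi_invariant_def
  proof (intro conjI subsetI ballI)
    fix \<beta> assume "\<beta> \<in> ?B Y"
    then show "\<beta> \<in> carrier glob.G" using glob.\<Delta>D(1) by (simp add: global_eqs)
  next
    fix g \<beta> d assume *: "g \<in> glob.\<Gamma>" "\<beta> \<in> ?B Y" "d \<in> glob.\<Gamma>"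
    have c: "g \<in> carrier (G_glob L)" "\<beta> \<in> carrier (G_glob L)" "d \<in> carrier (G_glob L)"
      using * glob.\<Gamma>D(1) glob.\<Delta>D(1) by (auto simp: global_eqs)
    have "g \<otimes>\<^bsub>glob.G\<^esub> \<beta> \<otimes>\<^bsub>glob.G\<^esub> d \<in> \<Delta>_glob L"
      using * bi_invariantD(2)[OF glob.bi_invariant_\<Delta>] by (simp add: global_eqs)
    moreover have bc: "base_change L q (g \<otimes>\<^bsub>glob.G\<^esub> \<beta> \<otimes>\<^bsub>glob.G\<^esub> d)
        = base_change L q g \<otimes>\<^bsub>G_loc L q\<^esub> base_change L q \<beta> \<otimes>\<^bsub>G_loc L q\<^esub> base_change L q d" if "prime q" for q
    proof -
      interpret hq: group_hom "G_glob L" "G_loc L q" "base_change L q" by (rule bc_hom[OF that])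
      have "base_change L q (g \<otimes>\<^bsub>G_glob L\<^esub> \<beta> \<otimes>\<^bsub>G_glob L\<^esub> d)
        = base_change L q g \<otimes>\<^bsub>G_loc L q\<^esub> base_change L q \<beta> \<otimes>\<^bsub>G_loc L q\<^esub> base_change L q d"
        using c by simp
      then show ?thesis by (simp add: global_eqs)
    qed
    have gd: "base_change L q g \<in> \<Gamma>_loc L q" "base_change L q d \<in> \<Gamma>_loc L q" if "prime q" for q
      using bc_\<Gamma>[OF that] * by (auto simp: global_eqs)
    have b: "base_change L p \<beta> \<in> Y" "\<And>q. prime q \<Longrightarrow> q \<noteq> p \<Longrightarrow> base_change L q \<beta> \<in> \<Gamma>_loc L q"
      using *(2) Bmem[OF Y] by blast+
    have "base_change L p (g \<otimes>\<^bsub>glob.G\<^esub> \<beta> \<otimes>\<^bsub>glob.G\<^esub> d) \<in> Y"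
      unfolding bc[OF p] by (rule bi_invariantD(2)[OF X[OF Y] b(1) gd[OF p]])
    moreover have "base_change L q (g \<otimes>\<^bsub>glob.G\<^esub> \<beta> \<otimes>\<^bsub>glob.G\<^esub> d) \<in> \<Gamma>_loc L q" if q: "prime q" "q \<noteq> p" for q
    proof -
      interpret lq: group_with_subgroup "G_loc L q" "\<Gamma>_loc L q" by (rule loc_group[OF q(1)])
      show ?thesis unfolding bc[OF q(1)] by (intro lq.m_closed gd[OF q(1)] b(2)[OF q])
    qed
    ultimately show "g \<otimes>\<^bsub>glob.G\<^esub> \<beta> \<otimes>\<^bsub>glob.G\<^esub> d \<in> ?B Y" using Bmem[OF Y] by blast
  qed
  have Bfin: "finite (dcosets glob.G glob.\<Gamma> (?B Y))" if "Y \<in> ?D" for Y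
  proof (rule finite_subset)
    have "?B Y \<subseteq> glob.level (p ^ k)" using level that by blast
    then show "dcosets glob.G glob.\<Gamma> (?B Y) \<subseteq> dcosets glob.G glob.\<Gamma> (glob.level (p ^ k))"
      unfolding dcosets_def by (rule image_mono)
    show "finite (dcosets glob.G glob.\<Gamma> (glob.level (p ^ k)))"
      by (rule glob.G.finite_dcosets[OF glob.bi_invariant_level finC])
  qed
  have Bdisj: "?B Y \<inter> ?B Z = {}" if YZ: "Y \<in> ?D" "Z \<in> ?D" "Y \<noteq> Z" for Y Z
  proof (rule ccontr)
    assume "?B Y \<inter> ?B Z \<noteq> {}"
    then obtain \<beta> where "base_change L p \<beta> \<in> Y" "base_change L p \<beta> \<in> Z"
      using Bmem[OF YZ(1)] Bmem[OF YZ(2)] by blast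
    moreover obtain a b where ab: "a \<in> ?A" "b \<in> ?A" "Y = dcoset (G_loc L p) (\<Gamma>_loc L p) a"
      "Z = dcoset (G_loc L p) (\<Gamma>_loc L p) b"
      using YZ(1,2) unfolding dcosets_def by blast
    ultimately have "Y = Z"
      using l.dcoset_disjoint[OF bi_invariantD(1)[OF A ab(1)] bi_invariantD(1)[OF A ab(2)], of "base_change L p \<beta>"]
      by simp
    then show False using YZ(3) by simp
  qed
  have "loc_to_glob L p (T_loc L p (p ^ k)) = (\<Sum>X\<in>?D. hecke_sum glob.G glob.\<Gamma> (?B X))"
    using finD by (simp add: loc_to_glob_def T_loc_def hecke_sum_def[of "G_loc L p"] loc_to_hat_def
        \<eta>_upper_def frag_extend_sum o_def global_eqs)
  also have "\<dots> = hecke_sum glob.G glob.\<Gamma> (\<Union>X\<in>?D. ?B X)"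
    by (rule glob.G.hecke_sum_UN[symmetric]) (use finD Binv Bfin Bdisj in auto)
  finally show ?thesis unfolding level T_glob_eq .
qed

lemma foldr_T_glob:
  assumes "distinct ps" "\<And>p. p \<in> set ps \<Longrightarrow> prime p"
  shows "foldr (\<lambda>p y. T_glob L (p ^ f p) \<otimes>\<^bsub>R_glob L\<^esub> y) ps \<one>\<^bsub>R_glob L\<^esub>
    = T_glob L (\<Prod>p\<in>set ps. p ^ f p)"
  using assms
proof (induction ps)
  case (Cons p ps)
  have "coprime (p ^ f p) (\<Prod>q\<in>set ps. q ^ f q)"
  proof (rule prod_coprime_right)
    fix q assume "q \<in> set ps"
    then have "coprime p q" using Cons.prems by (intro primes_coprime) auto
    then show "coprime (p ^ f p) (q ^ f q)" by simp
  qed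
  moreover have "p ^ f p > 0" "(\<Prod>q\<in>set ps. q ^ f q) > 0"
    using Cons.prems prime_gt_0_nat by (auto intro!: prod_pos)
  ultimately show ?case using Cons by (simp add: T_glob_mult)
qed (simp add: T_glob_1[unfolded One_nat_def])

theorem euler_product:
  "multiplicative_seq (R_glob L) (T_glob L) \<and>
    has_euler_product (R_glob L) (D_series L) (\<lambda>p k. loc_to_glob L p (P_series L p k))"
proof
  show "multiplicative_seq (R_glob L) (T_glob L)"
    unfolding multiplicative_seq_def using T_glob_1 T_glob_mult by simp
  show "has_euler_product (R_glob L) (D_series L) (\<lambda>p k. loc_to_glob L p (P_series L p k))"
    unfolding has_euler_product_def
  proof (intro allI impI)
    fix n :: nat assume n: "n > 0"
    have P: "loc_to_glob L p (P_series L p (multiplicity p n)) = T_glob L (p ^ multiplicity p n)"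
      if "prime p" for p
      unfolding P_series_def by (rule loc_to_glob_T_loc[OF that])
    show "has_formal_prod (R_glob L) (\<lambda>p. loc_to_glob L p (P_series L p (multiplicity p n))) primes (D_series L n)"
      unfolding has_formal_prod_def
    proof (intro exI[of _ "prime_factors n"] conjI ballI allI impI)
      show "prime_factors n \<subseteq> primes" by auto
      fix p assume p: "p \<in> primes - prime_factors n"
      then have "multiplicity p n = 0" by (simp add: prime_factors_multiplicity)
      then show "loc_to_glob L p (P_series L p (multiplicity p n)) = \<one>\<^bsub>R_glob L\<^esub>"
        using p P[of p] T_glob_1 by simp
    next
      fix ps assume ps: "distinct ps \<and> set ps = prime_factors n"
      have "foldr (\<lambda>p y. loc_to_glob L p (P_series L p (multiplicity p n)) \<otimes>\<^bsub>R_glob L\<^esub> y) ps \<one>\<^bsub>R_glob L\<^esub>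
        = foldr (\<lambda>p y. T_glob L (p ^ multiplicity p n) \<otimes>\<^bsub>R_glob L\<^esub> y) ps \<one>\<^bsub>R_glob L\<^esub>"
        using ps by (intro foldr_cong refl) (simp add: P in_prime_factors_imp_prime)
      also have "\<dots> = T_glob L (\<Prod>p\<in>set ps. p ^ multiplicity p n)"
        using ps by (intro foldr_T_glob) auto
      also have "(\<Prod>p\<in>set ps. p ^ multiplicity p n) = n"
        using ps prime_factorization_nat[OF n] by simp
      finally show "foldr (\<lambda>p y. loc_to_glob L p (P_series L p (multiplicity p n)) \<otimes>\<^bsub>R_glob L\<^esub> y) ps \<one>\<^bsub>R_glob L\<^esub>
        = D_series L n" by (simp add: D_series_def)
    qed simp
  qed
qed

end

theorem theorem3p2:
  fixes L :: "('a, 'm) ring_scheme" and r :: nat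
  assumes "nonassoc_algebra L"
    and "add_monoid L \<cong> free_Abelian_group {..<r}"
    and "bij_betw (\<eta>_lower L)
           (left_quotient (G_glob L) (\<Gamma>_glob L) (\<Delta>_glob L))
           (left_quotient (G_hat L) (\<Gamma>_hat L) (\<Delta>_hat L))"
  shows "multiplicative_seq (R_glob L) (T_glob L) \<and>
         has_euler_product (R_glob L) (D_series L) (\<lambda>p k. loc_to_glob L p (P_series L p k))"
proof -
  obtain e c where ec: "based_algebra L r e c"
    using based_algebra_of_iso[OF assms(1,2)] by blast
  have "class_number_one L r e c"
    using assms(3) ec unfolding bij_betw_def
    by (intro class_number_one.intro class_number_one_axioms.intro) auto
  then show ?thesis by (rule class_number_one.euler_product)
qed

end
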